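(* Let $n\ge 1$. The Chen ranks $\theta_k=\theta_k(P\Sigma_n^+)$ of the upper McCool group $P\Sigma_n^+$ are given by $\theta_1=\binom{n}{2}$, $\theta_2=\binom{n}{3}$, and $$\theta_k=\binom{n+1}{4}+\sum_{i=3}^{k}\binom{n+i-2}{i+1}\qquad\text{for all } k\ge 3 .$$
   Context: Let $F_n$ be the free group on $x_1,\dots,x_n$. For $1\le i\neq j\le n$ let $\alpha_{ij}\in\mathrm{Aut}(F_n)$ be the automorphism sending $x_i\mapsto x_jx_ix_j^{-1}$ and fixing $x_l$ for $l\ne i$. The upper (triangular) McCool group $P\Sigma_n^+$ is the subgroup of $\mathrm{Aut}(F_n)$ generated by the $\alpha_{ij}$ with $i>j$. For a finitely generated group $G$, the lower central series is $\Gamma_1G=G$, $\Gamma_{k}G=[G,\Gamma_{k-1}G]$, and $\mathrm{gr}_k(G)=\Gamma_kG/\Gamma_{k+1}G$. With $G''=[G',G']$ the second derived subgroup, the $k$-th Chen rank of $G$ is $\theta_k(G)=\mathrm{rank}\,\mathrm{gr}_k(G/G'')$. *)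

theory Defs
  imports "HOL-Algebra.Bij" "HOL-Algebra.FiniteProduct" "HOL-Algebra.Generated_Groups"
    "HOL-Library.Extended_Nat"
begin

section \<open>Free groups as groups of reduced words\<close>

text \<open>The letter \<open>(x, True)\<close> stands for the generator \<open>x\<close>, and \<open>(x, False)\<close> for its inverse.\<close>

type_synonym 'a word = "('a \<times> bool) list"

definition flip_letter :: "'a \<times> bool \<Rightarrow> 'a \<times> bool"
  where "flip_letter a = (fst a, \<not> snd a)"

fun reduced :: "'a word \<Rightarrow> bool" where
  "reduced [] \<longleftrightarrow> True"
| "reduced [a] \<longleftrightarrow> True"
| "reduced (a # b # w) \<longleftrightarrow> b \<noteq> flip_letter a \<and> reduced (b # w)"

text \<open>The reduced form of \<open>a # w\<close>, for a letter \<open>a\<close> and a reduced word \<open>w\<close>.\<close>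

fun push_letter :: "'a \<times> bool \<Rightarrow> 'a word \<Rightarrow> 'a word" where
  "push_letter a [] = [a]"
| "push_letter a (b # w) = (if b = flip_letter a then w else a # b # w)"

definition free_group :: "'a set \<Rightarrow> 'a word monoid" where
  "free_group X =
    \<lparr>carrier = {w. reduced w \<and> fst ` set w \<subseteq> X},
     mult = (\<lambda>u v. foldr push_letter u v),
     one = []\<rparr>"

definition free_gen :: "'a \<Rightarrow> 'a word"
  where "free_gen x = [(x, True)]"

text \<open>The homomorphism from a free group to \<open>G\<close> that sends each generator \<open>x\<close> to \<open>f x\<close>.\<close>

definition free_lift :: "('b, 'c) monoid_scheme \<Rightarrow> ('a \<Rightarrow> 'b) \<Rightarrow> 'a word \<Rightarrow> 'b" where
  "free_lift G f w =
    foldr (\<lambda>a g. (if snd a then f (fst a) else inv\<^bsub>G\<^esub> (f (fst a))) \<otimes>\<^bsub>G\<^esub> g) w \<one>\<^bsub>G\<^esub>"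

lemma flip_flip [simp]: "flip_letter (flip_letter a) = a"
  by (simp add: flip_letter_def)

lemma flip_neq [simp]: "flip_letter a \<noteq> a" "a \<noteq> flip_letter a"
  by (auto simp: flip_letter_def prod_eq_iff)

lemma fst_flip [simp]: "fst (flip_letter a) = fst a"
  by (simp add: flip_letter_def)

lemma reduced_ConsD: "reduced (a # w) \<Longrightarrow> reduced w"
  by (cases w) auto

lemma reduced_push: "reduced w \<Longrightarrow> reduced (push_letter a w)"
  by (cases w) (auto dest: reduced_ConsD)

lemma push_Cons_reduced: "reduced (a # w) \<Longrightarrow> push_letter a w = a # w"
  by (cases w) auto

lemma push_flip: "reduced w \<Longrightarrow> push_letter a (push_letter (flip_letter a) w) = w"
  by (cases w) (auto simp: push_Cons_reduced)

lemma push_flip': "reduced w \<Longrightarrow> push_letter (flip_letter a) (push_letter a w) = w"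
  using push_flip[of w "flip_letter a"] by simp

lemma reduced_foldr_push: "reduced v \<Longrightarrow> reduced (foldr push_letter u v)"
  by (induction u) (auto simp: reduced_push)

lemma set_push: "set (push_letter a w) \<subseteq> insert a (set w)"
  by (cases w) auto

lemma set_foldr_push: "set (foldr push_letter u v) \<subseteq> set u \<union> set v"
proof (induction u)
  case (Cons a u)
  then show ?case using set_push[of a "foldr push_letter u v"] by auto
qed auto

lemma foldr_push_Nil: "reduced u \<Longrightarrow> foldr push_letter u [] = u"
proof (induction u)
  case (Cons a u)
  then show ?case using reduced_ConsD[OF Cons.prems] by (simp add: push_Cons_reduced)
qed simp

lemma foldr_push_push:
  assumes "reduced w"
  shows "foldr push_letter (push_letter a u) w = push_letter a (foldr push_letter u w)"
  using assms by (cases u) (auto simp: push_flip reduced_foldr_push)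

lemma foldr_push_assoc:
  assumes "reduced w"
  shows "foldr push_letter (foldr push_letter u v) w
       = foldr push_letter u (foldr push_letter v w)"
  using assms by (induction u) (auto simp: foldr_push_push)

lemma foldr_push_inverse:
  assumes "reduced w"
  shows "foldr push_letter (rev (map flip_letter u)) (foldr push_letter u w) = w"
  using assms by (induction u) (auto simp: push_flip' reduced_foldr_push)

theorem group_free_group: "group (free_group X)"
proof (rule groupI)
  fix u assume u: "u \<in> carrier (free_group X)"
  let ?v = "foldr push_letter (rev (map flip_letter u)) []"
  have "set ?v \<subseteq> flip_letter ` set u"
    using set_foldr_push[of "rev (map flip_letter u)" "[]"] by simp
  then have "?v \<in> carrier (free_group X)"
    using u by (fastforce simp: free_group_def reduced_foldr_push)
  moreover have "foldr push_letter ?v u = []"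
    using u foldr_push_inverse[of "[]" u]
    by (simp add: free_group_def foldr_push_assoc foldr_push_Nil)
  ultimately show "\<exists>v\<in>carrier (free_group X). v \<otimes>\<^bsub>free_group X\<^esub> u = \<one>\<^bsub>free_group X\<^esub>"
    by (auto simp: free_group_def)
next
  fix u v
  assume "u \<in> carrier (free_group X)" "v \<in> carrier (free_group X)"
  then show "u \<otimes>\<^bsub>free_group X\<^esub> v \<in> carrier (free_group X)"
    using set_foldr_push[of u v] by (fastforce simp: free_group_def reduced_foldr_push)
qed (auto simp: free_group_def foldr_push_assoc)

lemma free_gen_closed: "x \<in> X \<Longrightarrow> free_gen x \<in> carrier (free_group X)"
  by (simp add: free_group_def free_gen_def)

lemma inv_free_gen:
  assumes "x \<in> X" shows "inv\<^bsub>free_group X\<^esub> (free_gen x) = [(x, False)]"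
  by (rule group.inv_equality[OF group_free_group])
     (use assms in \<open>auto simp: free_group_def free_gen_def flip_letter_def\<close>)

context group
begin

lemma free_lift_closed:
  assumes "f \<in> X \<rightarrow> carrier G" "fst ` set w \<subseteq> X"
  shows "free_lift G f w \<in> carrier G"
  using assms(2)
proof (induction w)
  case (Cons a w)
  then have "f (fst a) \<in> carrier G" "free_lift G f w \<in> carrier G" using assms(1) by auto
  then show ?case by (simp add: free_lift_def)
qed (simp add: free_lift_def)

lemma free_lift_push:
  assumes f: "f \<in> X \<rightarrow> carrier G" and a: "fst a \<in> X" and w: "fst ` set w \<subseteq> X"
  shows "free_lift G f (push_letter a w)
       = (if snd a then f (fst a) else inv (f (fst a))) \<otimes> free_lift G f w"
proof (cases w)
  case (Cons b v)
  have c: "f (fst a) \<in> carrier G" "free_lift G f v \<in> carrier G"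
    using f a free_lift_closed[OF f, of v] w Cons by auto
  show ?thesis
    using c by (auto simp: Cons free_lift_def flip_letter_def m_assoc[symmetric])
qed (simp add: free_lift_def)

theorem free_lift_hom:
  assumes f: "f \<in> X \<rightarrow> carrier G"
  shows "free_lift G f \<in> hom (free_group X) G"
proof (rule homI)
  fix u v
  assume "u \<in> carrier (free_group X)" "v \<in> carrier (free_group X)"
  then have "fst ` set u \<subseteq> X" and v: "fst ` set v \<subseteq> X"
    by (auto simp: free_group_def)
  from this(1)
  have "free_lift G f (foldr push_letter u v) = free_lift G f u \<otimes> free_lift G f v"
  proof (induction u)
    case Nil
    then show ?case using free_lift_closed[OF f v] by (simp add: free_lift_def)
  next
    case (Cons a u)
    have s: "fst ` set (foldr push_letter u v) \<subseteq> X"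
      using set_foldr_push[of u v] Cons.prems v by fastforce
    have c: "f (fst a) \<in> carrier G" "free_lift G f u \<in> carrier G" "free_lift G f v \<in> carrier G"
      using f Cons.prems v free_lift_closed[OF f] by auto
    have "free_lift G f (foldr push_letter (a # u) v)
        = (if snd a then f (fst a) else inv (f (fst a))) \<otimes> (free_lift G f u \<otimes> free_lift G f v)"
      using Cons free_lift_push[OF f _ s, of a] by simp
    also have "\<dots> = free_lift G f (a # u) \<otimes> free_lift G f v"
      using c by (simp add: free_lift_def m_assoc)
    finally show ?case .
  qed
  then show "free_lift G f (u \<otimes>\<^bsub>free_group X\<^esub> v) = free_lift G f u \<otimes> free_lift G f v"
    by (simp add: free_group_def)
qed (use free_lift_closed[OF f] in \<open>auto simp: free_group_def\<close>)

lemma free_lift_gen: "f x \<in> carrier G \<Longrightarrow> free_lift G f (free_gen x) = f x"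
  by (simp add: free_lift_def free_gen_def)

theorem free_lift_unique:
  assumes h: "h \<in> hom (free_group X) G" and f: "\<And>x. x \<in> X \<Longrightarrow> h (free_gen x) = f x"
    and w: "w \<in> carrier (free_group X)"
  shows "h w = free_lift G f w"
proof -
  interpret F: group "free_group X" by (rule group_free_group)
  interpret H: group_hom "free_group X" G h
    using h by unfold_locales
  have "reduced w" "fst ` set w \<subseteq> X" using w by (auto simp: free_group_def)
  then show ?thesis
  proof (induction w)
    case Nil
    then show ?case using H.hom_one by (simp add: free_lift_def free_group_def)
  next
    case (Cons a w)
    have a: "[a] \<in> carrier (free_group X)" "w \<in> carrier (free_group X)"
      using Cons.prems by (auto simp: free_group_def dest: reduced_ConsD)
    have x: "fst a \<in> X" using Cons.prems by auto
    have "a # w = [a] \<otimes>\<^bsub>free_group X\<^esub> w"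
      using Cons.prems by (simp add: free_group_def push_Cons_reduced)
    then have "h (a # w) = h [a] \<otimes> h w" using a by simp
    moreover have "h [a] = (if snd a then f (fst a) else inv (f (fst a)))"
    proof (cases "snd a")
      case True
      then have "[a] = free_gen (fst a)" by (simp add: free_gen_def prod_eq_iff)
      then show ?thesis using f[OF x] True by simp
    next
      case False
      then have "[a] = inv\<^bsub>free_group X\<^esub> (free_gen (fst a))"
        by (simp add: inv_free_gen[OF x] prod_eq_iff)
      then show ?thesis using f[OF x] False free_gen_closed[OF x] by simp
    qed
    moreover have "h w = free_lift G f w"
      using Cons by (auto dest: reduced_ConsD)
    ultimately show ?case by (simp add: free_lift_def)
  qed
qed

end

lemma free_group_endo_eqI:
  assumes "h \<in> hom (free_group X) (free_group X)"
    and "\<And>x. x \<in> X \<Longrightarrow> h (free_gen x) = free_gen x"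
    and "w \<in> carrier (free_group X)"
  shows "h w = w"
proof -
  have "id \<in> hom (free_group X) (free_group X)" by (auto simp: hom_def)
  then show ?thesis
    using group.free_lift_unique[OF group_free_group assms]
      group.free_lift_unique[OF group_free_group, of id X X free_gen w] assms(3)
    by auto
qed


section \<open>The upper McCool groups\<close>

abbreviation Free :: "nat \<Rightarrow> nat word monoid"
  where "Free n \<equiv> free_group {1..n}"

definition alpha :: "nat \<Rightarrow> nat \<Rightarrow> nat \<Rightarrow> nat word \<Rightarrow> nat word" where
  "alpha n i j = restrict
    (free_lift (Free n) (\<lambda>l.
      if l = i then free_gen j \<otimes>\<^bsub>Free n\<^esub> free_gen i \<otimes>\<^bsub>Free n\<^esub> inv\<^bsub>Free n\<^esub> (free_gen j)
      else free_gen l))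
    (carrier (Free n))"

definition upper_McCool_gens :: "nat \<Rightarrow> (nat word \<Rightarrow> nat word) set"
  where "upper_McCool_gens n = {alpha n i j | i j. 1 \<le> j \<and> j < i \<and> i \<le> n}"

definition upper_McCool :: "nat \<Rightarrow> (nat word \<Rightarrow> nat word) monoid" where
  "upper_McCool n =
    (AutoGroup (Free n)) \<lparr>carrier := generate (AutoGroup (Free n)) (upper_McCool_gens n)\<rparr>"

lemma alpha_gen:
  assumes "i \<in> {1..n}" "j \<in> {1..n}"
  shows "alpha n i j (free_gen i)
       = free_gen j \<otimes>\<^bsub>Free n\<^esub> free_gen i \<otimes>\<^bsub>Free n\<^esub> inv\<^bsub>Free n\<^esub> (free_gen j)"
    and "\<And>l. \<lbrakk>l \<in> {1..n}; l \<noteq> i\<rbrakk> \<Longrightarrow> alpha n i j (free_gen l) = free_gen l"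
proof -
  interpret group "Free n" by (rule group_free_group)
  note One_nat_def [simp del]
  show "alpha n i j (free_gen i)
      = free_gen j \<otimes>\<^bsub>Free n\<^esub> free_gen i \<otimes>\<^bsub>Free n\<^esub> inv\<^bsub>Free n\<^esub> (free_gen j)"
    using assms by (simp add: alpha_def free_lift_gen free_gen_closed)
  show "\<And>l. \<lbrakk>l \<in> {1..n}; l \<noteq> i\<rbrakk> \<Longrightarrow> alpha n i j (free_gen l) = free_gen l"
    by (simp add: alpha_def free_lift_gen free_gen_closed)
qed

theorem alpha_auto:
  assumes ij: "i \<in> {1..n}" "j \<in> {1..n}" "i \<noteq> j"
  shows "alpha n i j \<in> carrier (AutoGroup (Free n))"
proof -
  interpret group "Free n" by (rule group_free_group)
  note One_nat_def [simp del]
  let ?C = "carrier (Free n)"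
  define a where "a = free_lift (Free n) (\<lambda>l. if l = i
      then free_gen j \<otimes>\<^bsub>Free n\<^esub> free_gen i \<otimes>\<^bsub>Free n\<^esub> inv\<^bsub>Free n\<^esub> (free_gen j) else free_gen l)"
  define b where "b = free_lift (Free n) (\<lambda>l. if l = i
      then inv\<^bsub>Free n\<^esub> (free_gen j) \<otimes>\<^bsub>Free n\<^esub> free_gen i \<otimes>\<^bsub>Free n\<^esub> free_gen j else free_gen l)"
  have g: "free_gen l \<in> ?C" if "l \<in> {1..n}" for l
    using that by (rule free_gen_closed)
  have gi: "free_gen i \<in> ?C" "free_gen j \<in> ?C" using ij g by auto
  have ha: "a \<in> hom (Free n) (Free n)" unfolding a_def
    by (rule free_lift_hom) (use gi g in auto)
  have hb: "b \<in> hom (Free n) (Free n)" unfolding b_def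
    by (rule free_lift_hom) (use gi g in auto)
  interpret A: group_hom "Free n" "Free n" a using ha by unfold_locales
  interpret B: group_hom "Free n" "Free n" b using hb by unfold_locales
  have ag: "a (free_gen i) = free_gen j \<otimes>\<^bsub>Free n\<^esub> free_gen i \<otimes>\<^bsub>Free n\<^esub> inv\<^bsub>Free n\<^esub> (free_gen j)"
    "\<And>l. l \<in> {1..n} \<Longrightarrow> l \<noteq> i \<Longrightarrow> a (free_gen l) = free_gen l"
    unfolding a_def using g gi by (simp_all add: free_lift_gen)
  have bg: "b (free_gen i) = inv\<^bsub>Free n\<^esub> (free_gen j) \<otimes>\<^bsub>Free n\<^esub> free_gen i \<otimes>\<^bsub>Free n\<^esub> free_gen j"
    "\<And>l. l \<in> {1..n} \<Longrightarrow> l \<noteq> i \<Longrightarrow> b (free_gen l) = free_gen l"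
    unfolding b_def using g gi by (simp_all add: free_lift_gen)
  have cancel: "inv\<^bsub>Free n\<^esub> x \<otimes>\<^bsub>Free n\<^esub> (x \<otimes>\<^bsub>Free n\<^esub> y) = y"
    "x \<otimes>\<^bsub>Free n\<^esub> (inv\<^bsub>Free n\<^esub> x \<otimes>\<^bsub>Free n\<^esub> y) = y" if "x \<in> ?C" "y \<in> ?C" for x y
    using that by (simp_all add: m_assoc[symmetric])
  have ab: "(a \<circ> b) w = w" if "w \<in> ?C" for w
  proof (rule free_group_endo_eqI[OF _ _ that])
    show "a \<circ> b \<in> hom (Free n) (Free n)" by (rule Group.hom_compose[OF hb ha])
    show "(a \<circ> b) (free_gen l) = free_gen l" if "l \<in> {1..n}" for l
      using that ij gi ag bg g by (cases "l = i") (auto simp: m_assoc cancel)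
  qed
  have ba: "(b \<circ> a) w = w" if "w \<in> ?C" for w
  proof (rule free_group_endo_eqI[OF _ _ that])
    show "b \<circ> a \<in> hom (Free n) (Free n)" by (rule Group.hom_compose[OF ha hb])
    show "(b \<circ> a) (free_gen l) = free_gen l" if "l \<in> {1..n}" for l
      using that ij gi ag bg g by (cases "l = i") (auto simp: m_assoc cancel)
  qed
  have "bij_betw a ?C ?C"
    by (rule bij_betw_byWitness[of _ b]) (use ab ba in auto)
  then have "bij_betw (restrict a ?C) ?C ?C" by (simp add: bij_betw_restrict_eq)
  moreover have "restrict a ?C \<in> hom (Free n) (Free n)"
    using ha by (auto simp: hom_def)
  ultimately show ?thesis
    by (auto simp: alpha_def a_def[symmetric] AutoGroup_def auto_def Bij_def)
qed

theorem group_upper_McCool: "group (upper_McCool n)"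
proof -
  interpret A: group "AutoGroup (Free n)" by (rule group.AutoGroup[OF group_free_group])
  have "upper_McCool_gens n \<subseteq> carrier (AutoGroup (Free n))"
    by (auto simp: upper_McCool_gens_def simp del: One_nat_def intro!: alpha_auto)
  then show ?thesis
    unfolding upper_McCool_def by (intro A.subgroup_imp_group A.generate_is_subgroup)
qed


section \<open>Lower central series and Chen ranks\<close>

definition commutator_subgroup :: "('a, 'b) monoid_scheme \<Rightarrow> 'a set \<Rightarrow> 'a set \<Rightarrow> 'a set" where
  "commutator_subgroup G H K =
    generate G (\<Union>h\<in>H. \<Union>k\<in>K. {h \<otimes>\<^bsub>G\<^esub> k \<otimes>\<^bsub>G\<^esub> inv\<^bsub>G\<^esub> h \<otimes>\<^bsub>G\<^esub> inv\<^bsub>G\<^esub> k})"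

text \<open>The series starts at index 1; the value at 0 is a dummy.\<close>

fun lower_central :: "('a, 'b) monoid_scheme \<Rightarrow> nat \<Rightarrow> 'a set" where
  "lower_central G 0 = carrier G"
| "lower_central G (Suc 0) = carrier G"
| "lower_central G (Suc (Suc k)) = commutator_subgroup G (carrier G) (lower_central G (Suc k))"

definition gr :: "('a, 'b) monoid_scheme \<Rightarrow> nat \<Rightarrow> 'a set monoid" where
  "gr G k = (G \<lparr>carrier := lower_central G k\<rparr>) Mod (lower_central G (Suc k))"

text \<open>
  The rank of an abelian group (written multiplicatively) is the maximal size of a finite
  subset that is linearly independent over the integers. It is taken in \<^typ>\<open>enat\<close>, so that
  infinite rank is the value \<open>\<infinity>\<close> and not a junk number.
\<close>

definition int_independent :: "('a, 'b) monoid_scheme \<Rightarrow> 'a set \<Rightarrow> bool" where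
  "int_independent A S \<longleftrightarrow>
    (\<forall>c :: 'a \<Rightarrow> int. (\<Otimes>\<^bsub>A\<^esub>s\<in>S. s [^]\<^bsub>A\<^esub> c s) = \<one>\<^bsub>A\<^esub> \<longrightarrow> (\<forall>s\<in>S. c s = 0))"

definition ab_rank :: "('a, 'b) monoid_scheme \<Rightarrow> enat" where
  "ab_rank A = Sup {enat (card S) | S. finite S \<and> S \<subseteq> carrier A \<and> int_independent A S}"

definition second_derived :: "('a, 'b) monoid_scheme \<Rightarrow> 'a set"
  where "second_derived G = derived G (derived G (carrier G))"

definition chen_rank :: "('a, 'b) monoid_scheme \<Rightarrow> nat \<Rightarrow> enat"
  where "chen_rank G k = ab_rank (gr (G Mod second_derived G) k)"

lemma (in group) second_derived_normal: "second_derived G \<lhd> G"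
  unfolding second_derived_def by (intro derived_is_normal normal_self)

lemma (in group) commutator_subgroup_normal:
  assumes "N \<lhd> G"
  shows "commutator_subgroup G (carrier G) N \<lhd> G" "commutator_subgroup G (carrier G) N \<subseteq> N"
proof -
  interpret N: normal N G by (rule assms)
  let ?S = "\<Union>h\<in>carrier G. \<Union>k\<in>N. {h \<otimes> k \<otimes> inv h \<otimes> inv k}"
  have sub: "?S \<subseteq> N"
    using N.inv_op_closed2 by auto
  then show "commutator_subgroup G (carrier G) N \<subseteq> N"
    unfolding commutator_subgroup_def
    by (intro generate_subgroup_incl N.subgroup_axioms)
  show "commutator_subgroup G (carrier G) N \<lhd> G"
    unfolding commutator_subgroup_def
  proof (rule normal_generateI)
    show "?S \<subseteq> carrier G" using sub N.subset by blast
    fix s g assume "s \<in> ?S" and g: "g \<in> carrier G"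
    then obtain h k where h: "h \<in> carrier G" and k: "k \<in> N"
      and s: "s = h \<otimes> k \<otimes> inv h \<otimes> inv k" by auto
    have kc: "k \<in> carrier G" using k N.subset by auto
    let ?h = "g \<otimes> h \<otimes> inv g" and ?k = "g \<otimes> k \<otimes> inv g"
    have "inv g \<otimes> (g \<otimes> x) = x" if "x \<in> carrier G" for x
      using that g by (simp add: m_assoc[symmetric])
    then have "g \<otimes> s \<otimes> inv g = ?h \<otimes> ?k \<otimes> inv ?h \<otimes> inv ?k"
      using g h kc by (simp add: s m_assoc inv_mult_group)
    moreover have "?h \<in> carrier G" "?k \<in> N" using g h k N.inv_op_closed2 by auto
    ultimately show "g \<otimes> s \<otimes> inv g \<in> ?S" by blast
  qed
qed

lemma (in group) lower_central_normal:
  "lower_central G k \<lhd> G"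
proof (induction k)
  case (Suc k)
  then show ?case by (cases k) (simp_all add: normal_self commutator_subgroup_normal)
qed (simp add: normal_self)

lemma (in group) lower_central_Suc_subset: "lower_central G (Suc k) \<subseteq> lower_central G k"
proof (cases k)
  case (Suc m)
  then show ?thesis
    using commutator_subgroup_normal(2)[OF lower_central_normal[of "Suc m"]] by simp
qed simp

theorem (in group) comm_group_gr:
  assumes "k \<ge> 1" shows "comm_group (gr G k)"
proof -
  let ?H = "G \<lparr>carrier := lower_central G k\<rparr>" and ?N = "lower_central G (Suc k)"
  interpret H: normal "lower_central G k" G by (rule lower_central_normal)
  interpret M: normal ?N G by (rule lower_central_normal)
  have "?N \<lhd> ?H"
    by (rule normal_restrict_supergroup[OF H.subgroup_axioms M.normal_axioms
          lower_central_Suc_subset])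
  then interpret N: normal ?N ?H .
  have k: "?N = commutator_subgroup G (carrier G) (lower_central G k)"
    using assms by (cases k) auto
  show ?thesis
    unfolding gr_def
  proof (rule group.group_comm_groupI[OF N.factorgroup_is_group])
    fix X Y assume "X \<in> carrier (?H Mod ?N)" "Y \<in> carrier (?H Mod ?N)"
    then obtain x y where xy: "x \<in> lower_central G k" "y \<in> lower_central G k"
      and X: "X = ?N #>\<^bsub>?H\<^esub> x" and Y: "Y = ?N #>\<^bsub>?H\<^esub> y"
      by (auto simp: carrier_FactGroup)
    then have c: "x \<in> carrier G" "y \<in> carrier G" using H.subset by auto
    have "x \<otimes> y \<otimes> inv x \<otimes> inv y \<in> ?N"
      unfolding k commutator_subgroup_def using c xy by (intro generate.incl) blast
    moreover have "x \<otimes> y = (x \<otimes> y \<otimes> inv x \<otimes> inv y) \<otimes> (y \<otimes> x)"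
      using c by (simp add: m_assoc inv_solve_left')
    ultimately have "x \<otimes> y \<in> ?N #> (y \<otimes> x)"
      unfolding r_coset_def by blast
    then have "?N #> (x \<otimes> y) = ?N #> (y \<otimes> x)"
      using repr_independence[OF _ _ M.subgroup_axioms] c by (metis m_closed)
    then have "?N #>\<^bsub>?H\<^esub> (x \<otimes> y) = ?N #>\<^bsub>?H\<^esub> (y \<otimes> x)"
      by (simp add: r_coset_def)
    then show "X \<otimes>\<^bsub>?H Mod ?N\<^esub> Y = Y \<otimes>\<^bsub>?H Mod ?N\<^esub> X"
      using N.rcos_sum xy by (simp add: X Y)
  qed
qed

end

theory Submission
  imports Defs "HOL-Library.Multiset" "HOL-Computational_Algebra.Primes"
    "HOL-Computational_Algebra.Polynomial" "HOL-Computational_Algebra.Formal_Power_Series"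
begin

text \<open>Let \<open>M = G/G''\<close>. Commutation with the generators \<open>a\<^sub>i\<^sub>j\<close> makes \<open>M'\<close> a module over a
  polynomial ring in variables \<open>x\<^sub>i\<^sub>j\<close>, up to higher commutators, and \<open>gr\<^sub>r\<^sub>+\<^sub>2 M\<close> is its part of degree
  \<open>r\<close>. It is generated by the \<open>e\<^sub>i\<^sub>;\<^sub>j\<^sub>k = [a\<^sub>i\<^sub>j, a\<^sub>i\<^sub>k]\<close>, and the Jacobi identity turns the defining
  relations into rewrite rules: \<open>x\<^sub>k\<^sub>b e\<^sub>i\<^sub>;\<^sub>k\<^sub>j = x\<^sub>i\<^sub>j e\<^sub>i\<^sub>;\<^sub>b\<^sub>k\<close> and
  \<open>x\<^sub>p\<^sub>i (e\<^sub>i\<^sub>;\<^sub>j\<^sub>k + e\<^sub>p\<^sub>;\<^sub>j\<^sub>k) = 0\<close>, while the remaining \<open>x\<^sub>p\<^sub>q\<close> with \<open>p \<noteq> i\<close> annihilate \<open>e\<^sub>i\<^sub>;\<^sub>j\<^sub>k\<close>.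
  Hence only the variables \<open>x\<^sub>i\<^sub>q\<close> are needed on \<open>e\<^sub>i\<^sub>;\<^sub>j\<^sub>k\<close>, and \<open>x\<^sub>i\<^sub>q x\<^sub>i\<^sub>l e\<^sub>i\<^sub>;\<^sub>b\<^sub>c = 0\<close> for
  \<open>b, c < l \<noteq> q\<close>. Together with the Koszul relation this leaves a spanning set indexed by multisets.

  It is linearly independent because two families of representations by triangular matrices of
  size 2 over power series separate its elements: the leading coefficient of the upper right entry
  is an additive function on \<open>gr\<^sub>k M\<close>. These representations exist because they occur inside the
  Magnus representation of \<open>Aut(F\<^sub>n)\<close> after specialising the variables. The second family has
  coefficients in \<open>\<rat>[\<nu>\<^sub>1, \<nu>\<^sub>2]/(\<nu>\<^sub>1\<^sup>2, \<nu>\<^sub>2\<^sup>2)\<close>; it detects the part of the module that is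
  invisible on the reduced support.\<close>

section \<open>Linear dependence over the integers and the rank of an abelian group\<close>

text \<open>Why scalars do not suffice: by the Koszul relation the two choices in degree
  \<open>{b, c, l, ..., l}\<close> differ by \<open>x_l^r e_{i;bc}\<close>, and every
  \<open>x_{iq}\<close> with \<open>q \<noteq> l\<close> kills this element. Under a triangular
  representation over an integral domain its value is a multiple of
  \<open>\<delta>_b D_c - \<delta>_c D_b\<close>. Were it nonzero, its annihilation by
  \<open>x_{ib}\<close> and \<open>x_{ic}\<close> would force
  \<open>\<delta>_b = \<delta>_c = 0\<close>, which makes it zero. A nilpotent
  \<open>\<delta>_c\<close> avoids this: it contributes to the value and still annihilates it.

  Why the Magnus representation: the group is given by generators inside the automorphisms of the
  free group, so prescribing matrices for the generators does not by itself define a homomorphism.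
  The pairs (generator, matrix) generate a subgroup of a product of groups, which has to be the
  graph of a map. The matrices are realised on vectors moved by the Magnus representation, and this
  forces the matrix over the identity automorphism to be trivial. Thus the upper bound rests on
  relations verified in the group, and the representations show that no hidden relation makes the
  graded pieces smaller.\<close>

lemma int_vectors_dependent:
  fixes A :: "'s \<Rightarrow> 'i \<Rightarrow> int"
  assumes "finite I" "finite S" "card I < card S"
  shows "\<exists>c. (\<exists>s\<in>S. c s \<noteq> 0) \<and> (\<forall>i\<in>I. (\<Sum>s\<in>S. c s * A s i) = 0)"
  using assms
proof (induction I arbitrary: S A rule: finite_induct)
  case empty
  then have "S \<noteq> {}" by auto
  then show ?case by (intro exI[of _ "\<lambda>_. 1"]) auto
next
  case (insert i I)
  show ?case
  proof (cases "\<forall>s\<in>S. A s i = 0")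
    case True
    obtain c where "\<exists>s\<in>S. c s \<noteq> 0" "\<forall>i\<in>I. (\<Sum>s\<in>S. c s * A s i) = 0"
      using insert.IH[of S A] insert.prems insert.hyps by auto
    then show ?thesis using True by (intro exI[of _ c]) auto
  next
    case False
    then obtain t where t: "t \<in> S" "A t i \<noteq> 0" by auto
    define S' where "S' = S - {t}"
    have S: "S = insert t S'" "t \<notin> S'" "finite S'" using t insert.prems by (auto simp: S'_def)
    \<comment> \<open>Cross-multiplication with the pivot row \<open>t\<close> clears coordinate
      \<open>i\<close> without division, so the elimination stays over the integers.\<close>
    define B where "B s j = A t i * A s j - A s i * A t j" for s j
    have "card I < card S'" using insert.prems insert.hyps S by auto
    then obtain c where c: "\<exists>s\<in>S'. c s \<noteq> 0" "\<forall>j\<in>I. (\<Sum>s\<in>S'. c s * B s j) = 0"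
      using insert.IH[of S' B] S by auto
    \<comment> \<open>The coefficient of \<open>t\<close> is chosen so that the rows
      \<open>A\<close> combined with \<open>d\<close> agree with the rows \<open>B\<close> combined
      with \<open>c\<close> in every coordinate; coordinate \<open>i\<close> then vanishes because
      \<open>B s i = 0\<close>.\<close>
    define d where "d s = (if s = t then - (\<Sum>s\<in>S'. c s * A s i) else A t i * c s)" for s
    have "(\<Sum>s\<in>S. d s * A s j) = (\<Sum>s\<in>S'. c s * B s j)" for j
    proof -
      have "(\<Sum>s\<in>S'. d s * A s j) = (\<Sum>s\<in>S'. A t i * c s * A s j)"
        using S by (intro sum.cong) (auto simp: d_def)
      then have "(\<Sum>s\<in>S. d s * A s j)
          = - (\<Sum>s\<in>S'. c s * A s i) * A t j + (\<Sum>s\<in>S'. A t i * c s * A s j)"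
        using S by (simp add: d_def)
      also have "\<dots> = (\<Sum>s\<in>S'. c s * B s j)"
        by (simp add: B_def sum_distrib_right sum_distrib_left right_diff_distrib sum_subtractf mult_ac)
      finally show ?thesis .
    qed
    moreover have "B s i = 0" for s by (simp add: B_def)
    moreover have "\<exists>s\<in>S. d s \<noteq> 0" using c(1) S t by (auto simp: d_def)
    ultimately show ?thesis using c(2) by (intro exI[of _ d]) auto
  qed
qed

context comm_group
begin

lemma int_pow_finprod:
  assumes "f \<in> I \<rightarrow> carrier G"
  shows "(\<Otimes>i\<in>I. f i) [^] (k::int) = (\<Otimes>i\<in>I. f i [^] k)"
  using assms
proof (induction I rule: infinite_finite_induct)
  case (insert i I)
  then have "f i \<in> carrier G" "(\<Otimes>i\<in>I. f i) \<in> carrier G" "(\<lambda>i. f i [^] k) \<in> I \<rightarrow> carrier G"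
    by auto
  then show ?case using insert by (simp add: int_pow_distrib)
qed (auto simp: int_pow_one)

lemma finprod_int_pow_sum:
  assumes "finite S" "x \<in> carrier G"
  shows "(\<Otimes>s\<in>S. x [^] (a s :: int)) = x [^] (\<Sum>s\<in>S. a s)"
  using assms by (induction S rule: finite_induct) (auto simp: int_pow_mult)

lemma finprod_swap:
  assumes "finite S" "finite I" "\<And>s i. s \<in> S \<Longrightarrow> i \<in> I \<Longrightarrow> f s i \<in> carrier G"
  shows "(\<Otimes>s\<in>S. \<Otimes>i\<in>I. f s i) = (\<Otimes>i\<in>I. \<Otimes>s\<in>S. f s i)"
  using assms(1,3)
proof (induction S rule: finite_induct)
  case empty
  then show ?case by simp
next
  case (insert t S)
  have "(\<lambda>i. f t i) \<in> I \<rightarrow> carrier G" "(\<lambda>i. \<Otimes>s\<in>S. f s i) \<in> I \<rightarrow> carrier G"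
    using insert.prems by (auto intro!: finprod_closed)
  moreover have "(\<Otimes>i\<in>I. \<Otimes>s\<in>insert t S. f s i) = (\<Otimes>i\<in>I. f t i \<otimes> (\<Otimes>s\<in>S. f s i))"
    using insert by (intro finprod_cong') (auto intro!: finprod_closed)
  moreover have "(\<Otimes>s\<in>insert t S. \<Otimes>i\<in>I. f s i) = (\<Otimes>i\<in>I. f t i) \<otimes> (\<Otimes>s\<in>S. \<Otimes>i\<in>I. f s i)"
    using insert by (subst finprod_insert) (auto intro!: finprod_closed)
  moreover have "(\<Otimes>s\<in>S. \<Otimes>i\<in>I. f s i) = (\<Otimes>i\<in>I. \<Otimes>s\<in>S. f s i)"
    using insert by auto
  ultimately show ?case by simp
qed

lemma generate_image_finprod:
  assumes I: "finite I" and y: "y \<in> I \<rightarrow> carrier G" and x: "x \<in> generate G (y ` I)"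
  shows "\<exists>c::_ \<Rightarrow> int. x = (\<Otimes>i\<in>I. y i [^] c i)"
  using x
proof (induction x rule: generate.induct)
  case one
  then show ?case by (intro exI[of _ "\<lambda>_. 0"]) simp
next
  case (incl h)
  then obtain j where j: "j \<in> I" "h = y j" by auto
  have "(\<Otimes>i\<in>I. y i [^] (if i = j then 1 else 0 :: int)) = (\<Otimes>i\<in>I. if j = i then y i else \<one>)"
    using y j by (intro finprod_cong') (auto simp: int_pow_1 Pi_iff)
  then show ?case
    using finprod_singleton[OF j(1) I y] j by (metis (no_types))
next
  case (inv h)
  then obtain j where j: "j \<in> I" "h = y j" by auto
  have y': "(\<lambda>i. inv (y i)) \<in> I \<rightarrow> carrier G" using y by auto
  have "(\<Otimes>i\<in>I. y i [^] (if i = j then -1 else 0 :: int)) = (\<Otimes>i\<in>I. if j = i then inv (y i) else \<one>)"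
    using y j by (intro finprod_cong') (auto simp: int_pow_neg int_pow_1 Pi_iff)
  then show ?case
    using finprod_singleton[OF j(1) I y'] j by (metis (no_types))
next
  case (eng h1 h2)
  then obtain c d :: "_ \<Rightarrow> int" where "h1 = (\<Otimes>i\<in>I. y i [^] c i)" "h2 = (\<Otimes>i\<in>I. y i [^] d i)"
    by auto
  moreover have "(\<Otimes>i\<in>I. y i [^] (c i + d i)) = (\<Otimes>i\<in>I. y i [^] c i \<otimes> y i [^] d i)"
    using y by (intro finprod_cong') (auto simp: int_pow_mult Pi_iff)
  ultimately show ?case
    using y by (intro exI[of _ "\<lambda>i. c i + d i"]) (simp add: finprod_multf Pi_iff)
qed

text \<open>Written through fewer generators, the elements of \<open>S\<close> have exponent vectors
  that are dependent over the integers, and the dependence becomes a relation in the group.\<close>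

lemma card_independent_le:
  assumes I: "finite I" and y: "y \<in> I \<rightarrow> carrier G" and gen: "carrier G \<subseteq> generate G (y ` I)"
    and S: "finite S" "S \<subseteq> carrier G" "int_independent G S"
  shows "card S \<le> card I"
proof (rule ccontr)
  assume "\<not> card S \<le> card I"
  have "\<forall>s\<in>S. \<exists>c::_ \<Rightarrow> int. s = (\<Otimes>i\<in>I. y i [^] c i)"
    using generate_image_finprod[OF I y] gen S by blast
  then obtain A :: "_ \<Rightarrow> _ \<Rightarrow> int" where A: "\<And>s. s \<in> S \<Longrightarrow> s = (\<Otimes>i\<in>I. y i [^] A s i)"
    by metis
  obtain c where c: "\<exists>s\<in>S. c s \<noteq> 0" "\<And>i. i \<in> I \<Longrightarrow> (\<Sum>s\<in>S. c s * A s i) = 0"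
    using int_vectors_dependent[OF I S(1), of A] \<open>\<not> card S \<le> card I\<close> by auto
  have yc: "\<And>i. i \<in> I \<Longrightarrow> y i \<in> carrier G" using y by auto
  have "s [^] c s = (\<Otimes>i\<in>I. y i [^] (c s * A s i))" if "s \<in> S" for s
  proof -
    have "s [^] c s = (\<Otimes>i\<in>I. y i [^] A s i) [^] c s" using A[OF that] by metis
    also have "\<dots> = (\<Otimes>i\<in>I. (y i [^] A s i) [^] c s)" using y by (intro int_pow_finprod) auto
    also have "\<dots> = (\<Otimes>i\<in>I. y i [^] (c s * A s i))"
      using yc by (intro finprod_cong') (auto simp: int_pow_pow mult.commute)
    finally show ?thesis .
  qed
  then have "(\<Otimes>s\<in>S. s [^] c s) = (\<Otimes>s\<in>S. \<Otimes>i\<in>I. y i [^] (c s * A s i))"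
    using yc by (intro finprod_cong') (auto intro!: finprod_closed)
  also have "\<dots> = (\<Otimes>i\<in>I. \<Otimes>s\<in>S. y i [^] (c s * A s i))"
    using yc by (intro finprod_swap I S) auto
  also have "\<dots> = (\<Otimes>i\<in>I. y i [^] (\<Sum>s\<in>S. c s * A s i))"
    using yc S by (intro finprod_cong') (auto simp: finprod_int_pow_sum intro!: finprod_closed)
  also have "\<dots> = \<one>" using c(2) by (intro finprod_one_eqI) simp
  finally show False using c(1) S(3) unfolding int_independent_def by blast
qed

theorem ab_rank_eq_card:
  assumes I: "finite I" and y: "y \<in> I \<rightarrow> carrier G" and gen: "carrier G \<subseteq> generate G (y ` I)"
    and ind: "\<And>c::_ \<Rightarrow> int. (\<Otimes>i\<in>I. y i [^] c i) = \<one> \<Longrightarrow> \<forall>i\<in>I. c i = 0"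
  shows "ab_rank G = enat (card I)"
proof -
  have yc: "\<And>i. i \<in> I \<Longrightarrow> y i \<in> carrier G" using y by auto
  have inj: "inj_on y I"
  proof (rule inj_onI, rule ccontr)
    fix i j assume ij: "i \<in> I" "j \<in> I" "y i = y j" "i \<noteq> j"
    \<comment> \<open>Two indices with the same value would satisfy the relation with exponents 1
      and -1. Hence \<open>y\<close> is injective and its image has \<open>card I\<close>
      elements.\<close>
    define c where "c k = (if k = i then 1 else if k = j then -1 else 0 :: int)" for k
    have "I = insert i (insert j (I - {i,j}))" using ij by auto
    then have "(\<Otimes>k\<in>I. y k [^] c k) = (\<Otimes>k\<in>insert i (insert j (I - {i,j})). y k [^] c k)"
      by simp
    also have "\<dots> = y i [^] c i \<otimes> (y j [^] c j \<otimes> (\<Otimes>k\<in>I - {i,j}. y k [^] c k))"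
      using I yc ij by (simp add: Pi_iff)
    also have "(\<Otimes>k\<in>I - {i,j}. y k [^] c k) = \<one>"
      by (intro finprod_one_eqI) (auto simp: c_def)
    also have "y i [^] c i \<otimes> (y j [^] c j \<otimes> \<one>) = \<one>"
      using ij yc by (simp add: c_def int_pow_neg)
    finally have "c i = 0" using ind ij by blast
    then show False by (simp add: c_def)
  qed
  have "int_independent G (y ` I)"
    unfolding int_independent_def
  proof (intro allI impI)
    fix c :: "'a \<Rightarrow> int" assume c: "(\<Otimes>s\<in>y ` I. s [^] c s) = \<one>"
    have "(\<Otimes>s\<in>y ` I. s [^] c s) = (\<Otimes>i\<in>I. y i [^] c (y i))"
      using yc inj by (intro finprod_reindex) auto
    then show "\<forall>s\<in>y ` I. c s = 0" using ind[of "\<lambda>i. c (y i)"] c by auto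
  qed
  then have "enat (card I) \<le> ab_rank G"
    unfolding ab_rank_def using I yc card_image[OF inj]
    by (intro Sup_upper) (auto intro!: exI[of _ "y ` I"])
  moreover have "ab_rank G \<le> enat (card I)"
    unfolding ab_rank_def using card_independent_le[OF I y gen] by (intro Sup_least) auto
  ultimately show ?thesis by simp
qed

end


section \<open>Evaluations separate multisets\<close>

text \<open>Linear combinations over \<open>m\<close> turn the powers into values of an arbitrary
  polynomial; the one vanishing at all nodes except \<open>P i\<close> isolates
  \<open>c i\<close>.\<close>

lemma powers_independent:
  fixes c :: "'i \<Rightarrow> rat" and P :: "'i \<Rightarrow> rat"
  assumes I: "finite I" and P: "inj_on P I" and c: "\<And>m. (\<Sum>i\<in>I. c i * P i ^ m) = 0"
    and i: "i \<in> I"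
  shows "c i = 0"
proof -
  define f where "f = (\<Prod>j\<in>I - {i}. [:- P j, 1:])"
  have "(\<Sum>j\<in>I. c j * poly f (P j)) = (\<Sum>j\<in>I. \<Sum>m\<le>degree f. coeff f m * (c j * P j ^ m))"
    by (simp add: poly_altdef sum_distrib_left mult_ac)
  also have "\<dots> = (\<Sum>m\<le>degree f. coeff f m * (\<Sum>j\<in>I. c j * P j ^ m))"
    by (subst sum.swap) (simp add: sum_distrib_left)
  also have "\<dots> = 0" by (simp add: c)
  finally have "(\<Sum>j\<in>I. c j * poly f (P j)) = 0" .
  moreover have "poly f (P j) = 0" if "j \<in> I" "j \<noteq> i" for j
    using that I by (auto simp: f_def poly_prod)
  ultimately have "c i * poly f (P i) = 0"
    using I i by (simp add: sum.remove)
  moreover have "poly f (P i) \<noteq> 0"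
    using I i P by (auto simp: f_def poly_prod inj_on_def)
  ultimately show ?thesis by simp
qed

text \<open>At powers of distinct primes the monomials become powers of integers that are distinct
  by unique factorization, so the Vandermonde-type argument applies.\<close>

lemma monomials_independent:
  fixes c :: "nat multiset \<Rightarrow> rat"
  assumes \<M>: "finite \<M>" and c: "\<And>a :: nat \<Rightarrow> rat. (\<Sum>N\<in>\<M>. c N * (\<Prod>j\<in>#N. a j)) = 0"
    and N: "N \<in> \<M>"
  shows "c N = 0"
proof -
  obtain p :: "nat \<Rightarrow> nat" where p: "inj p" "\<And>j. prime (p j)"
    using infinite_countable_subset[OF primes_infinite] by (metis mem_Collect_eq range_subsetD)
  define P where "P N = (of_nat (\<Prod>j\<in>#N. p j) :: rat)" for N
  have "inj P"
  proof (rule injI)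
    fix N M assume "P N = P M"
    then have "(\<Prod>j\<in>#N. p j) = (\<Prod>j\<in>#M. p j)" unfolding P_def by (simp only: of_nat_eq_iff)
    then have "image_mset p N = image_mset p M"
      by (intro subset_mset.antisym) (auto intro!: prod_mset_primes_dvd_imp_subset simp: p)
    then show "N = M" using multiset.inj_map[OF p(1)] by (simp add: inj_eq)
  qed
  moreover have "(\<Sum>N\<in>\<M>. c N * P N ^ m) = 0" for m
  proof -
    have "P N ^ m = (\<Prod>j\<in>#N. of_nat (p j) ^ m)" for N
      unfolding P_def by (induction N) (auto simp: power_mult_distrib)
    then show ?thesis using c[of "\<lambda>j. of_nat (p j) ^ m"] by simp
  qed
  ultimately show ?thesis
    using powers_independent[OF \<M>, of P c N] N by (meson inj_on_subset subset_UNIV)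
qed

section \<open>Commutator calculus along the lower central series\<close>

context group
begin

definition cm :: "'a \<Rightarrow> 'a \<Rightarrow> 'a"
  where "cm g x = g \<otimes> x \<otimes> inv g \<otimes> inv x"

abbreviation \<gamma> :: "nat \<Rightarrow> 'a set"
  where "\<gamma> \<equiv> lower_central G"

lemma inv_cancel [simp]:
  assumes "x \<in> carrier G" "y \<in> carrier G"
  shows "inv x \<otimes> (x \<otimes> y) = y" "x \<otimes> (inv x \<otimes> y) = y"
  using assms by (simp_all add: m_assoc[symmetric])

lemma cm_closed [simp]: "g \<in> carrier G \<Longrightarrow> x \<in> carrier G \<Longrightarrow> cm g x \<in> carrier G"
  by (simp add: cm_def)

lemma cm_one [simp]: "g \<in> carrier G \<Longrightarrow> cm g \<one> = \<one>" "g \<in> carrier G \<Longrightarrow> cm \<one> g = \<one>"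
  by (simp_all add: cm_def)

lemma cm_eq_one:
  "g \<in> carrier G \<Longrightarrow> x \<in> carrier G \<Longrightarrow> g \<otimes> x = x \<otimes> g \<Longrightarrow> cm g x = \<one>"
  by (simp add: cm_def m_assoc)

lemma inv_cm: "g \<in> carrier G \<Longrightarrow> x \<in> carrier G \<Longrightarrow> inv (cm g x) = cm x g"
  by (simp add: cm_def m_assoc inv_mult_group)

lemma cm_mult_left:
  assumes "g \<in> carrier G" "h \<in> carrier G" "x \<in> carrier G"
  shows "cm (g \<otimes> h) x = g \<otimes> cm h x \<otimes> inv g \<otimes> cm g x"
  using assms by (simp add: cm_def m_assoc inv_mult_group)

lemma cm_mult_right:
  assumes "g \<in> carrier G" "x \<in> carrier G" "y \<in> carrier G"
  shows "cm g (x \<otimes> y) = cm g x \<otimes> (x \<otimes> cm g y \<otimes> inv x)"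
  using assms by (simp add: cm_def m_assoc inv_mult_group)

lemma cm_inv_left:
  assumes "g \<in> carrier G" "x \<in> carrier G"
  shows "cm (inv g) x = inv g \<otimes> inv (cm g x) \<otimes> g"
  using assms by (simp add: cm_def m_assoc inv_mult_group)

lemma cm_inv_right:
  assumes "g \<in> carrier G" "x \<in> carrier G"
  shows "cm g (inv x) = inv x \<otimes> inv (cm g x) \<otimes> x"
  using assms by (simp add: cm_def m_assoc inv_mult_group)

lemma conj_cm:
  "g \<in> carrier G \<Longrightarrow> x \<in> carrier G \<Longrightarrow> g \<otimes> x \<otimes> inv g = cm g x \<otimes> x"
  by (simp add: cm_def m_assoc)

lemma lower_central_carrier: "x \<in> \<gamma> k \<Longrightarrow> x \<in> carrier G"
  using normal_imp_subgroup[OF lower_central_normal] subgroup.subset by blast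

lemma lower_central_subgroup: "subgroup (\<gamma> k) G"
  by (rule normal_imp_subgroup[OF lower_central_normal])

lemma lower_central_antimono: "i \<le> j \<Longrightarrow> \<gamma> j \<subseteq> \<gamma> i"
  by (rule lift_Suc_antimono_le) (rule lower_central_Suc_subset)

lemma lower_central_Suc_generate:
  "k \<ge> 1 \<Longrightarrow> \<gamma> (Suc k) = generate G (\<Union>h\<in>carrier G. \<Union>x\<in>\<gamma> k. {cm h x})"
  by (cases k) (auto simp: commutator_subgroup_def cm_def)

lemma cm_lower_central:
  "k \<ge> 1 \<Longrightarrow> h \<in> carrier G \<Longrightarrow> x \<in> \<gamma> k \<Longrightarrow> cm h x \<in> \<gamma> (Suc k)"
  by (auto simp: lower_central_Suc_generate intro!: generate.incl)

text \<open>Conjugation changes an element of \<open>\<gamma> k\<close> only by a commutator in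
  \<open>\<gamma> (Suc k)\<close>.\<close>

lemma conj_mem_iff:
  assumes H: "subgroup H G" "\<gamma> (Suc k) \<subseteq> H" and k: "k \<ge> 1"
    and g: "g \<in> carrier G" and x: "x \<in> \<gamma> k"
  shows "g \<otimes> x \<otimes> inv g \<in> H \<longleftrightarrow> x \<in> H"
proof -
  interpret H: subgroup H G by (rule H)
  have c: "cm g x \<in> H" using cm_lower_central[OF k g x] H by blast
  have xc: "x \<in> carrier G" using lower_central_carrier x by blast
  have eq: "g \<otimes> x \<otimes> inv g = cm g x \<otimes> x" using conj_cm[OF g xc] .
  moreover have "x = inv (cm g x) \<otimes> (g \<otimes> x \<otimes> inv g)"
    unfolding eq using g xc by simp
  ultimately show ?thesis using c H.m_closed H.m_inv_closed by metis
qed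

text \<open>Bilinearity of the commutator modulo the next term of the series propagates generators.\<close>

lemma lower_central_Suc_span:
  assumes S: "carrier G \<subseteq> generate G S" "S \<subseteq> carrier G"
    and X: "\<gamma> k \<subseteq> generate G (X \<union> \<gamma> (Suc k))" "X \<subseteq> \<gamma> k" and k: "k \<ge> 1"
  shows "\<gamma> (Suc k) \<subseteq> generate G ((\<Union>s\<in>S. \<Union>x\<in>X. {cm s x}) \<union> \<gamma> (Suc (Suc k)))"
proof -
  define T where "T = (\<Union>s\<in>S. \<Union>x\<in>X. {cm s x}) \<union> \<gamma> (Suc (Suc k))"
  define H where "H = generate G T"
  have Xc: "X \<subseteq> carrier G" using X(2) lower_central_carrier by blast
  have "T \<subseteq> \<gamma> (Suc k)"
    unfolding T_def using cm_lower_central[OF k] S(2) X(2) lower_central_antimono[of "Suc k" "Suc (Suc k)"]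
    by (auto simp del: lower_central.simps)
  then have T: "T \<subseteq> carrier G" using lower_central_carrier by blast
  have H: "subgroup H G" unfolding H_def by (rule generate_is_subgroup[OF T])
  interpret H: subgroup H G by (rule H)
  have up: "\<gamma> (Suc (Suc k)) \<subseteq> H"
    unfolding H_def T_def by (auto simp del: lower_central.simps intro!: generate.incl)
  have conj: "g \<otimes> x \<otimes> inv g \<in> H" "inv g \<otimes> x \<otimes> g \<in> H"
    if "x \<in> H" "x \<in> \<gamma> (Suc k)" "g \<in> carrier G" for g x
    using conj_mem_iff[OF H up _ _ that(2), of g] conj_mem_iff[OF H up _ _ that(2), of "inv g"] that
    by auto
  \<comment> \<open>Induction on the second argument for a fixed generator \<open>s\<close>; the
    conjugations in the product formulas are absorbed by \<open>conj\<close>.\<close>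
  have one: "cm s x \<in> H" if s: "s \<in> S" and x: "x \<in> generate G (X \<union> \<gamma> (Suc k))" for s x
    using x
  proof (induction x rule: generate.induct)
    case one
    then show ?case using s S by auto
  next
    case (incl x)
    then show ?case
    proof
      assume "x \<in> X"
      then show ?thesis using s unfolding H_def T_def by (auto intro!: generate.incl)
    next
      assume "x \<in> \<gamma> (Suc k)"
      then show ?thesis using cm_lower_central[of "Suc k" s x] up s S by auto
    qed
  next
    case (inv x)
    have xk: "x \<in> \<gamma> k" using inv X lower_central_antimono[of k "Suc k"] by auto
    have xc: "x \<in> carrier G" "s \<in> carrier G" using xk lower_central_carrier s S by auto
    have m: "cm s x \<in> \<gamma> (Suc k)" using cm_lower_central[OF k] xk xc by auto
    have "cm s x \<in> H"
    using inv proof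
      assume "x \<in> X"
      then show ?thesis using s unfolding H_def T_def by (auto intro!: generate.incl)
    next
      assume "x \<in> \<gamma> (Suc k)"
      then show ?thesis using cm_lower_central[of "Suc k" s x] up s S by auto
    qed
    then have "inv (cm s x) \<in> H" "inv (cm s x) \<in> \<gamma> (Suc k)"
      using m subgroup.m_inv_closed[OF lower_central_subgroup] by auto
    then show ?case using conj(2) xc by (simp add: cm_inv_right)
  next
    case (eng x y)
    have sub: "X \<union> \<gamma> (Suc k) \<subseteq> \<gamma> k" using X lower_central_antimono[of k "Suc k"] by auto
    have xy: "x \<in> \<gamma> k" "y \<in> \<gamma> k"
      using eng generate_subgroup_incl[OF sub lower_central_subgroup] by auto
    then have c: "x \<in> carrier G" "y \<in> carrier G" "s \<in> carrier G"
      using lower_central_carrier s S by auto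
    then show ?case
      using eng conj(1)[of "cm s y" x] cm_lower_central[OF k, of s y] xy by (simp add: cm_mult_right)
  qed
  \<comment> \<open>Induction on the first argument, with \<open>x\<close> now arbitrary in
    \<open>\<gamma> k\<close>.\<close>
  have two: "cm g x \<in> H" if g: "g \<in> generate G S" and x: "x \<in> \<gamma> k" for g x
    using g
  proof (induction g rule: generate.induct)
    case one
    then show ?case using x lower_central_carrier by auto
  next
    case (incl g)
    then show ?case using one x X by blast
  next
    case (inv g)
    have c: "x \<in> carrier G" "g \<in> carrier G" using x lower_central_carrier inv S by auto
    have "cm g x \<in> H" "cm g x \<in> \<gamma> (Suc k)"
      using one inv x X c cm_lower_central[OF k] by blast+
    then have "inv (cm g x) \<in> H" "inv (cm g x) \<in> \<gamma> (Suc k)"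
      using subgroup.m_inv_closed[OF lower_central_subgroup] by auto
    then show ?case using conj(2) c by (simp add: cm_inv_left)
  next
    case (eng g h)
    have c: "x \<in> carrier G" "g \<in> carrier G" "h \<in> carrier G"
      using x lower_central_carrier eng generate_in_carrier[OF S(2)] by auto
    then show ?case
      using eng conj(1)[of "cm h x" g] cm_lower_central[OF k, of h x] x by (simp add: cm_mult_left)
  qed
  have "(\<Union>h\<in>carrier G. \<Union>x\<in>\<gamma> k. {cm h x}) \<subseteq> H" using two S(1) by auto
  then show ?thesis
    unfolding lower_central_Suc_generate[OF k] T_def[symmetric] H_def[symmetric]
    by (rule generate_subgroup_incl[OF _ H])
qed

lemma lower_central_2: "\<gamma> 2 = derived G (carrier G)"
  by (simp add: numeral_2_eq_2 commutator_subgroup_def derived_def)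

end


section \<open>Metabelian groups\<close>

locale metabelian = group +
  assumes derived_comm: "\<And>x y. x \<in> lower_central G 2 \<Longrightarrow> y \<in> lower_central G 2 \<Longrightarrow> x \<otimes> y = y \<otimes> x"
begin

lemma \<gamma>2_closed [simp]:
  "x \<in> \<gamma> 2 \<Longrightarrow> x \<in> carrier G"
  "x \<in> \<gamma> 2 \<Longrightarrow> y \<in> \<gamma> 2 \<Longrightarrow> x \<otimes> y \<in> \<gamma> 2"
  "x \<in> \<gamma> 2 \<Longrightarrow> inv x \<in> \<gamma> 2"
  "\<one> \<in> \<gamma> 2"
  using lower_central_carrier subgroup.m_closed[OF lower_central_subgroup]
    subgroup.m_inv_closed[OF lower_central_subgroup] subgroup.one_closed[OF lower_central_subgroup]
  by auto

lemma cm_mem_\<gamma>2 [simp]: "g \<in> carrier G \<Longrightarrow> h \<in> carrier G \<Longrightarrow> cm g h \<in> \<gamma> 2"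
  using cm_lower_central[of 1 g h] by (simp add: numeral_2_eq_2)

lemma \<gamma>_subset_\<gamma>2: "k \<ge> 2 \<Longrightarrow> x \<in> \<gamma> k \<Longrightarrow> x \<in> \<gamma> 2"
  using lower_central_antimono by blast

lemma \<gamma>2_lcomm: "x \<in> \<gamma> 2 \<Longrightarrow> y \<in> \<gamma> 2 \<Longrightarrow> z \<in> \<gamma> 2 \<Longrightarrow> x \<otimes> (y \<otimes> z) = y \<otimes> (x \<otimes> z)"
  using derived_comm[of x y] by (simp add: m_assoc[symmetric])

lemmas \<gamma>2_ac = m_assoc derived_comm \<gamma>2_lcomm

text \<open>Conjugation by \<open>x\<close> is trivial on the commutative group
  \<open>\<gamma> 2\<close>, which removes the twist in \<open>cm_mult_right\<close>. Thus
  \<open>cm g\<close> is the operator \<open>g - 1\<close> on the module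
  \<open>\<gamma> 2\<close>.\<close>

lemma cm_hom:
  assumes "g \<in> carrier G" "x \<in> \<gamma> 2" "y \<in> \<gamma> 2"
  shows "cm g (x \<otimes> y) = cm g x \<otimes> cm g y"
proof -
  have "x \<otimes> cm g y \<otimes> inv x = cm g y"
    using assms derived_comm[of x "cm g y"] by (simp add: m_assoc)
  then show ?thesis using assms by (simp add: cm_mult_right)
qed

lemma cm_inv_hom:
  assumes "g \<in> carrier G" "x \<in> \<gamma> 2"
  shows "cm g (inv x) = inv (cm g x)"
  using assms derived_comm[of "inv x" "inv (cm g x)"] by (simp add: cm_inv_right m_assoc)

lemma cm_mult_left':
  assumes "g \<in> carrier G" "h \<in> carrier G" "x \<in> carrier G"
  shows "cm (g \<otimes> h) x = cm g (cm h x) \<otimes> (cm h x \<otimes> cm g x)"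
  using assms conj_cm[of g "cm h x"] by (simp add: cm_mult_left m_assoc[symmetric])

lemma cm_\<gamma>2_trivial: "x \<in> \<gamma> 2 \<Longrightarrow> y \<in> \<gamma> 2 \<Longrightarrow> cm x y = \<one>"
  by (intro cm_eq_one derived_comm) auto

lemma swap_cm: "g \<in> carrier G \<Longrightarrow> h \<in> carrier G \<Longrightarrow> g \<otimes> h = cm g h \<otimes> (h \<otimes> g)"
  by (simp add: cm_def m_assoc)

text \<open>The products \<open>g \<otimes> h\<close> and \<open>h \<otimes> g\<close> differ by an
  element of \<open>\<gamma> 2\<close>, which acts trivially on \<open>\<gamma> 2\<close>; so the
  operators \<open>cm g\<close> behave like commuting variables.\<close>

lemma cm_cm_commute:
  assumes g: "g \<in> carrier G" "h \<in> carrier G" and x: "x \<in> \<gamma> 2"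
  shows "cm g (cm h x) = cm h (cm g x)"
proof -
  have xc: "x \<in> carrier G" using x by simp
  have "cm (g \<otimes> h) x = cm (cm g h \<otimes> (h \<otimes> g)) x" using swap_cm[OF g] by (rule arg_cong)
  also have "\<dots> = cm (h \<otimes> g) x"
    using g x xc by (subst cm_mult_left') (simp_all add: cm_\<gamma>2_trivial)
  finally have "cm g (cm h x) \<otimes> (cm h x \<otimes> cm g x) = cm h (cm g x) \<otimes> (cm h x \<otimes> cm g x)"
    using g xc derived_comm[of "cm h x" "cm g x"] by (simp add: cm_mult_left')
  then show ?thesis using g xc by (subst (asm) right_cancel) auto
qed

text \<open>Expand \<open>[x, yz] = [x, [y,z] zy]\<close> in two ways.\<close>

lemma jacobi:
  assumes c: "x \<in> carrier G" "y \<in> carrier G" "z \<in> carrier G"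
  shows "cm x (cm y z) \<otimes> (cm y (cm z x) \<otimes> cm z (cm x y)) = \<one>"
proof -
  have "cm x (y \<otimes> z) = cm x y \<otimes> (cm y (cm x z) \<otimes> cm x z)"
    using c by (simp add: cm_mult_right conj_cm)
  moreover have "cm x (y \<otimes> z) = cm x (cm y z \<otimes> (z \<otimes> y))" using swap_cm[OF c(2,3)] by (rule arg_cong)
  moreover have "\<dots> = cm x (cm y z) \<otimes> cm x (z \<otimes> y)"
    using c derived_comm[of "cm y z" "cm x (z \<otimes> y)"] by (simp add: cm_mult_right[of x "cm y z"] m_assoc)
  moreover have "cm x (z \<otimes> y) = cm x z \<otimes> (cm z (cm x y) \<otimes> cm x y)"
    using c by (simp add: cm_mult_right conj_cm)
  ultimately have eq: "cm x y \<otimes> (cm y (cm x z) \<otimes> cm x z)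
      = cm x (cm y z) \<otimes> (cm x z \<otimes> (cm z (cm x y) \<otimes> cm x y))"
    by simp
  define a b d e f where ab: "a = cm x y" "b = cm x z"
    and def: "d = cm y (cm x z)" "e = cm z (cm x y)" "f = cm x (cm y z)"
  have m: "a \<in> \<gamma> 2" "b \<in> \<gamma> 2" "d \<in> \<gamma> 2" "e \<in> \<gamma> 2" "f \<in> \<gamma> 2"
    using c by (auto simp: ab def)
  have "a \<otimes> (d \<otimes> b) = f \<otimes> (b \<otimes> (e \<otimes> a))" using eq by (simp only: ab def)
  then have "d \<otimes> (a \<otimes> b) = (f \<otimes> e) \<otimes> (a \<otimes> b)" using m by (simp add: \<gamma>2_ac)
  then have "d = f \<otimes> e" using m by (subst (asm) right_cancel) auto
  moreover have "cm y (cm z x) = inv d"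
    using c cm_inv_hom[of y "cm x z"] by (simp add: def inv_cm)
  ultimately show ?thesis
    using m by (simp add: def(2,3)[symmetric] inv_mult_group \<gamma>2_ac)
qed

section \<open>Congruence modulo a term of the series, and monomials in the operators
  \<open>cm g\<close>\<close>

definition cong :: "nat \<Rightarrow> 'a \<Rightarrow> 'a \<Rightarrow> bool"
  where "cong k x y \<longleftrightarrow> x \<in> \<gamma> 2 \<and> y \<in> \<gamma> 2 \<and> x \<otimes> inv y \<in> \<gamma> k"

lemma \<gamma>_closed [simp]: "x \<in> \<gamma> k \<Longrightarrow> y \<in> \<gamma> k \<Longrightarrow> x \<otimes> y \<in> \<gamma> k" "x \<in> \<gamma> k \<Longrightarrow> inv x \<in> \<gamma> k" "\<one> \<in> \<gamma> k"
  using subgroup.m_closed[OF lower_central_subgroup]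
    subgroup.m_inv_closed[OF lower_central_subgroup] subgroup.one_closed[OF lower_central_subgroup]
  by auto

lemma cong_mem: "cong k x y \<Longrightarrow> x \<in> \<gamma> 2" "cong k x y \<Longrightarrow> y \<in> \<gamma> 2"
  by (auto simp: cong_def)

lemma cong_refl [simp]: "x \<in> \<gamma> 2 \<Longrightarrow> cong k x x"
  by (simp add: cong_def)

lemma cong_sym: "cong k x y \<Longrightarrow> cong k y x"
proof -
  assume a: "cong k x y"
  then have "inv (x \<otimes> inv y) \<in> \<gamma> k" by (simp add: cong_def)
  then show ?thesis using a by (simp add: cong_def inv_mult_group)
qed

lemma cong_trans [trans]: "cong k x y \<Longrightarrow> cong k y z \<Longrightarrow> cong k x z"
proof -
  assume a: "cong k x y" "cong k y z"
  then have "(x \<otimes> inv y) \<otimes> (y \<otimes> inv z) \<in> \<gamma> k" by (simp add: cong_def)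
  then show ?thesis using a by (simp add: cong_def m_assoc)
qed

lemma cong_inv: "cong k x y \<Longrightarrow> cong k (inv x) (inv y)"
proof -
  assume a: "cong k x y"
  then have "inv (x \<otimes> inv y) \<in> \<gamma> k" by (simp add: cong_def)
  then show ?thesis using a by (simp add: cong_def inv_mult_group \<gamma>2_ac)
qed

lemma cong_cm: "k \<ge> 2 \<Longrightarrow> g \<in> carrier G \<Longrightarrow> cong k x y \<Longrightarrow> cong (Suc k) (cm g x) (cm g y)"
proof -
  assume a: "k \<ge> 2" "g \<in> carrier G" "cong k x y"
  then have "cm g (x \<otimes> inv y) \<in> \<gamma> (Suc k)" using cm_lower_central[of k g] by (simp add: cong_def)
  then show ?thesis using a by (simp add: cong_def cm_hom cm_inv_hom)
qed

lemma cong_one_iff: "k \<ge> 2 \<Longrightarrow> cong k x \<one> \<longleftrightarrow> x \<in> \<gamma> k"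
  using \<gamma>_subset_\<gamma>2 by (auto simp: cong_def)

lemma cong_generate:
  assumes "cong k x y" "X \<subseteq> carrier G" "y \<in> generate G (X \<union> \<gamma> k)"
  shows "x \<in> generate G (X \<union> \<gamma> k)"
proof -
  have "x \<otimes> inv y \<in> generate G (X \<union> \<gamma> k)" using assms by (auto simp: cong_def intro!: generate.incl)
  then have "x \<otimes> inv y \<otimes> y \<in> generate G (X \<union> \<gamma> k)" using assms by (auto intro: generate.eng)
  then show ?thesis using assms(1) by (simp add: cong_def m_assoc)
qed

definition xop :: "'a list \<Rightarrow> 'a \<Rightarrow> 'a"
  where "xop L x = foldr cm L x"

lemma xop_simps [simp]: "xop [] x = x" "xop (g # L) x = cm g (xop L x)"
  by (simp_all add: xop_def)

lemma xop_append: "xop (L @ L') x = xop L (xop L' x)"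
  by (simp add: xop_def)

lemma xop_lower_central:
  "set L \<subseteq> carrier G \<Longrightarrow> k \<ge> 1 \<Longrightarrow> x \<in> \<gamma> k \<Longrightarrow> xop L x \<in> \<gamma> (k + length L)"
  by (induction L) (auto simp: cm_lower_central)

lemma xop_\<gamma>2 [simp]: "set L \<subseteq> carrier G \<Longrightarrow> x \<in> \<gamma> 2 \<Longrightarrow> xop L x \<in> \<gamma> 2"
  by (induction L) auto

lemma xop_inv: "set L \<subseteq> carrier G \<Longrightarrow> x \<in> \<gamma> 2 \<Longrightarrow> xop L (inv x) = inv (xop L x)"
  by (induction L) (auto simp: cm_inv_hom)

lemma xop_mult:
  "set L \<subseteq> carrier G \<Longrightarrow> x \<in> \<gamma> 2 \<Longrightarrow> y \<in> \<gamma> 2 \<Longrightarrow> xop L (x \<otimes> y) = xop L x \<otimes> xop L y"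
  by (induction L) (auto simp: cm_hom)

lemma xop_one [simp]: "set L \<subseteq> carrier G \<Longrightarrow> xop L \<one> = \<one>"
  by (induction L) auto

lemma xop_cm:
  "set L \<subseteq> carrier G \<Longrightarrow> g \<in> carrier G \<Longrightarrow> x \<in> \<gamma> 2 \<Longrightarrow> xop L (cm g x) = cm g (xop L x)"
  by (induction L) (auto simp: cm_cm_commute[of g])

lemma xop_cong:
  "set L \<subseteq> carrier G \<Longrightarrow> k \<ge> 2 \<Longrightarrow> cong k x y \<Longrightarrow> cong (k + length L) (xop L x) (xop L y)"
  by (induction L) (auto simp: cong_cm)

lemma xop_remove1:
  assumes "g \<in> set L" "set L \<subseteq> carrier G" "x \<in> \<gamma> 2"
  shows "xop L x = cm g (xop (remove1 g L) x)"
  using assms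
proof (induction L)
  case (Cons h L)
  have "set (remove1 g L) \<subseteq> carrier G" using Cons.prems set_remove1_subset[of g L] by auto
  then show ?case using Cons by (auto simp: cm_cm_commute[of h g])
qed simp

text \<open>The operators commute exactly on \<open>\<gamma> 2\<close>, not merely up to higher
  commutators, so a list of group elements serves as a monomial.\<close>

lemma xop_mset:
  assumes "mset L = mset L'" "set L \<subseteq> carrier G" "x \<in> \<gamma> 2"
  shows "xop L x = xop L' x"
  using assms
proof (induction L arbitrary: L')
  case (Cons g L)
  have s: "set L' = set (g # L)" using Cons.prems(1) mset_eq_setD by metis
  have "mset L = mset (remove1 g L')" using Cons.prems(1) by (metis mset_remove1 add_mset_remove_trivial mset.simps(2))
  then have "xop L x = xop (remove1 g L') x" using Cons by auto
  then show ?case using xop_remove1[of g L' x] s Cons.prems by auto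
qed simp

end

declare lower_central.simps(3) [simp del]

section \<open>The relations of the upper McCool group in a metabelian group\<close>

text \<open>The last three assumptions are McCool's relations between the generators with
  \<open>i > j\<close>. They carry the upper bound on the ranks; the lower bound comes from the
  representations added in \<open>mccool_functionals\<close>.\<close>

locale mccool_quotient = metabelian +
  fixes n :: nat and a :: "nat \<Rightarrow> nat \<Rightarrow> 'a"
  assumes a_closed: "\<And>i j. 1 \<le> j \<Longrightarrow> j < i \<Longrightarrow> i \<le> n \<Longrightarrow> a i j \<in> carrier G"
    and a_gen: "carrier G \<subseteq> generate G {a i j | i j. 1 \<le> j \<and> j < i \<and> i \<le> n}"
    and rel_disjoint: "\<And>i j k l. 1 \<le> j \<Longrightarrow> j < i \<Longrightarrow> i \<le> n \<Longrightarrow> 1 \<le> l \<Longrightarrow> l < k \<Longrightarrow> k \<le> n \<Longrightarrow>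
      {i, j} \<inter> {k, l} = {} \<Longrightarrow> a i j \<otimes> a k l = a k l \<otimes> a i j"
    and rel_same: "\<And>i j k. 1 \<le> j \<Longrightarrow> j < k \<Longrightarrow> k < i \<Longrightarrow> i \<le> n \<Longrightarrow> a i j \<otimes> a k j = a k j \<otimes> a i j"
    and rel_chain: "\<And>i j k. 1 \<le> j \<Longrightarrow> j < k \<Longrightarrow> k < i \<Longrightarrow> i \<le> n \<Longrightarrow>
      a i k \<otimes> (a i j \<otimes> a k j) = (a i j \<otimes> a k j) \<otimes> a i k"
begin

definition ok :: "nat \<Rightarrow> nat \<Rightarrow> bool" where "ok i j \<longleftrightarrow> 1 \<le> j \<and> j < i \<and> i \<le> n"

definition e :: "nat \<Rightarrow> nat \<Rightarrow> nat \<Rightarrow> 'a" where "e i j k = cm (a i j) (a i k)"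

lemma okD: "ok i j \<Longrightarrow> 1 \<le> j" "ok i j \<Longrightarrow> j < i" "ok i j \<Longrightarrow> i \<le> n"
  by (auto simp: ok_def)

lemma a_carrier [simp]: "ok i j \<Longrightarrow> a i j \<in> carrier G"
  by (simp add: ok_def a_closed)

lemma e_mem [simp]: "ok i j \<Longrightarrow> ok i k \<Longrightarrow> e i j k \<in> \<gamma> 2"
  by (simp add: e_def)

lemma e_swap: "ok i j \<Longrightarrow> ok i k \<Longrightarrow> inv (e i j k) = e i k j"
  by (simp add: e_def inv_cm)

lemma cm_commuting:
  assumes "ok i j" "ok k l" "i \<noteq> k" "k \<noteq> j" "i \<noteq> l"
  shows "cm (a i j) (a k l) = \<one>"
proof -
  consider "j = l" "k < i" | "j = l" "i < k" | "j \<noteq> l" using assms by linarith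
  then have "a i j \<otimes> a k l = a k l \<otimes> a i j"
  proof cases
    case 1
    then show ?thesis using rel_same[of j k i] assms by (simp add: ok_def)
  next
    case 2
    then show ?thesis using rel_same[of j i k] assms by (simp add: ok_def)
  next
    case 3
    then show ?thesis using rel_disjoint[of j i l k] assms by (simp add: ok_def)
  qed
  then show ?thesis using assms by (intro cm_eq_one) auto
qed

text \<open>The commutator of \<open>a i k\<close> with the product
  \<open>a i j \<otimes> a k j\<close> is trivial and splits into two commutators up to a
  conjugation. The conjugation leaves a triple commutator, so the result is a congruence modulo
  \<open>\<gamma> 3\<close>.\<close>

lemma cm_chain:
  assumes "ok i k" "ok k j"
  shows "cong 3 (cm (a i k) (a k j)) (e i j k)"
proof -
  have o: "ok i j" using assms by (auto simp: ok_def)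
  define u where "u = cm (a i k) (a k j)"
  have u: "u \<in> \<gamma> 2" using assms by (simp add: u_def)
  have "cm (a i k) (a i j \<otimes> a k j) = \<one>"
    using assms o rel_chain[of j k i] by (intro cm_eq_one) (auto simp: ok_def)
  then have "cm (a i k) (a i j) \<otimes> (cm (a i j) u \<otimes> u) = \<one>"
    using assms o by (simp add: cm_mult_right conj_cm u_def)
  then have "inv (e i j k) \<otimes> (cm (a i j) u \<otimes> u) = \<one>"
    using e_swap assms o by (simp add: e_def)
  then have "(u \<otimes> inv (e i j k)) \<otimes> cm (a i j) u = \<one>"
    using assms o u by (simp add: \<gamma>2_ac)
  then have "u \<otimes> inv (e i j k) = inv (cm (a i j) u)"
    using assms o u by (metis inv_equality inv_inv \<gamma>2_closed(1,2,3) e_mem cm_mem_\<gamma>2 a_carrier)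
  moreover have "cm (a i j) u \<in> \<gamma> 3"
    using cm_lower_central[of 2 "a i j" u] u o by simp
  ultimately show ?thesis using assms o u by (simp add: cong_def u_def)
qed

lemma cm_chain':
  assumes "ok i k" "ok k j"
  shows "cong 3 (cm (a k j) (a i k)) (e i k j)"
proof -
  have o: "ok i j" using assms by (auto simp: ok_def)
  show ?thesis using cong_inv[OF cm_chain[OF assms]] assms o by (simp add: inv_cm e_swap)
qed

section \<open>Relations of the module in degrees one and two, all obtained from the Jacobi
  identity\<close>

lemma cm_cong4: "g \<in> carrier G \<Longrightarrow> cong 3 x y \<Longrightarrow> cong 4 (cm g x) (cm g y)"
  using cong_cm[of 3 g x y] by simp

lemma cm_cong5: "g \<in> carrier G \<Longrightarrow> cong 4 x y \<Longrightarrow> cong 5 (cm g x) (cm g y)"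
  using cong_cm[of 4 g x y] by simp

text \<open>In the Jacobi identity \<open>a p q\<close> commutes with both entries of the bracket,
  so the other two terms vanish exactly.\<close>

lemma rel_Z:
  assumes "ok p q" "ok i j" "ok i k" "p \<notin> {i, j, k}" "q \<noteq> i"
  shows "cm (a p q) (e i j k) = \<one>"
  using jacobi[of "a p q" "a i j" "a i k"] assms
    cm_commuting[of p q i j] cm_commuting[of i k p q]
  by (simp add: e_def)

text \<open>Jacobi for \<open>a k b\<close>, \<open>a i k\<close>, \<open>a i j\<close>: the first
  and the last commute, and the chain bracket of the first two is \<open>e i k b\<close> modulo
  \<open>\<gamma> 3\<close>. This trades the variable \<open>a k b\<close> for one with first index
  \<open>i\<close>.\<close>

lemma rel_A:
  assumes "ok k b" "ok i k" "ok i j" "j \<noteq> k"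
  shows "cong 4 (cm (a k b) (e i k j)) (cm (a i j) (e i b k))"
proof -
  have o: "ok i b" using assms by (auto simp: ok_def)
  have "cm (a i j) (a k b) = \<one>" using assms by (intro cm_commuting) (auto simp: ok_def)
  then have "cm (a k b) (e i k j) \<otimes> cm (a i j) (cm (a k b) (a i k)) = \<one>"
    using jacobi[of "a k b" "a i k" "a i j"] assms by (simp add: e_def)
  then have "cm (a k b) (e i k j) = inv (cm (a i j) (cm (a k b) (a i k)))"
    using assms by (metis inv_equality inv_inv \<gamma>2_closed(1) e_mem cm_mem_\<gamma>2 a_carrier)
  moreover have "cong 4 (inv (cm (a i j) (cm (a k b) (a i k)))) (inv (cm (a i j) (e i k b)))"
    using assms by (intro cong_inv cm_cong4 cm_chain') auto
  moreover have "inv (cm (a i j) (e i k b)) = cm (a i j) (e i b k)"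
    using assms o e_swap[of i k b] cm_inv_hom[of "a i j" "e i k b"] by simp
  ultimately show ?thesis by simp
qed

text \<open>Jacobi for \<open>a p i\<close>, \<open>a i k\<close>, \<open>a k j\<close>, where the
  first and the last commute, followed by \<open>rel_A\<close> for brackets with first index
  \<open>p\<close>. The generator \<open>a k j\<close> requires \<open>j < k\<close>; the other
  order follows by antisymmetry.\<close>

lemma rel_P:
  assumes "ok p i" "ok i j" "ok i k" "j \<noteq> k"
  shows "cong 4 (cm (a p i) (e i j k)) (inv (cm (a p i) (e p j k)))"
proof -
  have *: "cong 4 (cm (a p i) (e i j k)) (inv (cm (a p i) (e p j k)))"
    if o: "ok p i" "ok i j" "ok i k" "j < k" for j k
  proof -
    have o': "ok k j" "ok p k" "ok p j" using o by (auto simp: ok_def)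
    have "cm (a k j) (a p i) = \<one>" using o o' by (intro cm_commuting) (auto simp: ok_def)
    then have "cm (a p i) (cm (a i k) (a k j)) \<otimes> cm (a k j) (cm (a p i) (a i k)) = \<one>"
      using jacobi[of "a p i" "a i k" "a k j"] o o' by simp
    then have eq: "cm (a p i) (cm (a i k) (a k j)) = inv (cm (a k j) (cm (a p i) (a i k)))"
      using o o' by (metis inv_equality inv_inv \<gamma>2_closed(1) cm_mem_\<gamma>2 a_carrier)
    have "cong 4 (cm (a p i) (e i j k)) (cm (a p i) (cm (a i k) (a k j)))"
      using o o' by (intro cong_sym[OF cm_cong4] cm_chain) auto
    also note eq
    also have "cong 4 (inv (cm (a k j) (cm (a p i) (a i k)))) (inv (cm (a k j) (e p k i)))"
      using o o' by (intro cong_inv cm_cong4 cm_chain) auto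
    also have "cong 4 (inv (cm (a k j) (e p k i))) (inv (cm (a p i) (e p j k)))"
      using o o' by (intro cong_inv rel_A) (auto simp: ok_def)
    finally show ?thesis .
  qed
  show ?thesis
  proof (cases "j < k")
    case True
    then show ?thesis using * assms by blast
  next
    case False
    have o: "ok p j" "ok p k" using assms by (auto simp: ok_def)
    have "cong 4 (inv (cm (a p i) (e i k j))) (inv (inv (cm (a p i) (e p k j))))"
      using False assms by (intro cong_inv *) auto
    then show ?thesis
      using assms o cm_inv_hom[of "a p i" "e i k j"] cm_inv_hom[of "a p i" "e p k j"]
      by (simp add: e_swap)
  qed
qed

text \<open>Jacobi for three generators with the same first index, in the shape of a Koszul
  relation.\<close>

lemma rel_K:
  assumes "ok i l" "ok i b" "ok i c"
  shows "cm (a i l) (e i b c) = cm (a i c) (e i b l) \<otimes> inv (cm (a i b) (e i c l))"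
proof -
  have "cm (a i l) (e i b c) \<otimes> (cm (a i b) (e i c l) \<otimes> inv (cm (a i c) (e i b l))) = \<one>"
    using jacobi[of "a i l" "a i b" "a i c"] assms cm_inv_hom[of "a i c" "e i b l"] e_swap[of i b l]
    by (simp add: e_def)
  then have "cm (a i l) (e i b c) = inv (cm (a i b) (e i c l) \<otimes> inv (cm (a i c) (e i b l)))"
    using assms by (intro inv_equality[symmetric]) auto
  then show ?thesis using assms by (simp add: inv_mult_group)
qed

text \<open>\<open>rel_P\<close> moves the bracket to first index \<open>p\<close>, where
  \<open>a i q\<close> acts trivially by \<open>rel_Z\<close>. So the rule \<open>rel_P\<close> has
  a nonzero effect only on a bare bracket.\<close>

lemma rel_P0:
  assumes "ok p i" "ok i q" "ok i j" "ok i k" "j \<noteq> k"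
  shows "cong 5 (cm (a p i) (cm (a i q) (e i j k))) \<one>"
proof -
  have o: "ok p q" "ok p j" "ok p k" using assms by (auto simp: ok_def)
  have "cm (a p i) (cm (a i q) (e i j k)) = cm (a i q) (cm (a p i) (e i j k))"
    using assms by (intro cm_cm_commute) auto
  also have "cong 5 \<dots> (cm (a i q) (inv (cm (a p i) (e p j k))))"
    using assms by (intro cm_cong5 rel_P) auto
  also have "cm (a i q) (inv (cm (a p i) (e p j k))) = inv (cm (a p i) (cm (a i q) (e p j k)))"
    using assms o by (simp add: cm_inv_hom cm_cm_commute[of "a i q"])
  also have "\<dots> = \<one>" using rel_Z[of i q p j k] assms o by (auto simp: ok_def)
  finally show ?thesis .
qed

text \<open>\<open>rel_P\<close> moves the bracket back to first index \<open>i\<close>, where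
  \<open>a p q\<close> with \<open>q \<noteq> i\<close> acts trivially by
  \<open>rel_Z\<close>.\<close>

lemma rel_Q:
  assumes "ok p i" "ok i j" "ok i k" "j \<noteq> k" "ok p q" "q \<noteq> i"
  shows "cong 5 (cm (a p q) (cm (a p i) (e p j k))) \<one>"
proof -
  have o: "ok p j" "ok p k" using assms by (auto simp: ok_def)
  have "cong 5 (cm (a p q) (cm (a p i) (e i j k))) (cm (a p q) (inv (cm (a p i) (e p j k))))"
    using assms by (intro cm_cong5 rel_P) auto
  moreover have "cm (a p q) (cm (a p i) (e i j k)) = cm (a p i) (cm (a p q) (e i j k))"
    using assms by (intro cm_cm_commute) auto
  moreover have "\<dots> = \<one>" using rel_Z[of p q i j k] assms by (auto simp: ok_def)
  ultimately have "cong 5 (inv (cm (a p q) (inv (cm (a p i) (e p j k))))) (inv \<one>)"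
    by (metis cong_inv cong_sym)
  then show ?thesis using assms o by (simp add: cm_inv_hom)
qed

text \<open>By \<open>rel_K\<close> the two sides differ by the action of \<open>a i q\<close> and
  \<open>a i l\<close> on \<open>e i b c\<close>, which \<open>rel_Q\<close> kills. The exclusion of
  \<open>q = l\<close> is the source of the extra basis elements.\<close>

lemma rel_S:
  assumes "ok i l" "ok l b" "ok l c" "ok i q" "q \<noteq> l"
  shows "cong 5 (cm (a i q) (cm (a i c) (e i b l))) (cm (a i q) (cm (a i b) (e i c l)))"
proof (cases "b = c")
  case True
  moreover have "ok i b" using assms by (auto simp: ok_def)
  ultimately show ?thesis using assms by simp
next
  case False
  have o: "ok i b" "ok i c" using assms by (auto simp: ok_def)
  have "cong 5 (cm (a i q) (cm (a i l) (e i b c))) \<one>"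
    using assms False by (intro rel_Q) auto
  then have "cm (a i q) (cm (a i c) (e i b l) \<otimes> inv (cm (a i b) (e i c l))) \<in> \<gamma> 5"
    using assms o rel_K[of i l b c] by (simp add: cong_one_iff)
  then show ?thesis using assms o by (simp add: cong_def cm_hom cm_inv_hom)
qed


section \<open>A spanning set of the graded pieces\<close>

definition X :: "nat \<Rightarrow> nat list \<Rightarrow> nat \<Rightarrow> nat \<Rightarrow> 'a"
  where "X i L b l = xop (map (a i) L) (e i b l)"

lemma map_a_carrier [simp]: "set L \<subseteq> {1..<i} \<Longrightarrow> i \<le> n \<Longrightarrow> set (map (a i) L) \<subseteq> carrier G"
  by (auto simp: ok_def intro!: a_closed)

lemma map_a_carrier' [simp]: "set L \<subseteq> {1..<i} \<Longrightarrow> i \<le> n \<Longrightarrow> a i ` set L \<subseteq> carrier G"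
  using map_a_carrier by simp

lemma X_mem:
  assumes "set L \<subseteq> {1..<i}" "ok i b" "ok i l"
  shows "X i L b l \<in> \<gamma> (length L + 2)"
  using xop_lower_central[of "map (a i) L" 2 "e i b l"] assms
  by (simp add: X_def okD add.commute)

lemma X_mem_\<gamma>2 [simp]:
  "set L \<subseteq> {1..<i} \<Longrightarrow> ok i b \<Longrightarrow> ok i l \<Longrightarrow> X i L b l \<in> \<gamma> 2"
  by (simp add: X_def okD)

lemma X_swap: "set L \<subseteq> {1..<i} \<Longrightarrow> ok i b \<Longrightarrow> ok i l \<Longrightarrow> inv (X i L b l) = X i L l b"
  by (simp add: X_def okD xop_inv[symmetric] e_swap)

lemma X_mset:
  "mset L = mset L' \<Longrightarrow> set L \<subseteq> {1..<i} \<Longrightarrow> ok i b \<Longrightarrow> ok i l \<Longrightarrow> X i L b l = X i L' b l"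
  unfolding X_def by (intro xop_mset) (auto simp: okD intro!: map_a_carrier')

definition E :: "nat \<Rightarrow> 'a set"
  where "E r = {X i L j k | i L j k. ok i j \<and> ok i k \<and> j < k \<and> set L \<subseteq> {1..<i} \<and> length L = r}"

lemma E_subset: "E r \<subseteq> \<gamma> (r + 2)"
proof
  fix x assume "x \<in> E r"
  then obtain i L j k where "x = X i L j k" "ok i j" "ok i k" "set L \<subseteq> {1..<i}" "length L = r"
    by (auto simp: E_def)
  then show "x \<in> \<gamma> (r + 2)" using X_mem[of L i j k] by (simp del: add_2_eq_Suc')
qed

lemma E_carrier: "E r \<subseteq> carrier G"
  using E_subset lower_central_carrier by blast

lemma X_in_generate_E:
  assumes "ok i j" "ok i k" "j \<noteq> k" "set L \<subseteq> {1..<i}" "length L = r"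
  shows "X i L j k \<in> generate G (E r \<union> T)"
proof (cases "j < k")
  case True
  then show ?thesis using assms by (auto simp: E_def intro!: generate.incl)
next
  case False
  then have "X i L k j \<in> E r" using assms unfolding E_def
    by (intro CollectI exI[of _ i] exI[of _ L] exI[of _ k] exI[of _ j]) auto
  moreover have "X i L j k = inv (X i L k j)" using X_swap assms by simp
  ultimately show ?thesis by (auto intro: generate.inv)
qed

text \<open>A bracket of two generators is trivial, or equal to some \<open>e\<close>, or a chain
  bracket, which is some \<open>e\<close> modulo \<open>\<gamma> 3\<close>.\<close>

lemma \<gamma>2_spanned: "\<gamma> 2 \<subseteq> generate G (E 0 \<union> \<gamma> 3)"
proof -
  define A where "A = {a i j | i j. ok i j}"
  have A: "A \<subseteq> carrier G" by (auto simp: A_def)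
  have gen: "carrier G \<subseteq> generate G A" using a_gen by (simp add: A_def ok_def)
  then have "\<gamma> 1 \<subseteq> generate G (A \<union> \<gamma> (Suc 1))"
    using mono_generate[of A "A \<union> \<gamma> (Suc 1)"] by auto
  then have "\<gamma> 2 \<subseteq> generate G ((\<Union>s\<in>A. \<Union>x\<in>A. {cm s x}) \<union> \<gamma> 3)"
    using lower_central_Suc_span[OF gen A, of 1 A] A
    by (simp add: numeral_2_eq_2 numeral_3_eq_3)
  also have "\<dots> \<subseteq> generate G (E 0 \<union> \<gamma> 3)"
  proof (rule generate_subgroup_incl)
    have c: "E 0 \<union> \<gamma> 3 \<subseteq> carrier G" using E_carrier lower_central_carrier by blast
    then show "subgroup (generate G (E 0 \<union> \<gamma> 3)) G" by (rule generate_is_subgroup)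
    have e: "e i j k \<in> generate G (E 0 \<union> \<gamma> 3)" if "ok i j" "ok i k" "j \<noteq> k" for i j k
      using X_in_generate_E[of i j k "[]" 0] that by (simp add: X_def)
    have "cm (a i j) (a k l) \<in> generate G (E 0 \<union> \<gamma> 3)" if o: "ok i j" "ok k l" for i j k l
    proof -
      consider "i = k" "j = l" | "i = k" "j \<noteq> l" | "i = l" | "k = j" | "i \<noteq> k" "i \<noteq> l" "k \<noteq> j"
        by blast
      then show ?thesis
      proof cases
        case 1
        then show ?thesis using o by (simp add: cm_eq_one generate.one)
      next
        case 2
        then show ?thesis using e o by (simp add: e_def)
      next
        case 3
        then have "cong 3 (cm (a i j) (a k l)) (e k i j)" using cm_chain' o by simp
        moreover have "e k i j \<in> generate G (E 0 \<union> \<gamma> 3)" using 3 o by (intro e) (auto simp: ok_def)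
        ultimately show ?thesis using cong_generate E_carrier by blast
      next
        case 4
        then have "cong 3 (cm (a i j) (a k l)) (e i l j)" using cm_chain o by simp
        moreover have "e i l j \<in> generate G (E 0 \<union> \<gamma> 3)" using 4 o by (intro e) (auto simp: ok_def)
        ultimately show ?thesis using cong_generate E_carrier by blast
      next
        case 5
        then show ?thesis using o by (simp add: cm_commuting generate.one)
      qed
    qed
    then show "(\<Union>s\<in>A. \<Union>x\<in>A. {cm s x}) \<union> \<gamma> 3 \<subseteq> generate G (E 0 \<union> \<gamma> 3)"
      by (auto simp: A_def intro: generate.incl)
  qed
  finally show ?thesis .
qed

lemma xop_cong4:
  assumes "cong 4 x y" "set L \<subseteq> {1..<i}" "i \<le> n"
  shows "cong (length L + 4) (xop (map (a i) L) x) (xop (map (a i) L) y)"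
  using xop_cong[of "map (a i) L" 4 x y] assms by (simp add: add.commute)

lemma xop_cong5:
  assumes "cong 5 x y" "set L \<subseteq> {1..<i}" "i \<le> n"
  shows "cong (length L + 5) (xop (map (a i) L) x) (xop (map (a i) L) y)"
  using xop_cong[of "map (a i) L" 5 x y] assms by (simp add: add.commute)

lemma xop_Cons_right:
  assumes "set L \<subseteq> {1..<i}" "ok i q" "x \<in> \<gamma> 2"
  shows "xop (map (a i) L) (cm (a i q) x) = xop (map (a i) (q # L)) x"
  using assms by (simp add: xop_cm okD)

text \<open>Every generator of the module acts on an element \<open>X i L j k\<close> through the
  variables \<open>a i q\<close> alone.\<close>

lemma cm_X_in_generate:
  assumes pq: "ok p q" and o: "ok i j" "ok i k" "j < k" and L: "set L \<subseteq> {1..<i}" "length L = r"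
  shows "cm (a p q) (X i L j k) \<in> generate G (E (Suc r) \<union> \<gamma> (r + 4))"
proof -
  let ?H = "generate G (E (Suc r) \<union> \<gamma> (r + 4))"
  have L': "set (map (a i) L) \<subseteq> carrier G" "i \<le> n" using L o by (auto simp: ok_def intro!: a_closed)
  have pull: "cm (a p q) (X i L j k) = xop (map (a i) L) (cm (a p q) (e i j k))"
    unfolding X_def using L' o pq by (simp add: xop_cm)
  have up: "x \<in> ?H" if "cong (r + 4) x y" "y \<in> ?H" for x y
    using cong_generate[OF that(1)] that(2) E_carrier by blast
  have one: "\<one> \<in> ?H" by (rule generate.one)
  have XH: "X i' M b l \<in> ?H" "inv (X i' M b l) \<in> ?H"
    if "ok i' b" "ok i' l" "b \<noteq> l" "set M \<subseteq> {1..<i'}" "length M = Suc r" for i' M b l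
    using that X_in_generate_E[of i' b l M] X_in_generate_E[of i' l b M] X_swap[of M i' b l] by auto
  \<comment> \<open>If the variable starts at an entry of the bracket, \<open>rel_A\<close> replaces
    it by one with first index \<open>i\<close>. The inverse is included so that the claim serves
    the second entry as well, after a swap.\<close>
  have A: "cm (a p q) (X i L p c) \<in> ?H \<and> inv (cm (a p q) (X i L p c)) \<in> ?H"
    if c: "ok i p" "ok i c" "p \<noteq> c" for c
  proof -
    have oq: "ok i q" using pq c by (auto simp: ok_def)
    have "cm (a p q) (X i L p c) = xop (map (a i) L) (cm (a p q) (e i p c))"
      unfolding X_def using L' c pq by (simp add: xop_cm)
    moreover have "cong (r + 4) (xop (map (a i) L) (cm (a p q) (e i p c)))
        (xop (map (a i) L) (cm (a i c) (e i q p)))"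
      using rel_A[of p q i c] xop_cong4 c pq L o by (metis okD(3))
    moreover have "xop (map (a i) L) (cm (a i c) (e i q p)) = X i (c # L) q p"
      unfolding X_def using c oq L by (intro xop_Cons_right) auto
    moreover have "X i (c # L) q p \<in> ?H" "inv (X i (c # L) q p) \<in> ?H"
      using XH[of i q p "c # L"] c oq pq L by (auto simp: ok_def)
    ultimately show ?thesis using up cong_inv by metis
  qed
  consider "p = i" | "p = j" | "p = k" | "q = i" | "p \<notin> {i, j, k}" "q \<noteq> i" by blast
  then show ?thesis
  proof cases
    case 1
    then have "cm (a p q) (X i L j k) = X i (q # L) j k" by (simp add: X_def)
    moreover have "\<dots> \<in> ?H" using XH(1)[of i j k "q # L"] o L pq 1 by (auto simp: ok_def)
    ultimately show ?thesis by simp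
  next
    case 2
    then show ?thesis using A[of k] o by auto
  next
    case 3
    have "X i L j k = inv (X i L k j)" using X_swap L o by simp
    then have "cm (a p q) (X i L j k) = inv (cm (a p q) (X i L k j))"
      using o L pq by (simp add: cm_inv_hom)
    then show ?thesis using A[of j] 3 o by auto
  next
    \<comment> \<open>A variable ending at \<open>i\<close> moves a bare bracket to first index
      \<open>p\<close>, and gives zero as soon as a monomial stands in front of the bracket.\<close>
    case 4
    have op: "ok p j" "ok p k" "ok p i" using pq 4 o by (auto simp: ok_def)
    show ?thesis
    proof (cases L)
      case Nil
      then have "cong (r + 4) (cm (a p q) (X i L j k)) (inv (cm (a p i) (e p j k)))"
        using rel_P[of p i j k] o op 4 L by (simp add: X_def)
      moreover have "cm (a p i) (e p j k) = X p [i] j k" by (simp add: X_def)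
      moreover have "inv (X p [i] j k) \<in> ?H"
        using XH(2)[of p j k "[i]"] op o L Nil by (auto simp: ok_def)
      ultimately show ?thesis using up by metis
    next
      case (Cons q' M)
      have M: "set M \<subseteq> {1..<i}" "ok i q'" "r = Suc (length M)" using L o Cons by (auto simp: ok_def)
      have "cm (a p q) (X i L j k) = xop (map (a i) M) (cm (a p i) (cm (a i q') (e i j k)))"
        using pull Cons M o op 4 by (simp add: xop_cm[symmetric] okD cm_cm_commute[of "a i q'"])
      moreover have "cong (length M + 5) (xop (map (a i) M) (cm (a p i) (cm (a i q') (e i j k))))
          (xop (map (a i) M) \<one>)"
        using M o op by (intro xop_cong5 rel_P0) (auto simp: ok_def)
      ultimately show ?thesis using up[OF _ one] M o by (simp add: okD add.commute)
    qed
  next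
    case 5
    then have "cm (a p q) (X i L j k) = \<one>" using pull rel_Z[of p q i j k] pq o L' by simp
    then show ?thesis using one by simp
  qed
qed

lemma lower_central_spanned_E: "\<gamma> (r + 2) \<subseteq> generate G (E r \<union> \<gamma> (r + 3))"
proof (induction r)
  case 0
  then show ?case using \<gamma>2_spanned by (simp only: add_0)
next
  case (Suc r)
  define A where "A = {a i j | i j. ok i j}"
  have A: "A \<subseteq> carrier G" by (auto simp: A_def)
  have gen: "carrier G \<subseteq> generate G A" using a_gen by (simp add: A_def ok_def)
  have eqs: "Suc (r + 2) = Suc r + 2" "Suc (Suc r + 2) = r + 4" "Suc r + 3 = r + 4" "r + 3 = Suc (r + 2)"
    by simp_all
  have "\<gamma> (Suc (r + 2)) \<subseteq> generate G ((\<Union>s\<in>A. \<Union>x\<in>E r. {cm s x}) \<union> \<gamma> (Suc (Suc (r + 2))))"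
    using Suc[unfolded eqs(4)] by (intro lower_central_Suc_span[OF gen A _ E_subset]) auto
  then have "\<gamma> (Suc r + 2) \<subseteq> generate G ((\<Union>s\<in>A. \<Union>x\<in>E r. {cm s x}) \<union> \<gamma> (r + 4))"
    by (simp only: eqs)
  also have "\<dots> \<subseteq> generate G (E (Suc r) \<union> \<gamma> (r + 4))"
  proof (rule generate_subgroup_incl)
    have c: "E (Suc r) \<union> \<gamma> (r + 4) \<subseteq> carrier G" using E_carrier lower_central_carrier by blast
    then show "subgroup (generate G (E (Suc r) \<union> \<gamma> (r + 4))) G" by (rule generate_is_subgroup)
    show "(\<Union>s\<in>A. \<Union>x\<in>E r. {cm s x}) \<union> \<gamma> (r + 4) \<subseteq> generate G (E (Suc r) \<union> \<gamma> (r + 4))"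
      using cm_X_in_generate by (auto simp: A_def E_def[of r] intro: generate.incl)
  qed
  finally show ?case by (simp only: eqs)
qed

text \<open>Here \<open>N\<close> is a multiset of size \<open>r + 1\<close> over \<open>{1..l}\<close> and \<open>canon i l N\<close> is
  \<open>x\<^sup>N\<^sup>-\<^sup>b e\<^sub>i\<^sub>;\<^sub>b\<^sub>l\<close> with \<open>b\<close> the least element of \<open>N\<close>. Any other
  element of \<open>N\<close> could take the role of \<open>b\<close>, except that in degree
  \<open>{b, c, l, \<dots>, l}\<close> there are two genuinely different choices; the second one is \<open>extra\<close>.\<close>

definition canon :: "nat \<Rightarrow> nat \<Rightarrow> nat multiset \<Rightarrow> 'a"
  where "canon i l N =
    X i (sorted_list_of_multiset (N - {#Min (set_mset N)#})) (Min (set_mset N)) l"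

definition extra :: "nat \<Rightarrow> nat \<Rightarrow> nat \<Rightarrow> nat \<Rightarrow> nat \<Rightarrow> 'a"
  where "extra r i l c b = X i (b # replicate (r - 1) l) c l"

text \<open>The multiset consisting of \<open>l\<close> alone is removed: its least element is
  \<open>l\<close> itself, and the bracket \<open>e i l l\<close> is trivial.\<close>

definition canon_index :: "nat \<Rightarrow> (nat \<times> nat \<times> nat multiset) set"
  where "canon_index r = (SIGMA i:{1..n}. SIGMA l:{1..<i}.
    multisets_of_size {1..l} (Suc r) - {replicate_mset (Suc r) l})"

text \<open>In degree 0 there is no monomial and hence no second choice; emptiness there also keeps
  the truncated \<open>r - 1\<close> in \<open>extra\<close> harmless.\<close>

definition extra_index :: "nat \<Rightarrow> (nat \<times> nat \<times> nat \<times> nat) set"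
  where "extra_index r = (if r = 0 then {} else
    SIGMA i:{1..n}. SIGMA l:{1..<i}. SIGMA c:{1..<l}. {1..<c})"

definition basis :: "nat \<Rightarrow> nat \<times> nat \<times> nat multiset + nat \<times> nat \<times> nat \<times> nat \<Rightarrow> 'a"
  where "basis r = case_sum (\<lambda>(i, l, N). canon i l N) (\<lambda>(i, l, c, b). extra r i l c b)"

definition basis_index :: "nat \<Rightarrow> (nat \<times> nat \<times> nat multiset + nat \<times> nat \<times> nat \<times> nat) set"
  where "basis_index r = canon_index r <+> extra_index r"

lemma canon_indexD:
  assumes "(i, l, N) \<in> canon_index r"
  defines "b \<equiv> Min (set_mset N)"
  shows "ok i l" "1 \<le> b" "b < l" "ok i b" "set_mset N \<subseteq> {1..l}" "size N = Suc r" "b \<in># N"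
    "set (sorted_list_of_multiset (N - {#b#})) \<subseteq> {1..l}"
    "length (sorted_list_of_multiset (N - {#b#})) = r"
proof -
  show N: "ok i l" "set_mset N \<subseteq> {1..l}" "size N = Suc r"
    using assms by (auto simp: canon_index_def multisets_of_size_def ok_def)
  have neq: "N \<noteq> replicate_mset (Suc r) l" using assms by (auto simp: canon_index_def)
  have ne: "set_mset N \<noteq> {}" using N(3) by auto
  then show b: "b \<in># N" unfolding b_def by (intro Min_in) auto
  then show "1 \<le> b" using N(2) by auto
  show bl: "b < l"
  proof (rule ccontr)
    assume "\<not> b < l"
    then have "x = l" if "x \<in># N" for x
    proof -
      have "b \<le> x" unfolding b_def using that by (intro Min_le) auto
      moreover have "x \<le> l" using N(2) that by auto
      ultimately show ?thesis using \<open>\<not> b < l\<close> by simp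
    qed
    then have "N = replicate_mset (size N) l"
      by (metis set_mset_subset_singletonD singletonI subsetI)
    then show False using neq N(3) by simp
  qed
  then show "ok i b" using \<open>1 \<le> b\<close> N(1) by (auto simp: ok_def)
  show "set (sorted_list_of_multiset (N - {#b#})) \<subseteq> {1..l}"
    using N(2) by (auto dest: in_diffD simp del: One_nat_def)
  show "length (sorted_list_of_multiset (N - {#b#})) = r"
    using N(3) b by (metis diff_Suc_1 mset_sorted_list_of_multiset size_Diff_singleton size_mset)
qed

lemma basis_mem:
  assumes "s \<in> basis_index r"
  shows "basis r s \<in> \<gamma> (r + 2)"
proof (cases s)
  case (Inl t)
  then obtain i l N where t: "s = Inl (i, l, N)" by (cases t) auto
  then have I: "(i, l, N) \<in> canon_index r" using assms by (auto simp: basis_index_def)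
  let ?L = "sorted_list_of_multiset (N - {#Min (set_mset N)#})"
  have "set ?L \<subseteq> {1..<i}" using canon_indexD[OF I] by (force simp: ok_def)
  then have "X i ?L (Min (set_mset N)) l \<in> \<gamma> (length ?L + 2)"
    using canon_indexD[OF I] by (intro X_mem) auto
  then show ?thesis
    unfolding t basis_def using canon_indexD(9)[OF I] by (simp only: sum.case prod.case canon_def)
next
  case (Inr t)
  then obtain i l c b where t: "s = Inr (i, l, c, b)" by (cases t) auto
  then have I: "(i, l, c, b) \<in> extra_index r" using assms by (auto simp: basis_index_def)
  then have o: "r > 0" "ok i l" "ok i b" "ok i c" "1 \<le> l" "1 \<le> b" "l < i" "b < i"
    by (auto simp: extra_index_def ok_def split: if_splits)
  have "set (b # replicate (r - 1) l) \<subseteq> {1..<i}" using o by (auto split: if_splits)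
  then have "X i (b # replicate (r - 1) l) c l \<in> \<gamma> (length (b # replicate (r - 1) l) + 2)"
    using o by (intro X_mem) auto
  moreover have "length (b # replicate (r - 1) l) = r" using o by simp
  ultimately show ?thesis
    unfolding t basis_def by (simp only: sum.case prod.case extra_def)
qed

text \<open>\<open>rel_S\<close> exchanges the least element \<open>m\<close> with the bracket entry
  \<open>b\<close>, provided that the monomial contains a further variable other than
  \<open>l\<close>. If it contains none, the element is one of the extra ones.\<close>

lemma X_in_generate_basis:
  assumes o: "ok i l" "1 \<le> b" "b < l" and L: "set L \<subseteq> {1..l}" "length L = r"
  shows "X i L b l \<in> generate G (basis r ` basis_index r \<union> \<gamma> (r + 3))"
proof -
  let ?H = "generate G (basis r ` basis_index r \<union> \<gamma> (r + 3))"
  define M where "M = add_mset b (mset L)"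
  define m where "m = Min (set_mset M)"
  define K where "K = sorted_list_of_multiset (M - {#m#})"
  have ob: "ok i b" using o by (auto simp: ok_def)
  have "b \<in># M" by (simp add: M_def)
  then have "M \<noteq> replicate_mset (Suc r) l"
    using o by (metis in_replicate_mset less_irrefl)
  then have I: "(i, l, M) \<in> canon_index r"
    using o L by (auto simp: canon_index_def multisets_of_size_def M_def ok_def simp del: One_nat_def)
  note D = canon_indexD[OF I, folded m_def, folded K_def]
  have K: "mset K = M - {#m#}" by (simp add: K_def)
  have Ki: "set K \<subseteq> {1..<i}" using D o by (force simp: ok_def)
  have Li: "set L \<subseteq> {1..<i}" using L o by (force simp: ok_def)
  have "basis r (Inl (i, l, M)) \<in> ?H"
    using I by (intro generate.incl) (auto simp: basis_index_def)
  then have canon: "X i K m l \<in> ?H" by (simp add: basis_def canon_def K_def m_def)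
  show ?thesis
  proof (cases "m = b")
    case True
    then have "mset L = mset K" by (simp add: K M_def)
    then show ?thesis using X_mset[of L K i b l] canon Li o ob True by simp
  next
    case False
    then have mL: "m \<in> set L" using D(7) by (auto simp: M_def)
    have mb: "m \<le> b" unfolding m_def M_def by (intro Min_le) auto
    have olm: "ok l m" "ok l b" "ok i m" using mb False D(2) o by (auto simp: ok_def)
    define L1 where "L1 = remove1 m L"
    have L1: "mset L = add_mset m (mset L1)" "set L1 \<subseteq> {1..l}"
      using mL set_remove1_subset[of m L] L by (auto simp: L1_def simp del: One_nat_def)
    show ?thesis
    proof (cases "\<exists>q\<in>set L1. q \<noteq> l")
      case True
      then obtain q where q: "q \<in> set L1" "q \<noteq> l" by auto
      define L2 where "L2 = remove1 q L1"
      have L2: "mset L = mset (L2 @ [q, m])" "set L2 \<subseteq> {1..l}"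
        using L1 q set_remove1_subset[of q L1] by (auto simp: L2_def simp del: One_nat_def)
      have i: "set L2 \<subseteq> {1..<i}" "i \<le> n" "ok i q" using L2 o q L1 by (force simp: ok_def)+
      have len: "length L2 + 5 = r + 3" using L(2) arg_cong[OF L2(1), of size] by simp
      have "mset K = mset (L2 @ [q, b])" using L2(1) by (simp add: K M_def)
      then have canon': "X i (L2 @ [q, b]) m l \<in> ?H"
        using canon X_mset[of K "L2 @ [q, b]" i m l] Ki olm o by simp
      have "X i L b l = X i (L2 @ [q, m]) b l" using X_mset[OF L2(1)] Li ob o by simp
      also have "\<dots> = xop (map (a i) L2) (cm (a i q) (cm (a i m) (e i b l)))"
        by (simp add: X_def xop_append)
      also have "cong (r + 3) \<dots> (xop (map (a i) L2) (cm (a i q) (cm (a i b) (e i m l))))"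
        unfolding len[symmetric] using rel_S[of i l b m q] o olm q i by (intro xop_cong5) auto
      also have "xop (map (a i) L2) (cm (a i q) (cm (a i b) (e i m l))) = X i (L2 @ [q, b]) m l"
        by (simp add: X_def xop_append)
      finally show ?thesis
        by (rule cong_generate[OF _ _ canon']) (use basis_mem lower_central_carrier in blast)
    next
      case False
      then have "mset L1 = replicate_mset (size (mset L1)) l"
        by (metis set_mset_mset set_mset_subset_singletonD singletonI subsetI)
      moreover have "size (mset L1) = r - 1" "r > 0" using L(2) arg_cong[OF L1(1), of size] by auto
      ultimately have "mset L = mset (m # replicate (r - 1) l)" "r > 0" using L1(1) by auto
      then have "X i L b l = extra r i l b m"
        using X_mset[of L "m # replicate (r - 1) l" i b l] Li ob o by (simp add: extra_def)
      moreover have "(i, l, b, m) \<in> extra_index r"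
        using \<open>r > 0\<close> olm ob o \<open>m \<noteq> b\<close> mb by (auto simp: extra_index_def ok_def)
      then have "basis r (Inr (i, l, b, m)) \<in> ?H"
        by (intro generate.incl) (auto simp: basis_index_def)
      ultimately show ?thesis by (simp add: basis_def)
    qed
  qed
qed

lemma lower_central_spanned:
  "\<gamma> (r + 2) \<subseteq> generate G (basis r ` basis_index r \<union> \<gamma> (r + 3))"
proof -
  let ?H = "generate G (basis r ` basis_index r \<union> \<gamma> (r + 3))"
  have c: "basis r ` basis_index r \<union> \<gamma> (r + 3) \<subseteq> carrier G"
    using basis_mem lower_central_carrier by blast
  have "X i L j k \<in> ?H"
    if o: "ok i j" "ok i k" "j < k" and L: "set L \<subseteq> {1..<i}" "length L = r" for i j k L
  proof (cases "set L \<subseteq> {1..k}")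
    case True
    then show ?thesis using X_in_generate_basis[of i k j L r] o L by (auto simp: ok_def)
  next
    case False
    \<comment> \<open>A variable beyond both bracket entries is drawn into the bracket by
      \<open>rel_K\<close>. Taking the largest one leaves monomials over \<open>{1..q}\<close>, as
      \<open>X_in_generate_basis\<close> requires.\<close>
    define q where "q = Max (set L)"
    have "set L \<noteq> {}" using False by auto
    then have q: "q \<in> set L" "\<And>x. x \<in> set L \<Longrightarrow> x \<le> q" by (auto simp: q_def)
    obtain x where "x \<in> set L" "\<not> x \<le> k" using False L by force
    then have kq: "k < q" using q(2)[of x] by simp
    have oq: "ok i q" using q(1) L o by (auto simp: ok_def)
    define L' where "L' = remove1 q L"
    have sub: "set L' \<subseteq> set L" by (simp add: L'_def set_remove1_subset)
    have L': "mset L = mset (L' @ [q])" "set L' \<subseteq> {1..<i}"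
      using q L sub by (auto simp: L'_def)
    moreover have "set L' \<subseteq> {1..q}"
    proof
      fix x assume "x \<in> set L'"
      then have "x \<in> set L" using sub by blast
      then show "x \<in> {1..q}" using q(2) L(1) by auto
    qed
    ultimately have L': "mset L = mset (L' @ [q])" "set L' \<subseteq> {1..<i}" "set L' \<subseteq> {1..q}" by simp_all
    then have len: "length L = Suc (length L')" by (metis size_mset length_append_singleton)
    have "X i L j k = X i (L' @ [q]) j k" using X_mset[OF L'(1)] L o by simp
    also have "\<dots> = xop (map (a i) L') (cm (a i k) (e i j q) \<otimes> inv (cm (a i j) (e i k q)))"
      using rel_K[of i q j k] o oq by (simp add: X_def xop_append)
    also have "\<dots> = X i (L' @ [k]) j q \<otimes> inv (X i (L' @ [j]) k q)"
      using o oq L' by (simp add: X_def xop_append xop_mult xop_inv okD)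
    finally have eq: "X i L j k = X i (L' @ [k]) j q \<otimes> inv (X i (L' @ [j]) k q)" .
    have "X i (L' @ [k]) j q \<in> ?H" "X i (L' @ [j]) k q \<in> ?H"
      using X_in_generate_basis[of i q j "L' @ [k]" r] X_in_generate_basis[of i q k "L' @ [j]" r]
        o oq kq L L' len by (auto simp: ok_def)
    then show ?thesis unfolding eq
      using generate_m_inv_closed[OF c] by (intro generate.eng) auto
  qed
  then have "E r \<union> \<gamma> (r + 3) \<subseteq> ?H" by (auto simp: E_def intro: generate.incl)
  then have "generate G (E r \<union> \<gamma> (r + 3)) \<subseteq> ?H"
    using generate_subgroup_incl generate_is_subgroup[OF c] by blast
  then show ?thesis using lower_central_spanned_E by blast
qed

end

unbundle fps_syntax

section \<open>Ranks of graded pieces through additive functionals\<close>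

lemma (in comm_group) additive_finprod:
  fixes \<psi> :: "'a \<Rightarrow> rat"
  assumes \<psi>: "\<And>x y. x \<in> carrier G \<Longrightarrow> y \<in> carrier G \<Longrightarrow> \<psi> (x \<otimes> y) = \<psi> x + \<psi> y"
    and I: "finite I" and y: "y \<in> I \<rightarrow> carrier G"
  shows "\<psi> (\<Otimes>i\<in>I. y i [^] (c i :: int)) = (\<Sum>i\<in>I. of_int (c i) * \<psi> (y i))"
proof -
  have one: "\<psi> \<one> = 0" using \<psi>[of \<one> \<one>] by simp
  have inv: "\<psi> (inv x) = - \<psi> x" if "x \<in> carrier G" for x
    using \<psi>[of x "inv x"] that one by (simp add: eq_neg_iff_add_eq_0 add.commute)
  have nat: "\<psi> (x [^] m) = of_nat m * \<psi> x" if "x \<in> carrier G" for x and m :: nat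
    using that by (induction m) (auto simp: one \<psi> algebra_simps)
  have pow: "\<psi> (x [^] k) = of_int k * \<psi> x" if "x \<in> carrier G" for x and k :: int
    by (cases k rule: int_cases2) (use that in \<open>auto simp: nat inv int_pow_int int_pow_neg\<close>)
  show ?thesis
    using I y by (induction I rule: finite_induct) (auto simp: one \<psi> pow Pi_iff)
qed

context group
begin

text \<open>An additive function that vanishes on the next term factors through the graded piece, so
  every relation in the quotient passes to its values. Independence is therefore asked only of
  coefficients that satisfy the resulting equation for every such function.\<close>

theorem ab_rank_gr_eq_card:
  assumes k: "k \<ge> 1" and I: "finite I" and y: "\<And>i. i \<in> I \<Longrightarrow> y i \<in> \<gamma> k"
    and span: "\<gamma> k \<subseteq> generate G (y ` I \<union> \<gamma> (Suc k))"
    and ind: "\<And>c::_ \<Rightarrow> int. (\<And>\<phi>::'a \<Rightarrow> rat.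
        (\<And>x z. x \<in> \<gamma> k \<Longrightarrow> z \<in> \<gamma> k \<Longrightarrow> \<phi> (x \<otimes> z) = \<phi> x + \<phi> z) \<Longrightarrow>
        (\<And>x. x \<in> \<gamma> (Suc k) \<Longrightarrow> \<phi> x = 0) \<Longrightarrow>
        (\<Sum>i\<in>I. of_int (c i) * \<phi> (y i)) = 0) \<Longrightarrow> \<forall>i\<in>I. c i = 0"
  shows "ab_rank (gr G k) = enat (card I)"
proof -
  define H where "H = G\<lparr>carrier := \<gamma> k\<rparr>"
  define N where "N = \<gamma> (Suc k)"
  have gr: "gr G k = H Mod N" by (simp add: gr_def H_def N_def)
  interpret C: comm_group "H Mod N" using comm_group_gr[OF k] gr by simp
  interpret S: subgroup "\<gamma> k" G by (rule lower_central_subgroup)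
  interpret H: group H unfolding H_def by (rule S.subgroup_is_group[OF group_axioms])
  have NH: "N \<lhd> H"
    unfolding H_def N_def
    by (rule normal_restrict_supergroup[OF lower_central_subgroup lower_central_normal
          lower_central_Suc_subset])
  interpret N: normal N H by (rule NH)
  define \<pi> where "\<pi> x = N #>\<^bsub>H\<^esub> x" for x
  have \<pi>: "\<pi> \<in> hom H (H Mod N)" unfolding \<pi>_def by (rule N.r_coset_hom_Mod)
  interpret \<pi>: group_hom H "H Mod N" \<pi>
    by (simp add: group_hom_def group_hom_axioms_def \<pi> C.is_group H.is_group)
  have cH: "carrier H = \<gamma> k" by (simp add: H_def)
  have \<pi>N: "\<pi> x = \<one>\<^bsub>H Mod N\<^esub>" if "x \<in> N" for x
    using that by (simp add: \<pi>_def H.coset_join2 N.subset[THEN subsetD] N.subgroup_axioms)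
  have sub: "y ` I \<union> N \<subseteq> \<gamma> k"
    using y lower_central_Suc_subset[of k] by (auto simp: N_def)
  have gen: "\<pi> x \<in> generate (H Mod N) ((\<lambda>i. \<pi> (y i)) ` I)" if "x \<in> generate G (y ` I \<union> N)" for x
  proof -
    have "x \<in> generate H (y ` I \<union> N)"
      using that generate_consistent[OF sub lower_central_subgroup] by (simp add: H_def)
    moreover have one: "\<pi> h \<in> generate (H Mod N) ((\<lambda>i. \<pi> (y i)) ` I)" if "h \<in> N" for h
      unfolding \<pi>N[OF that] by (rule generate.one)
    ultimately show ?thesis
    proof (induction x rule: generate.induct)
      case one
      then show ?case using generate.one[of "H Mod N"] \<pi>.hom_one by metis
    next
      case (incl h)
      then show ?case by (auto intro: one generate.incl)
    next
      case (inv h)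
      have "h \<in> carrier H" using inv sub by (auto simp: cH)
      then have "\<pi> (inv\<^bsub>H\<^esub> h) = inv\<^bsub>H Mod N\<^esub> \<pi> h" by simp
      moreover have "h \<in> N \<Longrightarrow> inv\<^bsub>H\<^esub> h \<in> N" by simp
      ultimately show ?case using inv one[of "inv\<^bsub>H\<^esub> h"] by (metis Un_iff generate.inv imageE imageI)
    next
      case (eng h1 h2)
      then have "h1 \<in> carrier H" "h2 \<in> carrier H"
        using H.generate_in_carrier[of "y ` I \<union> N"] sub by (auto simp: cH)
      then have "\<pi> (h1 \<otimes>\<^bsub>H\<^esub> h2) = \<pi> h1 \<otimes>\<^bsub>H Mod N\<^esub> \<pi> h2" by (rule \<pi>.hom_mult)
      then show ?case using generate.eng[OF eng.IH[OF one]] by (simp only:)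
    qed
  qed
  have car: "carrier (H Mod N) = \<pi> ` \<gamma> k"
    by (auto simp: carrier_FactGroup \<pi>_def cH)
  have "ab_rank (H Mod N) = enat (card I)"
  proof (rule C.ab_rank_eq_card[OF I])
    show "(\<lambda>i. \<pi> (y i)) \<in> I \<rightarrow> carrier (H Mod N)" using y car by auto
    show "carrier (H Mod N) \<subseteq> generate (H Mod N) ((\<lambda>i. \<pi> (y i)) ` I)"
      using gen span car by (auto simp: N_def)
    fix c :: "_ \<Rightarrow> int"
    assume c: "(\<Otimes>\<^bsub>H Mod N\<^esub>i\<in>I. \<pi> (y i) [^]\<^bsub>H Mod N\<^esub> c i) = \<one>\<^bsub>H Mod N\<^esub>"
    show "\<forall>i\<in>I. c i = 0"
    proof (rule ind)
      fix \<phi> :: "'a \<Rightarrow> rat"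
      assume add: "\<And>x z. x \<in> \<gamma> k \<Longrightarrow> z \<in> \<gamma> k \<Longrightarrow> \<phi> (x \<otimes> z) = \<phi> x + \<phi> z"
        and zero: "\<And>x. x \<in> \<gamma> (Suc k) \<Longrightarrow> \<phi> x = 0"
      \<comment> \<open>The additive group of the rationals as a monoid record, so that the
        universal property of the quotient applies to \<open>\<phi>\<close>.\<close>
      define Q :: "rat monoid" where "Q = \<lparr>carrier = UNIV, monoid.mult = (+), one = 0\<rparr>"
      interpret Q: group Q
        by (rule groupI) (auto simp: Q_def algebra_simps intro: exI[of _ "- x" for x])
      interpret \<phi>: group_hom H Q \<phi>
        by unfold_locales (auto simp: hom_def add H_def Q_def)
      have "N \<subseteq> kernel H Q \<phi>"
        using zero N.subset by (auto simp: kernel_def N_def Q_def)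
      then obtain \<psi> where \<psi>: "\<psi> \<in> hom (H Mod N) Q" "\<And>x. x \<in> carrier H \<Longrightarrow> \<psi> (\<pi> x) = \<phi> x"
        using \<phi>.FactGroup_universal_kernel[OF NH] unfolding \<pi>_def by blast
      have \<psi>add: "\<psi> (x \<otimes>\<^bsub>H Mod N\<^esub> z) = \<psi> x + \<psi> z"
        if "x \<in> carrier (H Mod N)" "z \<in> carrier (H Mod N)" for x z
        using \<psi>(1) that by (auto simp: hom_def Q_def)
      have "(\<Sum>i\<in>I. of_int (c i) * \<psi> (\<pi> (y i))) = \<psi> \<one>\<^bsub>H Mod N\<^esub>"
        using c y car by (subst C.additive_finprod[OF \<psi>add I, symmetric]) auto
      also have "\<psi> \<one>\<^bsub>H Mod N\<^esub> = 0" 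
        using \<psi>add[OF C.one_closed C.one_closed] C.l_one[OF C.one_closed]
        by (metis add_cancel_right_right)
      finally show "(\<Sum>i\<in>I. of_int (c i) * \<phi> (y i)) = 0"
        using \<psi>(2) y by (simp add: cH)
    qed
  qed
  then show ?thesis by (simp add: gr)
qed

end


section \<open>Triangular matrices over power series\<close>

text \<open>The triple \<open>(u, t, d)\<close> stands for the matrix with rows \<open>(u, d)\<close> and \<open>(0, t)\<close>.\<close>

definition tri :: "('k::comm_ring_1 fps \<times> 'k fps \<times> 'k fps) monoid" where
  "tri = \<lparr>carrier = {(u, t, d). u $ 0 = 1 \<and> t $ 0 = 1},
     monoid.mult = (\<lambda>(u, t, d) (u', t', d'). (u * u', t * t', t' * d + u * d')),
     one = (1, 1, 0)\<rparr>"

lemma fps_inverse_exists: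
  fixes f :: "'k::comm_ring_1 fps"
  assumes "f $ 0 = 1"
  shows "\<exists>g. g $ 0 = 1 \<and> g * f = 1"
proof -
  have "f * fps_right_inverse f 1 = 1" using assms by (intro fps_right_inverse) simp
  moreover have "fps_right_inverse f 1 $ 0 = 1" by simp
  ultimately show ?thesis by (metis mult.commute)
qed

lemma group_tri: "group (tri :: ('k::comm_ring_1 fps \<times> 'k fps \<times> 'k fps) monoid)"
proof (rule groupI)
  fix x :: "'k fps \<times> 'k fps \<times> 'k fps"
  assume "x \<in> carrier tri"
  then obtain u t d where x: "x = (u, t, d)" "u $ 0 = 1" "t $ 0 = 1" by (auto simp: tri_def)
  obtain u' t' where i: "u' $ 0 = 1" "u' * u = 1" "t' $ 0 = 1" "t' * t = 1"
    using fps_inverse_exists[OF x(2)] fps_inverse_exists[OF x(3)] by auto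
  have "t * (- (t' * u' * d)) + u' * d = (1 - t' * t) * (u' * d)" by (simp add: algebra_simps)
  then have "t * (- (t' * u' * d)) + u' * d = 0" by (simp add: i)
  then show "\<exists>y\<in>carrier tri. y \<otimes>\<^bsub>tri\<^esub> x = \<one>\<^bsub>tri\<^esub>"
    by (intro bexI[of _ "(u', t', - (t' * u' * d))"]) (auto simp: tri_def x i)
qed (auto simp: tri_def algebra_simps)

locale tri_rep = group +
  fixes \<Psi> :: "'a \<Rightarrow> 'k::comm_ring_1 fps \<times> 'k fps \<times> 'k fps"
  assumes \<Psi>_hom: "\<Psi> \<in> hom G tri"
begin

definition u where "u g = fst (\<Psi> g)"
definition t where "t g = fst (snd (\<Psi> g))"
definition D where "D g = snd (snd (\<Psi> g))"
text \<open>Commutation with \<open>g\<close> multiplies the upper right entry of an element of the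
  derived subgroup by \<open>u g - t g\<close>, up to a unit with constant term 1; this is the
  leading coefficient of that factor.\<close>

definition \<delta> where "\<delta> g = (u g - t g) $ 1"

lemma ut_0 [simp]: "g \<in> carrier G \<Longrightarrow> u g $ 0 = 1" "g \<in> carrier G \<Longrightarrow> t g $ 0 = 1"
  using hom_in_carrier[OF \<Psi>_hom, of g] by (auto simp: tri_def u_def t_def)

lemma utD_mult:
  assumes "g \<in> carrier G" "h \<in> carrier G"
  shows "u (g \<otimes> h) = u g * u h" "t (g \<otimes> h) = t g * t h" "D (g \<otimes> h) = t h * D g + u g * D h"
  using hom_mult[OF \<Psi>_hom assms] by (auto simp: tri_def u_def t_def D_def split: prod.splits)

lemma fps_unit_cancel:
  fixes f :: "'k fps"
  assumes "f $ 0 = 1" "f * g = f * h"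
  shows "g = h"
  using fps_inverse_exists[OF assms(1)] assms(2) by (metis mult.assoc mult.left_neutral)

lemma utD_one: "u \<one> = 1" "t \<one> = 1" "D \<one> = 0"
proof -
  show "u \<one> = 1" "t \<one> = 1"
    using utD_mult(1,2)[of \<one> \<one>] fps_unit_cancel[of "u \<one>" 1 "u \<one>"] fps_unit_cancel[of "t \<one>" 1 "t \<one>"]
    by auto
  then show "D \<one> = 0" using utD_mult(3)[of \<one> \<one>] by simp
qed

lemma swap_eq: "g \<in> carrier G \<Longrightarrow> h \<in> carrier G \<Longrightarrow> cm g h \<otimes> (h \<otimes> g) = g \<otimes> h"
  by (simp add: cm_def m_assoc)

lemma ut_cm:
  assumes "g \<in> carrier G" "h \<in> carrier G"
  shows "u (cm g h) = 1" "t (cm g h) = 1"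
proof -
  have *: "u (h \<otimes> g) * u (cm g h) = u (h \<otimes> g) * 1" "t (h \<otimes> g) * t (cm g h) = t (h \<otimes> g) * 1"
    using arg_cong[OF swap_eq[OF assms], of u] arg_cong[OF swap_eq[OF assms], of t] assms
    by (simp_all add: utD_mult mult_ac)
  show "u (cm g h) = 1" "t (cm g h) = 1"
    using fps_unit_cancel[OF _ *(1)] fps_unit_cancel[OF _ *(2)] assms by simp_all
qed

lemma ut_derived:
  assumes "x \<in> \<gamma> (Suc k)" "k \<ge> 1"
  shows "u x = 1 \<and> t x = 1"
proof -
  have "x \<in> \<gamma> (Suc 1)" using assms lower_central_antimono[of "Suc 1" "Suc k"] by auto
  then have "x \<in> generate G (\<Union>h\<in>carrier G. \<Union>x\<in>carrier G. {cm h x})"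
    using lower_central_Suc_generate[of 1] by simp
  then show ?thesis
  proof (induction x rule: generate.induct)
    case (inv h)
    then have h: "h \<in> carrier G" "u h = 1 \<and> t h = 1" using ut_cm by auto
    then show ?case using utD_mult(1,2)[of h "inv h"] utD_one by simp
  next
    case (eng g h)
    moreover have "(\<Union>h\<in>carrier G. \<Union>x\<in>carrier G. {cm h x}) \<subseteq> carrier G" by auto
    ultimately have "g \<in> carrier G" "h \<in> carrier G" using generate_in_carrier by blast+
    then show ?case using eng by (simp add: utD_mult)
  qed (auto simp: utD_one ut_cm)
qed

lemma D_add:
  assumes "x \<in> \<gamma> (Suc k)" "y \<in> \<gamma> (Suc k)" "k \<ge> 1"
  shows "D (x \<otimes> y) = D x + D y"
  using utD_mult(3)[of x y] ut_derived[OF assms(1,3)] ut_derived[OF assms(2,3)]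
    lower_central_carrier assms by auto

text \<open>The upper right entries of
  \<open>cm g h \<otimes> (h \<otimes> g) = g \<otimes> h\<close> are compared, using that the
  diagonal of a commutator is 1.\<close>

lemma t_D_cm:
  assumes "g \<in> carrier G" "h \<in> carrier G"
  shows "t g * t h * D (cm g h) = (u g - t g) * D h - (u h - t h) * D g"
proof -
  have "D (cm g h \<otimes> (h \<otimes> g)) = D (g \<otimes> h)" using swap_eq[OF assms] by simp
  then show ?thesis using assms by (simp add: utD_mult ut_cm algebra_simps)
qed

lemma u_minus_t: "g \<in> carrier G \<Longrightarrow> \<exists>w. u g - t g = fps_X * w \<and> w $ 0 = \<delta> g"
proof -
  assume "g \<in> carrier G"
  then have "(u g - t g) $ 0 = 0" by simp
  then have "u g - t g = fps_X * fps_shift 1 (u g - t g)"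
    by (intro fps_ext) (auto simp: fps_X_mult_nth)
  then show ?thesis by (intro exI[of _ "fps_shift 1 (u g - t g)"]) (auto simp: \<delta>_def)
qed

lemma D_cm_nth:
  assumes "g \<in> carrier G" "h \<in> carrier G"
  shows "D (cm g h) $ 1 = \<delta> g * D h $ 0 - \<delta> h * D g $ 0" "D (cm g h) $ 0 = 0"
proof -
  obtain w v where w: "u g - t g = fps_X * w" "w $ 0 = \<delta> g" and v: "u h - t h = fps_X * v" "v $ 0 = \<delta> h"
    using u_minus_t assms by metis
  have "(t g * t h) $ 0 = 1" using assms by simp
  then obtain s where s: "s $ 0 = 1" "s * (t g * t h) = 1" using fps_inverse_exists by blast
  have "t g * t h * D (cm g h) = fps_X * (w * D h - v * D g)"
    by (simp only: t_D_cm[OF assms] w v) (simp add: algebra_simps)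
  moreover have "D (cm g h) = s * (t g * t h * D (cm g h))" using s by (simp add: mult.assoc[symmetric])
  ultimately have "D (cm g h) = s * (fps_X * (w * D h - v * D g))" by simp
  also have "\<dots> = fps_X * (s * (w * D h - v * D g))" by (simp add: mult_ac)
  finally have "D (cm g h) = fps_X * (s * (w * D h - v * D g))" .
  then show "D (cm g h) $ 1 = \<delta> g * D h $ 0 - \<delta> h * D g $ 0" "D (cm g h) $ 0 = 0"
    using s w v by (simp_all add: fps_X_mult_nth)
qed

lemma D_cm_lower_central:
  assumes g: "g \<in> carrier G" and x: "x \<in> \<gamma> (Suc k)" "k \<ge> 1" and d: "D x = fps_X ^ k * d"
  shows "\<exists>d'. D (cm g x) = fps_X ^ Suc k * d' \<and> d' $ 0 = \<delta> g * d $ 0"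
proof -
  obtain w where w: "u g - t g = fps_X * w" "w $ 0 = \<delta> g" using u_minus_t g by metis
  obtain s where s: "s $ 0 = 1" "s * t g = 1" using fps_inverse_exists g ut_0 by blast
  have xc: "x \<in> carrier G" using x lower_central_carrier by blast
  have "D (cm g x) = s * (t g * D (cm g x))" using s by (simp add: mult.assoc[symmetric])
  also have "t g * D (cm g x) = (u g - t g) * D x"
    using t_D_cm[OF g xc] ut_derived[OF x] by simp
  also have "s * \<dots> = fps_X ^ Suc k * (s * w * d)" by (simp add: w d mult_ac)
  finally show ?thesis using s w by (intro exI[of _ "s * w * d"]) simp
qed

text \<open>Each commutation contributes a factor \<open>u g - t g\<close>, which is divisible by
  \<open>fps_X\<close>, and \<open>D\<close> is additive on the derived subgroup. Hence the
  coefficient of index \<open>k\<close> is additive on \<open>\<gamma> (Suc k)\<close> and vanishes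
  on the next term.\<close>

lemma D_lower_central:
  assumes "k \<ge> 1" "x \<in> \<gamma> (Suc k)"
  shows "\<exists>d. D x = fps_X ^ k * d"
  using assms
proof (induction k arbitrary: x rule: nat_induct_at_least)
  case base
  show ?case
  proof -
    have "x \<in> generate G (\<Union>h\<in>carrier G. \<Union>x\<in>carrier G. {cm h x})"
      using base lower_central_Suc_generate[of 1] by simp
    then have "D x $ 0 = 0 \<and> x \<in> \<gamma> (Suc 1)"
    proof (induction x rule: generate.induct)
      case one
      then show ?case using utD_one subgroup.one_closed[OF lower_central_subgroup] by auto
    next
      case (incl h)
      then show ?case using D_cm_nth cm_lower_central[of 1] by auto
    next
      case (inv h)
      then have h: "h \<in> \<gamma> (Suc 1)" "D h $ 0 = 0" "h \<in> carrier G" using D_cm_nth cm_lower_central[of 1] by auto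
      then have h': "inv h \<in> \<gamma> (Suc 1)" using subgroup.m_inv_closed[OF lower_central_subgroup] by blast
      have "D h + D (inv h) = 0" using D_add[OF h(1) h'] h(3) utD_one by simp
      then have "(D h + D (inv h)) $ 0 = 0" by simp
      then show ?case using h h' by simp
    next
      case (eng g h)
      then show ?case using D_add[of g 1 h] subgroup.m_closed[OF lower_central_subgroup, of g "Suc 1" h] by auto
    qed
    then show ?thesis
      by (intro exI[of _ "fps_shift 1 (D x)"] fps_ext) (auto simp: fps_X_mult_nth)
  qed
next
  case (Suc k)
  have "x \<in> generate G (\<Union>h\<in>carrier G. \<Union>x\<in>\<gamma> (Suc k). {cm h x})"
    using Suc.prems lower_central_Suc_generate[of "Suc k"] by simp
  then have "(\<exists>d. D x = fps_X ^ Suc k * d) \<and> x \<in> \<gamma> (Suc (Suc k))"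
  proof (induction x rule: generate.induct)
    case one
    then show ?case
      using utD_one subgroup.one_closed[OF lower_central_subgroup] by (auto intro: exI[of _ 0])
  next
    case (incl h)
    then show ?case using D_cm_lower_central[OF _ _ Suc.hyps] Suc.IH cm_lower_central[of "Suc k"] by fastforce
  next
    case (inv h)
    then obtain d where h: "h \<in> \<gamma> (Suc (Suc k))" "D h = fps_X ^ Suc k * d" "h \<in> carrier G"
      using D_cm_lower_central[OF _ _ Suc.hyps] Suc.IH cm_lower_central[of "Suc k"] lower_central_carrier
      by fastforce
    then have h': "inv h \<in> \<gamma> (Suc (Suc k))" using subgroup.m_inv_closed[OF lower_central_subgroup] by blast
    have "D h + D (inv h) = 0" using D_add[OF h(1) h'] h(3) utD_one by simp
    then have "D (inv h) = fps_X ^ Suc k * (- d)" using h(2) by (simp add: eq_neg_iff_add_eq_0 add.commute)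
    then show ?case using h' by blast
  next
    case (eng g h)
    then obtain d d' where "D g = fps_X ^ Suc k * d" "D h = fps_X ^ Suc k * d'" by auto
    then have "D (g \<otimes> h) = fps_X ^ Suc k * (d + d')"
      using D_add[of g "Suc k" h] eng by (simp add: algebra_simps)
    then show ?case using eng subgroup.m_closed[OF lower_central_subgroup, of g "Suc (Suc k)" h] by blast
  qed
  then show ?case by blast
qed

lemma D_nth_zero: "k \<ge> 1 \<Longrightarrow> x \<in> \<gamma> (Suc k) \<Longrightarrow> m < k \<Longrightarrow> D x $ m = 0"
  using D_lower_central[of k x] by (auto simp: fps_X_power_mult_nth)

text \<open>On leading coefficients the operator \<open>cm g\<close> becomes multiplication by a
  scalar, so monomials of operators are evaluated by products.\<close>

lemma D_cm_nth_Suc: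
  assumes "g \<in> carrier G" "x \<in> \<gamma> (Suc k)" "k \<ge> 1"
  shows "D (cm g x) $ Suc k = \<delta> g * D x $ k"
proof -
  obtain d where d: "D x = fps_X ^ k * d" using D_lower_central assms by blast
  then obtain d' where "D (cm g x) = fps_X ^ Suc k * d'" "d' $ 0 = \<delta> g * d $ 0"
    using D_cm_lower_central[OF assms d] by blast
  then show ?thesis using d by (simp add: fps_X_power_mult_nth del: power_Suc)
qed

lemma t_nth_1_add:
  "g \<in> carrier G \<Longrightarrow> h \<in> carrier G \<Longrightarrow> t (g \<otimes> h) $ 1 = t g $ 1 + t h $ 1"
  by (simp add: utD_mult fps_mult_nth_1)

end

section \<open>Dual numbers\<close>

text \<open>Two layers give the ring with the nilpotents \<open>\<nu>\<^sub>1\<close> (inner layer)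
  and \<open>\<nu>\<^sub>2\<close> (outer layer); there \<open>du (du x)\<close> reads off the
  coefficient of \<open>\<nu>\<^sub>1 * \<nu>\<^sub>2\<close>.\<close>

datatype 'a dual = Dual (re: 'a) (du: 'a)

instantiation dual :: (comm_ring_1) comm_ring_1
begin

definition "0 = Dual 0 0"
definition "1 = Dual 1 0"
definition "x + y = Dual (re x + re y) (du x + du y)"
definition "x - y = Dual (re x - re y) (du x - du y)"
definition "- x = Dual (- re x) (- du x)"
definition "x * y = Dual (re x * re y) (re x * du y + du x * re y)"

instance
  by standard
    (auto simp: zero_dual_def one_dual_def plus_dual_def minus_dual_def uminus_dual_def
      times_dual_def algebra_simps dual.expand)

end

lemma dual_simps [simp]:
  "re 0 = 0" "du 0 = 0" "re 1 = 1" "du 1 = 0"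
  "re (x + y) = re x + re y" "du (x + y) = du x + du y"
  "re (x - y) = re x - re y" "du (x - y) = du x - du y"
  "re (- x) = - re x" "du (- x) = - du x"
  "re (x * y) = re x * re y" "du (x * y) = re x * du y + du x * re y"
  by (simp_all add: zero_dual_def one_dual_def plus_dual_def minus_dual_def uminus_dual_def
      times_dual_def)

lemma dual_numeral [simp]: "re (numeral k) = numeral k" "du (numeral k) = 0"
  by (induction k) (simp_all only: numeral.simps dual_simps add_0_right)

definition \<nu>\<^sub>1 :: "rat dual dual" where "\<nu>\<^sub>1 = Dual (Dual 0 1) 0"
definition \<nu>\<^sub>2 :: "rat dual dual" where "\<nu>\<^sub>2 = Dual 0 1"

lemma \<nu>_square [simp]: "\<nu>\<^sub>1 * \<nu>\<^sub>1 = 0" "\<nu>\<^sub>2 * \<nu>\<^sub>2 = 0" "\<nu>\<^sub>1 * (\<nu>\<^sub>1 * x) = 0" "\<nu>\<^sub>2 * (\<nu>\<^sub>2 * x) = 0"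
  by (auto simp: \<nu>\<^sub>1_def \<nu>\<^sub>2_def intro!: dual.expand)


section \<open>Two families of triangular representations\<close>

text \<open>Magnus matrices restricted to vectors supported on \<open>l\<close> and
  \<open>i\<close>, with parameters \<open>s i = - 1\<close>, \<open>s j = 1 + w j X\<close> for
  \<open>j \<le> l\<close>, and 1 otherwise. The entry 2 is \<open>1 - s i\<close>.\<close>

definition lin_rep :: "nat \<Rightarrow> nat \<Rightarrow> (nat \<Rightarrow> rat) \<Rightarrow> nat \<Rightarrow> nat \<Rightarrow> rat fps \<times> rat fps \<times> rat fps"
  where "lin_rep i l w p q =
    (if p = l then 1 + fps_const (w q) * fps_X else 1,
     if p = i \<and> q \<le> l then 1 + fps_const (w q) * fps_X else 1,
     if p = i \<and> q = l then 2 else 0)"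

text \<open>This comes from the parameters \<open>s i = - 1\<close>, \<open>s l = 1 + X\<close>,
  \<open>s c = 1 + \<nu>\<^sub>1 X\<close>, and 1 otherwise. They give \<open>e i b c\<close> the
  value \<open>2 * \<nu>\<^sub>1 * \<nu>\<^sub>2\<close>, which is killed by
  \<open>\<delta> (a i q)\<close> for every \<open>q \<noteq> l\<close> but survives
  \<open>\<delta> (a i l) = - 1\<close>.\<close>

definition nil_rep :: "nat \<Rightarrow> nat \<Rightarrow> nat \<Rightarrow> nat \<Rightarrow> nat \<Rightarrow> nat \<Rightarrow>
    rat dual dual fps \<times> rat dual dual fps \<times> rat dual dual fps"
  where "nil_rep i l c b p q =
    (if q = b \<and> p = l then 1 + fps_const \<nu>\<^sub>2 * fps_X
     else if q = b \<and> p = c then 1 - fps_const \<nu>\<^sub>2 * fps_X else 1,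
     if p = i \<and> q = l then 1 + fps_X
     else if p = i \<and> q = c then 1 + fps_const \<nu>\<^sub>1 * fps_X else 1,
     if p = i \<and> q = b then fps_const (2 * \<nu>\<^sub>2) else if p = i \<and> q = c then fps_const (2 * \<nu>\<^sub>1)
     else if p = l \<and> q = b then - fps_const (2 * \<nu>\<^sub>2) else if p = l \<and> q = c then - fps_const (2 * \<nu>\<^sub>1)
     else 0)"

locale mccool_functionals = mccool_quotient +
  assumes lin_rep_hom: "\<And>i l w. 1 \<le> l \<Longrightarrow> l < i \<Longrightarrow> i \<le> n \<Longrightarrow>
      \<exists>\<Psi>\<in>hom G tri. \<forall>p q. 1 \<le> q \<and> q < p \<and> p \<le> n \<longrightarrow> \<Psi> (a p q) = lin_rep i l w p q"
    and nil_rep_hom: "\<And>i l c b. 1 \<le> b \<Longrightarrow> b < c \<Longrightarrow> c < l \<Longrightarrow> l < i \<Longrightarrow> i \<le> n \<Longrightarrow>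
      \<exists>\<Psi>\<in>hom G tri. \<forall>p q. 1 \<le> q \<and> q < p \<and> p \<le> n \<longrightarrow> \<Psi> (a p q) = nil_rep i l c b p q"
begin

section \<open>Values of the functionals on the spanning set\<close>

lemma D_X:
  fixes \<Psi> :: "'a \<Rightarrow> 'k::comm_ring_1 fps \<times> 'k fps \<times> 'k fps"
  assumes "tri_rep G \<Psi>" and o: "ok i b" "ok i l" and L: "set L \<subseteq> {1..<i}"
  shows "tri_rep.D \<Psi> (X i L b l) $ Suc (length L) =
    (\<Prod>q\<leftarrow>L. tri_rep.\<delta> \<Psi> (a i q)) *
    (tri_rep.\<delta> \<Psi> (a i b) * tri_rep.D \<Psi> (a i l) $ 0 - tri_rep.\<delta> \<Psi> (a i l) * tri_rep.D \<Psi> (a i b) $ 0)"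
proof -
  interpret tri_rep G \<Psi> by (rule assms)
  show ?thesis
    using L
  proof (induction L)
    case Nil
    then show ?case using D_cm_nth(1)[of "a i b" "a i l"] o by (simp add: X_def e_def)
  next
    case (Cons q L)
    then have "X i L b l \<in> \<gamma> (Suc (Suc (length L)))" "ok i q"
      using X_mem[of L i b l] o by (auto simp: ok_def)
    then show ?case
      using Cons D_cm_nth_Suc[of "a i q" "X i L b l" "Suc (length L)"] by (simp add: X_def mult.assoc)
  qed
qed

lemma relation_of_rep:
  fixes \<Psi> :: "'a \<Rightarrow> 'k::comm_ring_1 fps \<times> 'k fps \<times> 'k fps" and f :: "'k \<Rightarrow> rat"
  assumes \<Psi>: "tri_rep G \<Psi>" and f: "\<And>x y. f (x + y) = f x + f y"
    and c: "\<And>\<phi>::'a \<Rightarrow> rat. (\<And>x z. x \<in> \<gamma> (r + 2) \<Longrightarrow> z \<in> \<gamma> (r + 2) \<Longrightarrow> \<phi> (x \<otimes> z) = \<phi> x + \<phi> z) \<Longrightarrow>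
        (\<And>x. x \<in> \<gamma> (Suc (r + 2)) \<Longrightarrow> \<phi> x = 0) \<Longrightarrow>
        (\<Sum>s\<in>basis_index r. of_int (c s) * \<phi> (basis r s)) = 0"
  shows "(\<Sum>s\<in>basis_index r. of_int (c s) * f (tri_rep.D \<Psi> (basis r s) $ Suc r)) = 0"
proof -
  interpret tri_rep G \<Psi> by (rule assms)
  have "f 0 = 0" using f[of 0 0] by simp
  then show ?thesis
    using D_add[of _ "Suc r"] D_nth_zero[of "Suc (Suc r)"]
    by (intro c) (auto simp: f)
qed

text \<open>Up to a sign fixed by the length, the value is a monomial in \<open>w\<close> determined
  by the multiset of \<open>b'\<close> and \<open>L\<close>. So a canonical and an extra element
  with the same multiset have the same value.\<close>

lemma canon_D_lin:
  assumes \<Psi>: "tri_rep G \<Psi>" "\<And>p q. ok p q \<Longrightarrow> \<Psi> (a p q) = lin_rep i l w p q"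
    and o: "ok i l" and o': "ok i' l'" "1 \<le> b'" "b' < l'" and L: "set L \<subseteq> {1..l'}"
  shows "tri_rep.D \<Psi> (X i' L b' l') $ Suc (length L) =
    (if i' = i \<and> l' = l then 2 * (-1) ^ Suc (length L) * (\<Prod>q\<leftarrow>L. w q) * w b' else 0)"
proof -
  interpret tri_rep G \<Psi> by (rule assms)
  have d: "\<delta> (a p q) = (if p = l then w q else if p = i \<and> q \<le> l then - w q else 0)"
    "D (a p q) $ 0 = (if p = i \<and> q = l then 2 else 0)" if "ok p q" for p q
    using \<Psi>(2)[OF that] o that
    by (auto simp: \<delta>_def u_def t_def D_def lin_rep_def ok_def)
  have ok': "ok i' b'" using o' by (auto simp: ok_def)
  have "set L \<subseteq> {1..<i'}" using L o' by (force simp: ok_def)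
  then have eq: "D (X i' L b' l') $ Suc (length L) = (\<Prod>q\<leftarrow>L. \<delta> (a i' q)) *
      (\<delta> (a i' b') * D (a i' l') $ 0 - \<delta> (a i' l') * D (a i' b') $ 0)"
    using D_X[OF \<Psi>(1) ok' o'(1)] by simp
  show ?thesis
  proof (cases "i' = i \<and> l' = l")
    case True
    have "(\<Prod>q\<leftarrow>L. \<delta> (a i' q)) = (-1) ^ length L * (\<Prod>q\<leftarrow>L. w q)"
      using L
    proof (induction L)
      case (Cons q L)
      then have "ok i' q" "q \<le> l" using o' True by (auto simp: ok_def)
      moreover have "i \<noteq> l" using o by (auto simp: ok_def)
      ultimately show ?case using Cons d True by simp
    qed simp
    then show ?thesis unfolding eq d[OF ok'] d[OF o'(1)] using True o' o by (auto simp: ok_def)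
  next
    case False
    then show ?thesis unfolding eq d[OF ok'] d[OF o'(1)] using o' o by (auto simp: ok_def)
  qed
qed

lemma bracket_nil:
  assumes \<Psi>: "tri_rep G \<Psi>" "\<And>p q. ok p q \<Longrightarrow> \<Psi> (a p q) = nil_rep i l c b p q"
    and o: "ok i l" "1 \<le> b" "b < c" "c < l" and o': "ok i' l'" "1 \<le> b'" "b' < l'"
  shows "\<And>p q. ok p q \<Longrightarrow> tri_rep.\<delta> \<Psi> (a p q) = (if q = b \<and> p = l then \<nu>\<^sub>2 else if q = b \<and> p = c then - \<nu>\<^sub>2
       else if p = i \<and> q = l then - 1 else if p = i \<and> q = c then - \<nu>\<^sub>1 else 0)"
    and "tri_rep.\<delta> \<Psi> (a i' b') * tri_rep.D \<Psi> (a i' l') $ 0 - tri_rep.\<delta> \<Psi> (a i' l') * tri_rep.D \<Psi> (a i' b') $ 0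
     = (if i' = i \<and> l' = l \<and> b' = b then 2 * \<nu>\<^sub>2 else if i' = i \<and> l' = l \<and> b' = c then 2 * \<nu>\<^sub>1
        else if i' = i \<and> l' = c \<and> b' = b then 2 * \<nu>\<^sub>1 * \<nu>\<^sub>2
        else if i' = l \<and> l' = c \<and> b' = b then - 2 * \<nu>\<^sub>1 * \<nu>\<^sub>2 else 0)"
proof -
  interpret tri_rep G \<Psi> by (rule assms)
  show d: "\<delta> (a p q) = (if q = b \<and> p = l then \<nu>\<^sub>2 else if q = b \<and> p = c then - \<nu>\<^sub>2
       else if p = i \<and> q = l then - 1 else if p = i \<and> q = c then - \<nu>\<^sub>1 else 0)" if "ok p q" for p q
    using \<Psi>(2)[OF that] o that by (auto simp: \<delta>_def u_def t_def nil_rep_def ok_def)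
  have D: "D (a p q) $ 0 = (if p = i \<and> q = b then 2 * \<nu>\<^sub>2 else if p = i \<and> q = c then 2 * \<nu>\<^sub>1
     else if p = l \<and> q = b then - 2 * \<nu>\<^sub>2 else if p = l \<and> q = c then - 2 * \<nu>\<^sub>1 else 0)" if "ok p q" for p q
    using \<Psi>(2)[OF that] by (auto simp: D_def nil_rep_def)
  have ok': "ok i' b'" using o' by (auto simp: ok_def)
  show "\<delta> (a i' b') * D (a i' l') $ 0 - \<delta> (a i' l') * D (a i' b') $ 0
     = (if i' = i \<and> l' = l \<and> b' = b then 2 * \<nu>\<^sub>2 else if i' = i \<and> l' = l \<and> b' = c then 2 * \<nu>\<^sub>1
        else if i' = i \<and> l' = c \<and> b' = b then 2 * \<nu>\<^sub>1 * \<nu>\<^sub>2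
        else if i' = l \<and> l' = c \<and> b' = b then - 2 * \<nu>\<^sub>1 * \<nu>\<^sub>2 else 0)"
  proof -
    have ne: "i \<noteq> l" "i \<noteq> c" "l \<noteq> c" "b \<noteq> c" "b \<noteq> l" "l \<noteq> i" "c \<noteq> i" "c \<noteq> l" "c \<noteq> b" "l \<noteq> b"
      using o by (auto simp: ok_def)
    note eqs = d[OF ok'] d[OF o'(1)] D[OF ok'] D[OF o'(1)]
    consider "i' = i" | "i' = l" | "i' = c" | "i' \<noteq> i" "i' \<noteq> l" "i' \<noteq> c" by blast
    then show ?thesis
    proof cases
      case 1
      have "l' = l \<Longrightarrow> b' \<noteq> l" "l' = c \<Longrightarrow> b' \<noteq> l \<and> b' \<noteq> c" "l' = b \<Longrightarrow> b' \<noteq> l \<and> b' \<noteq> c"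
        using o' o by auto
      then show ?thesis
        unfolding eqs by (cases "l' = l"; cases "l' = c"; cases "l' = b") (simp_all add: 1 ne mult.commute)
    next
      case 2
      have "l' = c \<Longrightarrow> b' \<noteq> c" "l' = b \<Longrightarrow> b' \<noteq> b \<and> b' \<noteq> c"
        using o' o by auto
      then show ?thesis
        unfolding eqs by (cases "l' = c"; cases "l' = b") (simp_all add: 2 ne mult.commute)
    next
      case 3
      then show ?thesis unfolding eqs by (simp add: ne)
    next
      case 4
      then show ?thesis unfolding eqs by simp
    qed
  qed
qed

text \<open>One factor of the product already kills \<open>y\<close>, whence the assumption that the
  list is nonempty.\<close>

lemma prod_nil:
  assumes "L \<noteq> []" "\<And>q. q \<in> set L \<Longrightarrow> f q = 0 \<or> f q = x \<or> f q = - x" "x * y = (0::'k::comm_ring_1)"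
  shows "(\<Prod>q\<leftarrow>L. f q) * y = 0"
proof -
  obtain q L' where L: "L = q # L'" using assms(1) by (cases L) auto
  have "f q * y = 0" using assms(2)[of q] assms(3) L by auto
  moreover have "(\<Prod>q\<leftarrow>L. f q) * y = (f q * y) * (\<Prod>q\<leftarrow>L'. f q)" by (simp add: L mult_ac)
  ultimately show ?thesis by simp
qed

text \<open>Up to sign the product is a power of \<open>\<nu>\<^sub>1\<close> whose exponent counts
  the entries \<open>c\<close>, or zero if an entry other than \<open>c\<close> and \<open>l\<close>
  occurs. As \<open>\<nu>\<^sub>1\<close> squares to zero, at most one \<open>c\<close>
  survives.\<close>

lemma prod_nil_du:
  fixes f :: "nat \<Rightarrow> rat dual dual"
  assumes "\<And>q. q \<in> set L \<Longrightarrow> f q = (if q = l then - 1 else if q = c then - \<nu>\<^sub>1 else 0)" "c \<noteq> l"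
  shows "du (\<Prod>q\<leftarrow>L. f q) = 0"
    "du (re (\<Prod>q\<leftarrow>L. f q)) =
      (if mset L = add_mset c (replicate_mset (length L - 1) l) \<and> L \<noteq> [] then (-1) ^ length L else 0)"
    "re (re (\<Prod>q\<leftarrow>L. f q)) = (if mset L = replicate_mset (length L) l then (-1) ^ length L else 0)"
proof -
  have *: "du (\<Prod>q\<leftarrow>L. f q) = 0 \<and> du (re (\<Prod>q\<leftarrow>L. f q)) =
      (if mset L = add_mset c (replicate_mset (length L - 1) l) \<and> L \<noteq> [] then (-1) ^ length L else 0) \<and>
    re (re (\<Prod>q\<leftarrow>L. f q)) = (if mset L = replicate_mset (length L) l then (-1) ^ length L else 0)"
    using assms(1)
  proof (induction L)
    case (Cons q L)
    consider "q = l" | "q = c" "q \<noteq> l" | "q \<noteq> l" "q \<noteq> c" by blast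
    then show ?case
    proof cases
      case 1
      have "add_mset l (mset L) = add_mset c (replicate_mset (length L) l) \<longleftrightarrow>
          mset L = add_mset c (replicate_mset (length L - 1) l) \<and> L \<noteq> []"
        using assms(2) by (cases L) (auto simp: add_eq_conv_ex dest: arg_cong[of _ _ size])
      then show ?thesis using Cons 1 by simp
    next
      case 2
      have "add_mset c (mset L) \<noteq> add_mset l (replicate_mset (length L) l)"
        using assms(2) by (metis in_replicate_mset replicate_mset_Suc union_single_eq_member)
      then show ?thesis using Cons 2 by (simp add: \<nu>\<^sub>1_def)
    next
      case 3
      have "q \<notin># add_mset l (replicate_mset (length L) l)" "q \<notin># add_mset c (replicate_mset (length L) l)"
        using 3 by auto
      then have "add_mset q (mset L) \<noteq> add_mset l (replicate_mset (length L) l)"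
        "add_mset q (mset L) \<noteq> add_mset c (replicate_mset (length L) l)"
        by (metis union_single_eq_member)+
      then show ?thesis using Cons 3 by simp
    qed
  qed simp
  then show "du (\<Prod>q\<leftarrow>L. f q) = 0"
    "du (re (\<Prod>q\<leftarrow>L. f q)) =
      (if mset L = add_mset c (replicate_mset (length L - 1) l) \<and> L \<noteq> [] then (-1) ^ length L else 0)"
    "re (re (\<Prod>q\<leftarrow>L. f q)) = (if mset L = replicate_mset (length L) l then (-1) ^ length L else 0)"
    by blast+
qed

text \<open>The coefficient of \<open>\<nu>\<^sub>1 * \<nu>\<^sub>2\<close> singles out one
  canonical element: \<open>e i b l\<close> supplies \<open>\<nu>\<^sub>2\<close>, and the monomial
  must supply \<open>\<nu>\<^sub>1\<close> by one \<open>c\<close> and otherwise \<open>l\<close>.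
  Brackets that carry the whole product are killed by any factor of the monomial, which exists
  because \<open>r > 0\<close>.\<close>

lemma canon_D_nil:
  assumes \<Psi>: "tri_rep G \<Psi>" "\<And>p q. ok p q \<Longrightarrow> \<Psi> (a p q) = nil_rep i l c b p q"
    and o: "ok i l" "1 \<le> b" "b < c" "c < l" and I: "(i', l', N) \<in> canon_index r" "r > 0"
  shows "du (du (tri_rep.D \<Psi> (canon i' l' N) $ Suc r)) =
    (if i' = i \<and> l' = l \<and> N = {#b, c#} + replicate_mset (r - 1) l then 2 * (-1) ^ r else 0)"
proof -
  interpret tri_rep G \<Psi> by (rule assms)
  define b' where "b' = Min (set_mset N)"
  define L where "L = sorted_list_of_multiset (N - {#b'#})"
  note J = canon_indexD[OF I(1), folded b'_def, folded L_def]
  have Li: "set L \<subseteq> {1..<i'}" using J(1,8) by (force simp: ok_def)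
  have L0: "L \<noteq> []" using J(9) I(2) by auto
  have N: "N = add_mset b' (mset L)" using J(7) by (simp add: L_def)
  have b'min: "b' \<le> q" if "q \<in> set L" for q
  proof -
    have "q \<in># N" using that by (subst N) simp
    then show ?thesis unfolding b'_def by (intro Min_le) auto
  qed
  note d = bracket_nil(1)[OF \<Psi> o J(1,2,3)]
  have eq: "D (canon i' l' N) $ Suc r = (\<Prod>q\<leftarrow>L. \<delta> (a i' q)) *
      (if i' = i \<and> l' = l \<and> b' = b then 2 * \<nu>\<^sub>2 else if i' = i \<and> l' = l \<and> b' = c then 2 * \<nu>\<^sub>1
        else if i' = i \<and> l' = c \<and> b' = b then 2 * \<nu>\<^sub>1 * \<nu>\<^sub>2
        else if i' = l \<and> l' = c \<and> b' = b then - 2 * \<nu>\<^sub>1 * \<nu>\<^sub>2 else 0)"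
    using D_X[OF \<Psi>(1) J(4,1) Li] bracket_nil(2)[OF \<Psi> o J(1,2,3)]
    by (simp add: canon_def b'_def[symmetric] L_def[symmetric] J(9))
  have di: "\<delta> (a i q) = (if q = l then - 1 else if q = c then - \<nu>\<^sub>1 else 0)" if "i' = i" "q \<in> set L" for q
  proof -
    have "ok i q" using that Li J(1) by (auto simp: ok_def)
    then show ?thesis using d o by (auto simp: ok_def)
  qed
  consider "i' = i" "l' = l" "b' = b" | "i' = i" "l' = l" "b' = c" | "i' = i" "l' = c" "b' = b"
    | "i' = l" "l' = c" "b' = b"
    | "\<not> (i' = i \<and> l' = l \<and> b' = b)" "\<not> (i' = i \<and> l' = l \<and> b' = c)" "\<not> (i' = i \<and> l' = c \<and> b' = b)"
      "\<not> (i' = l \<and> l' = c \<and> b' = b)" by blast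
  then show ?thesis
  proof cases
    case 1
    have "N = {#b, c#} + replicate_mset (r - 1) l \<longleftrightarrow> mset L = add_mset c (replicate_mset (length L - 1) l)"
      using 1 N J(9) by simp
    then show ?thesis
      unfolding eq using 1 prod_nil_du[of L "\<lambda>q. \<delta> (a i q)" l c] di o L0 J(9) by (simp add: \<nu>\<^sub>2_def)
  next
    \<comment> \<open>As \<open>b'\<close> is the least element, \<open>b' = c\<close> keeps
      \<open>b\<close> out of \<open>N\<close>; the value is a multiple of
      \<open>\<nu>\<^sub>1\<close> without a \<open>\<nu>\<^sub>2\<close> part.\<close>
    case 2
    then have "b \<notin># N" using N b'min[of b] o by auto
    then have "N \<noteq> {#b, c#} + replicate_mset (r - 1) l" by auto
    then show ?thesis
      unfolding eq using 2 prod_nil_du[of L "\<lambda>q. \<delta> (a i q)" l c] di o by (simp add: \<nu>\<^sub>1_def)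
  next
    case 3
    have "\<delta> (a i q) = 0 \<or> \<delta> (a i q) = \<nu>\<^sub>1 \<or> \<delta> (a i q) = - \<nu>\<^sub>1" if "q \<in> set L" for q
      using di[OF 3(1) that] J(8) that 3 o by auto
    then have "(\<Prod>q\<leftarrow>L. \<delta> (a i q)) * (2 * \<nu>\<^sub>1 * \<nu>\<^sub>2) = 0"
      by (intro prod_nil[OF L0]) (auto simp: mult_ac)
    then show ?thesis unfolding eq using 3 o by auto
  next
    case 4
    have "\<delta> (a l q) = 0 \<or> \<delta> (a l q) = \<nu>\<^sub>2 \<or> \<delta> (a l q) = - \<nu>\<^sub>2" if "q \<in> set L" for q
    proof -
      have "ok l q" using that 4 Li J(1) by (auto simp: ok_def)
      then show ?thesis using d o by (auto simp: ok_def)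
    qed
    then have "(\<Prod>q\<leftarrow>L. \<delta> (a l q)) * (- 2 * \<nu>\<^sub>1 * \<nu>\<^sub>2) = 0"
      by (intro prod_nil[OF L0]) (auto simp: mult_ac)
    then show ?thesis unfolding eq using 4 o by (auto simp: ok_def)
  next
    case 5
    have "b' = b" if "N = {#b, c#} + replicate_mset (r - 1) l"
    proof -
      have "Min (set_mset N) = b" unfolding that using o by (intro Min_eqI) (auto split: if_splits)
      then show ?thesis by (simp add: b'_def)
    qed
    then show ?thesis unfolding eq using 5 by auto
  qed
qed

text \<open>The larger element \<open>c'\<close> sits in the bracket. Wherever the bracket has a
  nonzero value, the variable \<open>a i' b'\<close> with \<open>b' < c'\<close> has
  \<open>\<delta> = 0\<close>. This asymmetry with \<open>canon\<close> is what separates the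
  two.\<close>

lemma extra_D_nil:
  assumes \<Psi>: "tri_rep G \<Psi>" "\<And>p q. ok p q \<Longrightarrow> \<Psi> (a p q) = nil_rep i l c b p q"
    and o: "ok i l" "1 \<le> b" "b < c" "c < l" and I: "(i', l', c', b') \<in> extra_index r"
  shows "tri_rep.D \<Psi> (extra r i' l' c' b') $ Suc r = 0"
proof -
  interpret tri_rep G \<Psi> by (rule assms)
  have J: "ok i' l'" "1 \<le> c'" "c' < l'" "1 \<le> b'" "b' < c'" "r > 0" "ok i' c'" "ok i' b'"
    using I by (auto simp: extra_index_def ok_def split: if_splits)
  let ?L = "b' # replicate (r - 1) l'"
  have Li: "set ?L \<subseteq> {1..<i'}" using J by (auto simp: ok_def)
  have "\<delta> (a i' b') = 0"
    if "i' = i \<and> (l' = l \<or> l' = c) \<and> (c' = b \<or> c' = c) \<or> i' = l \<and> c' = b"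
    using bracket_nil(1)[OF \<Psi> o J(1,2,3,8)] that J o by (auto simp: ok_def)
  then show ?thesis
    using D_X[OF \<Psi>(1) J(7,1) Li] bracket_nil(2)[OF \<Psi> o J(1,2,3)] J(6)
    by (auto simp: extra_def)
qed

section \<open>Linear independence of the spanning set, and the ranks in terms of its size\<close>

definition pair_mset :: "nat \<Rightarrow> nat \<Rightarrow> nat \<Rightarrow> nat \<Rightarrow> nat multiset"
  where "pair_mset r l c b = {#b, c#} + replicate_mset (r - 1) l"

lemma finite_index: "finite (canon_index r)" "finite (extra_index r)"
  by (auto simp: canon_index_def extra_index_def intro!: finite_SigmaI finite_Diff)

lemma extra_indexD:
  assumes "(i, l, c, b) \<in> extra_index r"
  shows "ok i l" "1 \<le> b" "b < c" "c < l" "r > 0" "(i, l, pair_mset r l c b) \<in> canon_index r"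
proof -
  show I: "ok i l" "1 \<le> b" "b < c" "c < l" "r > 0"
    using assms by (auto simp: extra_index_def ok_def split: if_splits)
  have "b \<in># pair_mset r l c b" by (simp add: pair_mset_def)
  then have "pair_mset r l c b \<noteq> replicate_mset (Suc r) l" using I by (metis in_replicate_mset less_trans nat_neq_iff)
  then show "(i, l, pair_mset r l c b) \<in> canon_index r"
    using I by (auto simp: canon_index_def multisets_of_size_def pair_mset_def ok_def split: if_splits)
qed

lemma pair_mset_inj:
  assumes "b < c" "c < l" "b' < c'" "c' < l" "pair_mset r l c b = pair_mset r l c' b'"
  shows "c = c' \<and> b = b'"
proof -
  have "{#b, c#} = {#b', c'#}" using assms(5) unfolding pair_mset_def by (rule add_right_imp_eq)
  from arg_cong[OF this, of set_mset] have "{b, c} = {b', c'}" by simp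
  then show ?thesis using assms by (auto simp: doubleton_eq_iff)
qed

lemma sum_slice:
  assumes "finite T" "\<And>i' l' x. (i', l', x) \<in> T \<Longrightarrow> \<not> (i' = i \<and> l' = l) \<Longrightarrow> h (i', l', x) = 0"
  shows "sum h T = (\<Sum>x | (i, l, x) \<in> T. h (i, l, x))"
proof -
  have "sum h T = sum h ((\<lambda>x. (i, l, x)) ` {x. (i, l, x) \<in> T})"
    using assms by (intro sum.mono_neutral_right) auto
  also have "\<dots> = (\<Sum>x | (i, l, x) \<in> T. h (i, l, x))"
    by (subst sum.reindex) (auto simp: inj_on_def)
  finally show ?thesis .
qed

lemma basis_independent:
  assumes c: "\<And>\<phi>::'a \<Rightarrow> rat. (\<And>x z. x \<in> \<gamma> (r + 2) \<Longrightarrow> z \<in> \<gamma> (r + 2) \<Longrightarrow> \<phi> (x \<otimes> z) = \<phi> x + \<phi> z) \<Longrightarrow>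
        (\<And>x. x \<in> \<gamma> (Suc (r + 2)) \<Longrightarrow> \<phi> x = 0) \<Longrightarrow>
        (\<Sum>s\<in>basis_index r. of_int (c s) * \<phi> (basis r s)) = 0"
  shows "\<forall>s\<in>basis_index r. c s = 0"
proof -
  define C where "C x = c (Inl x)" for x
  define E where "E x = c (Inr x)" for x
  have split: "(\<Sum>s\<in>basis_index r. of_int (c s) * f (basis r s)) =
      (\<Sum>(i, l, N)\<in>canon_index r. of_int (C (i, l, N)) * f (canon i l N)) +
      (\<Sum>(i, l, c, b)\<in>extra_index r. of_int (E (i, l, c, b)) * f (extra r i l c b))" for f :: "'a \<Rightarrow> rat"
    unfolding basis_index_def by (subst sum.Plus) (auto simp: finite_index C_def E_def basis_def case_prod_unfold)
  \<comment> \<open>The nilpotent family isolates the coefficient of the canonical element that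
    shares its multiset with an extra one.\<close>
  have C_pair: "C (i, l, pair_mset r l c b) = 0" if I: "(i, l, c, b) \<in> extra_index r" for i l c b
  proof -
    note J = extra_indexD[OF I]
    obtain \<Psi> where \<Psi>: "\<Psi> \<in> hom G tri" "\<And>p q. ok p q \<Longrightarrow> \<Psi> (a p q) = nil_rep i l c b p q"
      using nil_rep_hom[of b c l i] J by (auto simp: ok_def)
    have rep: "tri_rep G \<Psi>" using \<Psi>(1) by unfold_locales
    let ?f = "\<lambda>x. du (du (tri_rep.D \<Psi> x $ Suc r))"
    have "(\<Sum>(i', l', N)\<in>canon_index r. of_int (C (i', l', N)) * ?f (canon i' l' N)) +
      (\<Sum>(i', l', c', b')\<in>extra_index r. of_int (E (i', l', c', b')) * ?f (extra r i' l' c' b')) = 0"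
      using relation_of_rep[OF rep, of "\<lambda>x. du (du x)", OF _ assms(1)] split[of ?f] by simp
    moreover have "(\<Sum>(i', l', c', b')\<in>extra_index r.
        of_int (E (i', l', c', b')) * ?f (extra r i' l' c' b')) = 0"
      by (intro sum.neutral) (auto simp: extra_D_nil[OF rep \<Psi>(2) J(1-4)])
    moreover have "?f (canon i' l' N) = (if i' = i \<and> l' = l \<and> N = pair_mset r l c b then 2 * (-1) ^ r else 0)"
      if "(i', l', N) \<in> canon_index r" for i' l' N
      using canon_D_nil[OF rep \<Psi>(2) J(1-4) that J(5)] by (simp only: pair_mset_def)
    then have "(\<Sum>(i', l', N)\<in>canon_index r. of_int (C (i', l', N)) * ?f (canon i' l' N)) =
        (\<Sum>x\<in>canon_index r. if x = (i, l, pair_mset r l c b) then of_int (C x) * (2 * (-1) ^ r) else 0)"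
      by (intro sum.cong) (auto split: if_splits)
    ultimately show ?thesis using J(6) finite_index by simp
  qed
  \<comment> \<open>The linear family sees both elements in the same monomial and yields only the
    sum of their coefficients.\<close>
  have lin: "of_int (C (i, l, N)) + (\<Sum>(c, b) | (i, l, c, b) \<in> extra_index r.
      if N = pair_mset r l c b then of_int (E (i, l, c, b)) else 0 :: rat) = 0"
    if I: "(i, l, N) \<in> canon_index r" for i l N
  proof -
    have o: "ok i l" using canon_indexD[OF I] by simp
    let ?\<M> = "{N. (i, l, N) \<in> canon_index r}" and ?P = "{(c, b). (i, l, c, b) \<in> extra_index r}"
    have fin: "finite ?\<M>" "finite ?P"
    proof -
      have "?\<M> \<subseteq> (\<lambda>t. snd (snd t)) ` canon_index r" "?P \<subseteq> (\<lambda>t. snd (snd t)) ` extra_index r"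
        by force+
      then show "finite ?\<M>" "finite ?P"
        using finite_subset[OF _ finite_imageI] finite_index by blast+
    qed
    let ?W = "\<lambda>(w :: nat \<Rightarrow> rat) N. \<Prod>j\<in>#N. w j"
    let ?\<kappa> = "2 * (-1) ^ Suc r :: rat"
    have "(\<Sum>N\<in>?\<M>. (of_int (C (i, l, N)) + (\<Sum>(c, b)\<in>?P.
        if N = pair_mset r l c b then of_int (E (i, l, c, b)) else 0)) * ?W w N) = 0" for w
    proof -
      obtain \<Psi> where \<Psi>: "\<Psi> \<in> hom G tri" "\<And>p q. ok p q \<Longrightarrow> \<Psi> (a p q) = lin_rep i l w p q"
        using lin_rep_hom[of l i w] o by (auto simp: ok_def)
      have rep: "tri_rep G \<Psi>" using \<Psi>(1) by unfold_locales
      let ?f = "\<lambda>x. tri_rep.D \<Psi> x $ Suc r"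
      have W_mset: "?W w (add_mset x (mset K)) = (\<Prod>q\<leftarrow>K. w q) * w x" for x K
        by (induction K) (simp_all add: mult_ac)
      have canon: "?f (canon i' l' N') = (if i' = i \<and> l' = l then ?\<kappa> * ?W w N' else 0)"
        if I': "(i', l', N') \<in> canon_index r" for i' l' N'
      proof -
        note J = canon_indexD[OF I']
        let ?L = "sorted_list_of_multiset (N' - {#Min (set_mset N')#})"
        have "N' = add_mset (Min (set_mset N')) (mset ?L)" using J(7) by simp
        from arg_cong[OF this, of "?W w"] have "?W w N' = (\<Prod>q\<leftarrow>?L. w q) * w (Min (set_mset N'))"
          by (rule trans) (rule W_mset)
        then show ?thesis
          using canon_D_lin[OF rep \<Psi>(2) o J(1,2,3,8)] by (simp add: canon_def J(9))
      qed
      have extra: "?f (extra r i' l' c b) = (if i' = i \<and> l' = l then ?\<kappa> * ?W w (pair_mset r l c b) else 0)"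
        if I': "(i', l', c, b) \<in> extra_index r" for i' l' c b
      proof -
        note J = extra_indexD[OF I']
        have s: "set (b # replicate (r - 1) l') \<subseteq> {1..l'}" "1 \<le> c" using J by auto
        have "?W w (pair_mset r l' c b) = (\<Prod>q\<leftarrow>b # replicate (r - 1) l'. w q) * w c"
          by (simp add: pair_mset_def prod_list_replicate mult_ac)
        then show ?thesis
          using canon_D_lin[OF rep \<Psi>(2) o J(1) s(2) J(4) s(1)] J(5)
          by (cases "l' = l") (auto simp: extra_def mult_ac)
      qed
      have "0 = (\<Sum>(i', l', N')\<in>canon_index r. of_int (C (i', l', N')) * ?f (canon i' l' N')) +
        (\<Sum>(i', l', c, b)\<in>extra_index r. of_int (E (i', l', c, b)) * ?f (extra r i' l' c b))"
        using relation_of_rep[OF rep, of "\<lambda>x. x", OF _ assms(1)] split[of ?f] by simp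
      also have "(\<Sum>(i', l', N')\<in>canon_index r. of_int (C (i', l', N')) * ?f (canon i' l' N')) =
          (\<Sum>N\<in>?\<M>. of_int (C (i, l, N)) * (?\<kappa> * ?W w N))"
        by (subst sum_slice[where i = i and l = l, OF finite_index(1)])
          (auto simp: canon intro!: sum.cong)
      also have "(\<Sum>(i', l', c, b)\<in>extra_index r. of_int (E (i', l', c, b)) * ?f (extra r i' l' c b)) =
          (\<Sum>(c, b)\<in>?P. of_int (E (i, l, c, b)) * (?\<kappa> * ?W w (pair_mset r l c b)))"
        by (subst sum_slice[where i = i and l = l, OF finite_index(2)])
          (auto simp: extra case_prod_unfold intro!: sum.cong)
      also have "\<dots> = (\<Sum>(c, b)\<in>?P. \<Sum>N\<in>?\<M>.
          if N = pair_mset r l c b then of_int (E (i, l, c, b)) * (?\<kappa> * ?W w N) else 0)"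
        using fin extra_indexD(6) by (intro sum.cong) (auto simp: sum.delta)
      also have "\<dots> = (\<Sum>N\<in>?\<M>. \<Sum>(c, b)\<in>?P.
          if N = pair_mset r l c b then of_int (E (i, l, c, b)) * (?\<kappa> * ?W w N) else 0)"
        unfolding case_prod_unfold by (rule sum.swap)
      also have "(\<Sum>N\<in>?\<M>. of_int (C (i, l, N)) * (?\<kappa> * ?W w N)) + \<dots> = ?\<kappa> *
          (\<Sum>N\<in>?\<M>. (of_int (C (i, l, N)) + (\<Sum>(c, b)\<in>?P.
            if N = pair_mset r l c b then of_int (E (i, l, c, b)) else 0)) * ?W w N)"
        unfolding sum.distrib[symmetric] sum_distrib_left
        by (intro sum.cong refl)
          (simp add: distrib_right distrib_left sum_distrib_right sum_distrib_left case_prod_unfold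
            if_distrib[of "\<lambda>x. x * _"] if_distrib[of "\<lambda>x. _ * x"] mult_ac cong: if_cong)
      finally show ?thesis by simp
    qed
    from monomials_independent[OF fin(1) this, of N] I show ?thesis by simp
  qed
  \<comment> \<open>For fixed \<open>i\<close> and \<open>l\<close> a pair multiset comes from a
    single pair, so the sum has one term; the canonical coefficient beside it is zero by
    \<open>C_pair\<close>.\<close>
  have E: "E (i, l, c, b) = 0" if I: "(i, l, c, b) \<in> extra_index r" for i l c b
  proof -
    note J = extra_indexD[OF I]
    have fin: "finite {(c, b). (i, l, c, b) \<in> extra_index r}"
    proof (rule finite_subset)
      show "{(c, b). (i, l, c, b) \<in> extra_index r} \<subseteq> (\<lambda>(i, l, c, b). (c, b)) ` extra_index r"
        by force
    qed (simp add: finite_index)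
    have inj: "pair_mset r l c b = pair_mset r l c' b' \<longleftrightarrow> c' = c \<and> b' = b"
      if "(i, l, c', b') \<in> extra_index r" for c' b'
      using pair_mset_inj[OF J(3,4) extra_indexD(3,4)[OF that], of r] by auto
    have "(\<Sum>(c', b') | (i, l, c', b') \<in> extra_index r.
        if pair_mset r l c b = pair_mset r l c' b' then of_int (E (i, l, c', b')) else 0 :: rat) =
      (\<Sum>x\<in>{(c, b). (i, l, c, b) \<in> extra_index r}. if x = (c, b) then of_int (E (i, l, c, b)) else 0)"
      by (intro sum.cong) (auto simp: inj split: if_splits)
    also have "\<dots> = of_int (E (i, l, c, b))" using I by (subst sum.delta[OF fin]) simp
    finally show ?thesis using lin[OF J(6)] C_pair[OF I] by simp
  qed
  have "C (i, l, N) = 0" if I: "(i, l, N) \<in> canon_index r" for i l N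
  proof -
    have "(\<Sum>(c, b) | (i, l, c, b) \<in> extra_index r.
        if N = pair_mset r l c b then of_int (E (i, l, c, b)) else 0 :: rat) = 0"
      using E by (intro sum.neutral) auto
    then show ?thesis using lin[OF I] by simp
  qed
  then show ?thesis using E by (auto simp: basis_index_def C_def E_def)
qed

theorem ab_rank_gr: "ab_rank (gr G (r + 2)) = enat (card (basis_index r))"
proof (rule ab_rank_gr_eq_card)
  show "finite (basis_index r)" by (simp add: basis_index_def finite_index)
  show "\<gamma> (r + 2) \<subseteq> generate G (basis r ` basis_index r \<union> \<gamma> (Suc (r + 2)))"
    using lower_central_spanned[of r] by (simp add: eval_nat_numeral)
  fix c :: "nat \<times> nat \<times> nat multiset + nat \<times> nat \<times> nat \<times> nat \<Rightarrow> int"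
  assume "\<And>\<phi>::'a \<Rightarrow> rat. (\<And>x z. x \<in> \<gamma> (r + 2) \<Longrightarrow> z \<in> \<gamma> (r + 2) \<Longrightarrow> \<phi> (x \<otimes> z) = \<phi> x + \<phi> z) \<Longrightarrow>
        (\<And>x. x \<in> \<gamma> (Suc (r + 2)) \<Longrightarrow> \<phi> x = 0) \<Longrightarrow>
        (\<Sum>s\<in>basis_index r. of_int (c s) * \<phi> (basis r s)) = 0"
  then show "\<forall>s\<in>basis_index r. c s = 0" by (rule basis_independent)
qed (use basis_mem in auto)

definition gen_index :: "(nat \<times> nat) set"
  where "gen_index = (SIGMA i:{1..n}. {1..<i})"

theorem ab_rank_gr_1: "ab_rank (gr G 1) = enat (card gen_index)"
proof (rule ab_rank_gr_eq_card[where y = "\<lambda>(i, j). a i j"])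
  have g: "(i, j) \<in> gen_index \<longleftrightarrow> ok i j" for i j by (auto simp: gen_index_def ok_def)
  show fin: "finite gen_index" by (auto simp: gen_index_def)
  show "(case s of (i, j) \<Rightarrow> a i j) \<in> \<gamma> 1" if "s \<in> gen_index" for s using that g by (cases s) auto
  have "{a i j | i j. 1 \<le> j \<and> j < i \<and> i \<le> n} \<subseteq> (\<lambda>(i, j). a i j) ` gen_index"
    using g by (force simp: ok_def)
  then have "generate G {a i j | i j. 1 \<le> j \<and> j < i \<and> i \<le> n}
      \<subseteq> generate G ((\<lambda>(i, j). a i j) ` gen_index \<union> \<gamma> (Suc 1))"
    by (intro mono_generate) auto
  then show "\<gamma> 1 \<subseteq> generate G ((\<lambda>(i, j). a i j) ` gen_index \<union> \<gamma> (Suc 1))" using a_gen by simp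
  fix c :: "nat \<times> nat \<Rightarrow> int"
  assume c: "\<And>\<phi>::'a \<Rightarrow> rat. (\<And>x z. x \<in> \<gamma> 1 \<Longrightarrow> z \<in> \<gamma> 1 \<Longrightarrow> \<phi> (x \<otimes> z) = \<phi> x + \<phi> z) \<Longrightarrow>
        (\<And>x. x \<in> \<gamma> (Suc 1) \<Longrightarrow> \<phi> x = 0) \<Longrightarrow>
        (\<Sum>s\<in>gen_index. of_int (c s) * \<phi> (case s of (i, j) \<Rightarrow> a i j)) = 0"
  show "\<forall>s\<in>gen_index. c s = 0"
  proof
    fix s assume s: "s \<in> gen_index"
    obtain i j where ij: "s = (i, j)" by fastforce
    then have o: "ok i j" using s g by simp
    then have i1: "1 \<le> i - 1" by (auto simp: ok_def)
    \<comment> \<open>With \<open>l = i - 1\<close> the entry \<open>t\<close> sees every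
      \<open>a i q\<close>, and the indicator of \<open>j\<close> makes its linear coefficient dual
      to the generator \<open>a i j\<close>.\<close>
    define w :: "nat \<Rightarrow> rat" where "w q = (if q = j then 1 else 0)" for q
    obtain \<Psi> where \<Psi>: "\<Psi> \<in> hom G tri" "\<And>p q. ok p q \<Longrightarrow> \<Psi> (a p q) = lin_rep i (i - 1) w p q"
      using lin_rep_hom[of "i - 1" i w] o i1 by (auto simp: ok_def)
    interpret tri_rep G \<Psi> using \<Psi>(1) by unfold_locales
    have "(\<Sum>s\<in>gen_index. of_int (c s) * t (case s of (i, j) \<Rightarrow> a i j) $ 1) = 0"
      using t_nth_1_add ut_derived[of _ 1] by (intro c) auto
    moreover have "t (case s' of (i, j) \<Rightarrow> a i j) $ 1 = (if s' = s then 1 else 0)" if "s' \<in> gen_index" for s'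
    proof -
      obtain p q where pq: "s' = (p, q)" by fastforce
      then have "ok p q" using that g by simp
      then show ?thesis using \<Psi>(2) by (auto simp: pq ij t_def lin_rep_def w_def ok_def)
    qed
    then have "(\<Sum>s'\<in>gen_index. of_int (c s') * t (case s' of (i, j) \<Rightarrow> a i j) $ 1) =
        (\<Sum>s'\<in>gen_index. if s' = s then of_int (c s') else 0)"
      by (intro sum.cong) auto
    ultimately show "c s = 0" using s fin by simp
  qed
qed simp

end


section \<open>Counting the basis\<close>

lemma sum_choose_below: "(\<Sum>l\<in>{1..<i}. (l + r) choose (r + 2)) = (i + r) choose (r + 3)" if "i \<ge> 1"
  using that
proof (induction i rule: nat_induct_at_least)
  case (Suc i)
  have "(Suc i + r) choose (r + 3) = ((i + r) choose (r + 2)) + ((i + r) choose (r + 3))"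
    by (simp add: eval_nat_numeral)
  then show ?case using Suc by (simp add: atLeastLessThanSuc)
qed simp

lemma sum_choose_upto: "(\<Sum>i\<in>{1..n}. (i + r) choose (r + 3)) = (n + r + 1) choose (r + 4)"
  by (induction n) (simp_all add: eval_nat_numeral)

lemma sum_double_choose:
  "(\<Sum>i\<in>{1..n}. \<Sum>l\<in>{1..<i}. (l + r) choose (r + 2)) = (n + r + 1) choose (r + 4)"
proof -
  have "(\<Sum>i\<in>{1..n}. \<Sum>l\<in>{1..<i}. (l + r) choose (r + 2)) = (\<Sum>i\<in>{1..n}. (i + r) choose (r + 3))"
    by (intro sum.cong refl sum_choose_below) auto
  then show ?thesis by (simp only: sum_choose_upto)
qed

lemma sum_pred: "l \<ge> 1 \<Longrightarrow> (\<Sum>c\<in>{1..<l}. c - 1) = (l - 1) choose 2"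
proof (induction l rule: nat_induct_at_least)
  case (Suc l)
  then obtain m where "l = Suc m" by (cases l) auto
  then show ?case using Suc by (simp add: atLeastLessThanSuc numeral_2_eq_2)
qed simp

text \<open>Number of basis elements with given \<open>i\<close> and \<open>l\<close> in degree
  \<open>r > 0\<close>: multisets of size \<open>r + 1\<close> over \<open>l\<close> letters except
  one, and pairs \<open>b < c < l\<close>.\<close>

definition block :: "nat \<Rightarrow> nat \<Rightarrow> nat"
  where "block r l = ((l + r) choose (r + 1)) - 1 + ((l - 1) choose 2)"

lemma block_Suc: "l \<ge> 1 \<Longrightarrow> block (Suc r) l = block r l + ((l + r) choose (r + 2))"
proof -
  assume "l \<ge> 1"
  then have "(l + r) choose (r + 1) \<ge> 1" by (simp add: Suc_le_eq)
  moreover have "(l + Suc r) choose (Suc r + 1) = ((l + r) choose (r + 1)) + ((l + r) choose (r + 2))"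
    by (simp add: eval_nat_numeral)
  ultimately show ?thesis by (simp add: block_def)
qed

lemma block_1: "l \<ge> 1 \<Longrightarrow> block 1 l = 2 * (l choose 2)"
proof (induction l rule: nat_induct_at_least)
  case base
  then show ?case by (simp add: block_def numeral_2_eq_2)
next
  case (Suc l)
  then obtain m where m: "l = Suc m" by (cases l) auto
  have "(l + 1) choose 2 \<ge> 1" using Suc by (simp add: Suc_le_eq)
  then show ?case using Suc by (simp add: block_def m numeral_2_eq_2)
qed

text \<open>By Pascal's rule a step in degree adds one binomial to each block, hence one summand on
  the right. In degree 1 the blocks are twice a binomial, which accounts for
  \<open>(n + 1) choose 4\<close> and for the equal summand \<open>i = 3\<close>.\<close>

lemma sum_block:
  "(\<Sum>i\<in>{1..n}. \<Sum>l\<in>{1..<i}. block (Suc r) l) =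
    ((n + 1) choose 4) + (\<Sum>i=3..r + 3. (n + i - 2) choose (i + 1))"
proof (induction r)
  case 0
  have "(\<Sum>i\<in>{1..n}. \<Sum>l\<in>{1..<i}. block 1 l) = 2 * (\<Sum>i\<in>{1..n}. \<Sum>l\<in>{1..<i}. (l + 0) choose (0 + 2))"
    unfolding sum_distrib_left by (intro sum.cong refl) (subst block_1, simp_all add: numeral_2_eq_2)
  also have "\<dots> = 2 * ((n + 1) choose 4)" by (subst sum_double_choose) simp
  finally show ?case by simp
next
  case (Suc r)
  have "(\<Sum>i\<in>{1..n}. \<Sum>l\<in>{1..<i}. block (Suc (Suc r)) l) =
      (\<Sum>i\<in>{1..n}. \<Sum>l\<in>{1..<i}. block (Suc r) l) +
      (\<Sum>i\<in>{1..n}. \<Sum>l\<in>{1..<i}. (l + Suc r) choose (Suc r + 2))"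
    by (simp add: block_Suc sum.distrib del: add_2_eq_Suc')
  also have "(\<Sum>i\<in>{1..n}. \<Sum>l\<in>{1..<i}. (l + Suc r) choose (Suc r + 2)) = (n + Suc r + 1) choose (Suc r + 4)"
    by (rule sum_double_choose)
  finally show ?case using Suc by (simp add: eval_nat_numeral)
qed

section \<open>Cardinalities of the index sets and the resulting ranks\<close>

context mccool_functionals
begin

lemma card_gen_index: "card gen_index = n choose 2"
proof -
  have "card gen_index = (\<Sum>i\<in>{1..<Suc n}. i - 1)"
    unfolding gen_index_def by (subst card_SigmaI) (auto simp: atLeastLessThanSuc_atLeastAtMost)
  then show ?thesis using sum_pred[of "Suc n"] by simp
qed

lemma card_canon_index:
  "card (canon_index r) = (\<Sum>i\<in>{1..n}. \<Sum>l\<in>{1..<i}. ((l + r) choose (r + 1)) - 1)"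
proof -
  have "card (multisets_of_size {1..l} (Suc r) - {replicate_mset (Suc r) l}) = ((l + r) choose (r + 1)) - 1"
    if "l \<ge> 1" for l
  proof -
    have "replicate_mset (Suc r) l \<in> multisets_of_size {1..l} (Suc r)"
      using that by (auto simp: multisets_of_size_def)
    then show ?thesis
      by (simp add: card_Diff_singleton card_multisets_of_size finite_multisets_of_size)
  qed
  then show ?thesis
    unfolding canon_index_def
    by (subst card_SigmaI) (auto intro!: sum.cong card_SigmaI[THEN trans] finite_SigmaI)
qed

lemma card_extra_index:
  "card (extra_index (Suc r)) = (\<Sum>i\<in>{1..n}. \<Sum>l\<in>{1..<i}. (l - 1) choose 2)"
proof -
  have "card (extra_index (Suc r)) = (\<Sum>i\<in>{1..n}. \<Sum>l\<in>{1..<i}. \<Sum>c\<in>{1..<l}. c - 1)"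
    by (simp add: extra_index_def card_SigmaI finite_SigmaI)
  also have "\<dots> = (\<Sum>i\<in>{1..n}. \<Sum>l\<in>{1..<i}. (l - 1) choose 2)"
    by (intro sum.cong refl sum_pred) auto
  finally show ?thesis .
qed

lemma card_basis_index_0: "card (basis_index 0) = n choose 3"
proof -
  have "card (basis_index 0) = (\<Sum>i\<in>{1..n}. \<Sum>l\<in>{1..<i}. l - 1)"
    by (simp add: basis_index_def card_Plus finite_index card_canon_index extra_index_def)
  also have "\<dots> = (\<Sum>i\<in>{1..n}. (i - 1) choose 2)"
    by (intro sum.cong refl sum_pred) auto
  also have "\<dots> = n choose 3"
    by (induction n) (simp_all add: eval_nat_numeral)
  finally show ?thesis .
qed

lemma card_basis_index_Suc:
  "card (basis_index (Suc r)) = ((n + 1) choose 4) + (\<Sum>i=3..r + 3. (n + i - 2) choose (i + 1))"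
  unfolding sum_block[symmetric]
  by (simp add: basis_index_def card_Plus finite_index card_canon_index card_extra_index
      block_def sum.distrib)

theorem graded_ranks:
  "ab_rank (gr G 1) = enat (n choose 2) \<and> ab_rank (gr G 2) = enat (n choose 3) \<and>
   (\<forall>k\<ge>3. ab_rank (gr G k) = enat (((n + 1) choose 4) + (\<Sum>i=3..k. (n + i - 2) choose (i + 1))))"
proof (intro conjI allI impI)
  show "ab_rank (gr G 1) = enat (n choose 2)" by (simp only: ab_rank_gr_1 card_gen_index)
  show "ab_rank (gr G 2) = enat (n choose 3)" using ab_rank_gr[of 0] by (simp only: add_0 card_basis_index_0)
  fix k :: nat assume "k \<ge> 3"
  then obtain r where "k = r + 3" using le_Suc_ex[of 3 k] by (auto simp: add.commute)
  moreover have "Suc r + 2 = r + 3" by simp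
  ultimately show "ab_rank (gr G k) = enat (((n + 1) choose 4) + (\<Sum>i=3..k. (n + i - 2) choose (i + 1)))"
    using ab_rank_gr[of "Suc r"] card_basis_index_Suc[of r] by metis
qed

end

declare One_nat_def [simp del]

section \<open>Homomorphisms out of a group of automorphisms\<close>

text \<open>The pairs \<open>(x i, f i)\<close> generate a subgroup of the product that projects
  onto the group generated by the \<open>x i\<close>. Two values over the same element differ by a
  member of the fibre over the identity, so a trivial fibre makes this subgroup the graph of a
  homomorphism.\<close>

lemma hom_extension:
  assumes A: "group A" and Q: "group Q" and x: "x \<in> I \<rightarrow> carrier A" and f: "f \<in> I \<rightarrow> carrier Q"
    and inj: "\<And>y. (\<one>\<^bsub>A\<^esub>, y) \<in> generate (A \<times>\<times> Q) ((\<lambda>i. (x i, f i)) ` I) \<Longrightarrow> y = \<one>\<^bsub>Q\<^esub>"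
  shows "\<exists>\<Psi>\<in>hom (A\<lparr>carrier := generate A (x ` I)\<rparr>) Q. \<forall>i\<in>I. \<Psi> (x i) = f i"
proof -
  interpret A: group A by (rule A)
  interpret Q: group Q by (rule Q)
  interpret AQ: group "A \<times>\<times> Q" by (rule DirProd_group[OF A Q])
  define P where "P = generate (A \<times>\<times> Q) ((\<lambda>i. (x i, f i)) ` I)"
  have sub: "(\<lambda>i. (x i, f i)) ` I \<subseteq> carrier (A \<times>\<times> Q)" using x f by (auto simp: DirProd_def)
  interpret P: subgroup P "A \<times>\<times> Q" unfolding P_def by (rule AQ.generate_is_subgroup[OF sub])
  have Pc: "g \<in> carrier A" "y \<in> carrier Q" if "(g, y) \<in> P" for g y
    using P.subset that by auto
  have ex: "\<exists>y. (g, y) \<in> P" if "g \<in> generate A (x ` I)" for g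
    using that
  proof (induction g rule: generate.induct)
    case one
    then show ?case using P.one_closed by auto
  next
    case (incl h)
    then show ?case unfolding P_def by (auto intro: generate.incl)
  next
    case (inv h)
    then obtain y where y: "(h, y) \<in> P" unfolding P_def by (auto intro: generate.incl)
    then have "inv\<^bsub>A \<times>\<times> Q\<^esub> (h, y) \<in> P" by (rule P.m_inv_closed)
    then show ?case using inv_DirProd[OF A Q] Pc[OF y] by auto
  next
    case (eng g h)
    then obtain y z where "(g, y) \<in> P" "(h, z) \<in> P" by auto
    then have "(g, y) \<otimes>\<^bsub>A \<times>\<times> Q\<^esub> (h, z) \<in> P" by (rule P.m_closed)
    then show ?case by auto
  qed
  have unique: "y = z" if "(g, y) \<in> P" "(g, z) \<in> P" for g y z
  proof -
    have "(g, y) \<otimes>\<^bsub>A \<times>\<times> Q\<^esub> inv\<^bsub>A \<times>\<times> Q\<^esub> (g, z) \<in> P" using that by simp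
    then have "(\<one>\<^bsub>A\<^esub>, y \<otimes>\<^bsub>Q\<^esub> inv\<^bsub>Q\<^esub> z) \<in> P"
      using inv_DirProd[OF A Q] Pc that by auto
    then have "y \<otimes>\<^bsub>Q\<^esub> inv\<^bsub>Q\<^esub> z = \<one>\<^bsub>Q\<^esub>" using inj P_def by blast
    then show ?thesis using Pc that by (metis Q.inv_equality Q.inv_inv Q.inv_closed)
  qed
  define \<Psi> where "\<Psi> g = (SOME y. (g, y) \<in> P)" for g
  have \<Psi>: "(g, \<Psi> g) \<in> P" if "g \<in> generate A (x ` I)" for g
    unfolding \<Psi>_def using someI_ex[OF ex[OF that]] .
  have "\<Psi> \<in> hom (A\<lparr>carrier := generate A (x ` I)\<rparr>) Q"
  proof (rule homI)
    fix g h assume "g \<in> carrier (A\<lparr>carrier := generate A (x ` I)\<rparr>)" "h \<in> carrier (A\<lparr>carrier := generate A (x ` I)\<rparr>)"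
    then have gh: "g \<in> generate A (x ` I)" "h \<in> generate A (x ` I)" by auto
    have "(g, \<Psi> g) \<otimes>\<^bsub>A \<times>\<times> Q\<^esub> (h, \<Psi> h) \<in> P" using \<Psi>[OF gh(1)] \<Psi>[OF gh(2)] by (rule P.m_closed)
    then show "\<Psi> (g \<otimes>\<^bsub>A\<lparr>carrier := generate A (x ` I)\<rparr>\<^esub> h) = \<Psi> g \<otimes>\<^bsub>Q\<^esub> \<Psi> h"
      using unique[OF \<Psi>[OF generate.eng[OF gh]]] by simp
  qed (use \<Psi> Pc in force)
  moreover have "\<Psi> (x i) = f i" if "i \<in> I" for i
  proof (rule unique)
    show "(x i, \<Psi> (x i)) \<in> P" using that by (intro \<Psi> generate.incl) auto
    show "(x i, f i) \<in> P" unfolding P_def using that by (intro generate.incl) auto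
  qed
  ultimately show ?thesis by blast
qed

lemma AutoGroup_mult_apply:
  assumes "g \<in> carrier (AutoGroup G)" "h \<in> carrier (AutoGroup G)" "w \<in> carrier G"
  shows "(g \<otimes>\<^bsub>AutoGroup G\<^esub> h) w = g (h w)"
  using assms by (simp add: AutoGroup_def auto_def BijGroup_def compose_def)

lemma AutoGroup_one_apply: "w \<in> carrier G \<Longrightarrow> \<one>\<^bsub>AutoGroup G\<^esub> w = w"
  by (simp add: AutoGroup_def BijGroup_def)

lemma AutoGroup_hom: "g \<in> carrier (AutoGroup G) \<Longrightarrow> g \<in> hom G G"
  by (simp add: AutoGroup_def auto_def)

lemma AutoGroup_closed: "g \<in> carrier (AutoGroup G) \<Longrightarrow> w \<in> carrier G \<Longrightarrow> g w \<in> carrier G"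
  by (rule hom_in_carrier[OF AutoGroup_hom])

lemma AutoGroup_eqI:
  assumes "g \<in> carrier (AutoGroup G)" "h \<in> carrier (AutoGroup G)"
    "\<And>w. w \<in> carrier G \<Longrightarrow> g w = h w"
  shows "g = h"
  using assms by (auto simp: AutoGroup_def auto_def Bij_def intro: extensionalityI)


section \<open>The Magnus representation\<close>

text \<open>The pair \<open>(t, v)\<close> stands for the affine map \<open>x \<mapsto> t x + v\<close>.\<close>

definition aff :: "('r::comm_ring_1 \<times> 'r) monoid" where
  "aff = \<lparr>carrier = {(t, v). t dvd 1}, monoid.mult = (\<lambda>(t, v) (t', v'). (t * t', v + t * v')), one = (1, 0)\<rparr>"

lemma group_aff: "group (aff :: ('r::comm_ring_1 \<times> 'r) monoid)"
proof (rule groupI)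
  fix x :: "'r \<times> 'r" assume "x \<in> carrier aff"
  then obtain t v s where x: "x = (t, v)" "s * t = 1" by (auto simp: aff_def dvd_def mult.commute)
  then show "\<exists>y\<in>carrier aff. y \<otimes>\<^bsub>aff\<^esub> x = \<one>\<^bsub>aff\<^esub>"
    by (intro bexI[of _ "(s, - s * v)"]) (auto simp: aff_def dvd_def mult.commute intro: exI[of _ t])
next
  have "a * b dvd 1" if "a dvd 1" "b dvd 1" for a b :: 'r
    using mult_dvd_mono[OF that] by simp
  then show "x \<otimes>\<^bsub>aff\<^esub> y \<in> carrier aff" if "x \<in> carrier aff" "y \<in> carrier aff" for x y :: "'r \<times> 'r"
    using that by (auto simp: aff_def)
qed (auto simp: aff_def algebra_simps)

lemma aff_conj:
  assumes "x dvd 1" "z dvd (1 :: 'r :: comm_ring_1)"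
  shows "(x, a) \<otimes>\<^bsub>aff\<^esub> (z, b) \<otimes>\<^bsub>aff\<^esub> inv\<^bsub>aff\<^esub> (x, a) = (z, x * b + (1 - z) * a)"
proof -
  interpret group "aff :: ('r \<times> 'r) monoid" by (rule group_aff)
  have "(x, a) \<otimes>\<^bsub>aff\<^esub> (z, b) = (z, x * b + (1 - z) * a) \<otimes>\<^bsub>aff\<^esub> (x, a)"
    by (simp add: aff_def algebra_simps)
  moreover have "(x, a) \<in> carrier aff" "(z, x * b + (1 - z) * a) \<in> carrier aff" using assms by (auto simp: aff_def)
  ultimately show ?thesis by (simp add: m_assoc)
qed

locale magnus =
  fixes n :: nat and s :: "nat \<Rightarrow> 'r::comm_ring_1"
  assumes s_unit: "\<And>j. s j dvd 1"
begin

text \<open>Fox calculus in affine form: the second component is the sum over \<open>j\<close> of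
  the Fox derivative with respect to the generator \<open>j\<close>, specialised at
  \<open>s\<close>, times \<open>v j\<close>.\<close>

definition \<theta> :: "(nat \<Rightarrow> 'r) \<Rightarrow> nat word \<Rightarrow> 'r \<times> 'r"
  where "\<theta> v = free_lift aff (\<lambda>j. (s j, v j))"

lemma \<theta>_hom: "\<theta> v \<in> hom (Free n) aff"
  unfolding \<theta>_def by (rule group.free_lift_hom[OF group_aff]) (auto simp: aff_def s_unit)

lemma \<theta>_gen: "\<theta> v (free_gen j) = (s j, v j)"
  unfolding \<theta>_def by (rule group.free_lift_gen[OF group_aff]) (simp add: aff_def s_unit)

text \<open>This is the translation part of \<open>(s i, v i)\<close> conjugated by
  \<open>(s j, v j)\<close>. The linear part \<open>s i\<close> is unchanged by conjugation, so one
  choice of \<open>s\<close> is compatible with all generators.\<close>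

definition act :: "nat \<Rightarrow> nat \<Rightarrow> (nat \<Rightarrow> 'r) \<Rightarrow> nat \<Rightarrow> 'r"
  where "act i j v = v(i := s j * v i + (1 - s i) * v j)"

lemma \<theta>_alpha:
  assumes ij: "i \<in> {1..n}" "j \<in> {1..n}" "i \<noteq> j" and w: "w \<in> carrier (Free n)"
  shows "\<theta> v (alpha n i j w) = \<theta> (act i j v) w"
proof -
  interpret F: group "Free n" by (rule group_free_group)
  interpret \<theta>: group_hom "Free n" aff "\<theta> v"
    by (intro group_hom.intro group_hom_axioms.intro \<theta>_hom group_aff group_free_group)
  have g: "free_gen l \<in> carrier (Free n)" if "l \<in> {1..n}" for l using that by (rule free_gen_closed)
  have "(\<theta> v \<circ> alpha n i j) w = free_lift aff (\<lambda>l. (s l, act i j v l)) w"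
  proof (rule group.free_lift_unique[OF group_aff _ _ w])
    show "\<theta> v \<circ> alpha n i j \<in> hom (Free n) aff"
      by (rule Group.hom_compose[OF AutoGroup_hom[OF alpha_auto[OF ij]] \<theta>_hom])
    fix l assume l: "l \<in> {1..n}"
    show "(\<theta> v \<circ> alpha n i j) (free_gen l) = (s l, act i j v l)"
    proof (cases "l = i")
      case True
      have "\<theta> v (alpha n i j (free_gen i)) = (s j, v j) \<otimes>\<^bsub>aff\<^esub> (s i, v i) \<otimes>\<^bsub>aff\<^esub> inv\<^bsub>aff\<^esub> (s j, v j)"
        using alpha_gen(1)[OF ij(1,2)] g ij by (simp add: \<theta>_gen)
      then show ?thesis using True by (simp add: aff_conj s_unit act_def)
    next
      case False
      then show ?thesis using alpha_gen(2)[OF ij(1,2) l] by (simp add: \<theta>_gen act_def)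
    qed
  qed
  then show ?thesis by (simp add: \<theta>_def)
qed

lemma act_surj: "i \<noteq> j \<Longrightarrow> \<exists>w. act i j w = v"
proof -
  assume "i \<noteq> j"
  obtain r where r: "s j * r = 1" using s_unit[of j] by (auto simp: dvd_def)
  have "s j * (r * (v i - (1 - s i) * v j)) = v i - (1 - s i) * v j"
    using r by (simp add: mult.assoc[symmetric])
  then show ?thesis using \<open>i \<noteq> j\<close>
    by (intro exI[of _ "v(i := r * (v i - (1 - s i) * v j))"]) (auto simp: act_def fun_eq_iff)
qed

end

text \<open>A family \<open>St\<close> of vectors, on which the Magnus representation acts through the triangular
  matrices \<open>y i j\<close>, shows that these matrices satisfy all relations between the generators.\<close>

lemma (in magnus) magnus_hom:
  fixes y :: "nat \<Rightarrow> nat \<Rightarrow> 'k::comm_ring_1 fps \<times> 'k fps \<times> 'k fps"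
  fixes St :: "(nat \<Rightarrow> 'r) \<Rightarrow> 'k fps \<times> 'k fps \<Rightarrow> bool"
  fixes ap :: "'k fps \<times> 'k fps \<times> 'k fps \<Rightarrow> 'k fps \<times> 'k fps \<Rightarrow> 'k fps \<times> 'k fps"
  defines "ap \<equiv> \<lambda>(u, t, d) (p, q). (u * p, t * q + d * p)"
  assumes Z: "subgroup Z tri" and y: "\<And>i j. 1 \<le> j \<Longrightarrow> j < i \<Longrightarrow> i \<le> n \<Longrightarrow> y i j \<in> Z"
    and St_local: "\<And>v v' p. St v p \<Longrightarrow> (\<And>j. j \<in> {1..n} \<Longrightarrow> v' j = v j) \<Longrightarrow> St v' p"
    and St: "\<And>i j v p. 1 \<le> j \<Longrightarrow> j < i \<Longrightarrow> i \<le> n \<Longrightarrow> St (act i j v) (ap (y i j) p) \<longleftrightarrow> St v p"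
    and faithful: "\<And>z. z \<in> Z \<Longrightarrow> (\<And>v p. St v p \<Longrightarrow> St v (ap z p)) \<Longrightarrow> z = \<one>\<^bsub>tri\<^esub>"
  shows "\<exists>\<Psi>\<in>hom (upper_McCool n) tri. \<forall>i j. 1 \<le> j \<and> j < i \<and> i \<le> n \<longrightarrow> \<Psi> (alpha n i j) = y i j"
proof -
  let ?A = "AutoGroup (Free n)"
  interpret A: group ?A by (rule group.AutoGroup[OF group_free_group])
  interpret Q: group "tri :: ('k fps \<times> 'k fps \<times> 'k fps) monoid" by (rule group_tri)
  interpret Z: subgroup Z tri by (rule Z)
  have ap_mult: "ap (z \<otimes>\<^bsub>tri\<^esub> z') p = ap z' (ap z p)" for z z' p
    by (cases z; cases z'; cases p) (simp add: ap_def tri_def algebra_simps)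
  have ap_one: "ap \<one>\<^bsub>tri\<^esub> p = p" for p by (cases p) (simp add: ap_def tri_def)
  define I where "I = {(i, j). 1 \<le> j \<and> j < i \<and> i \<le> n}"
  define x where "x = (\<lambda>(i, j). alpha n i j)"
  define f where "f = (\<lambda>(i, j). y i j)"
  have gens: "x ` I = upper_McCool_gens n" by (auto simp: x_def I_def upper_McCool_gens_def)
  have x: "x \<in> I \<rightarrow> carrier ?A" by (auto simp: I_def x_def simp del: One_nat_def intro!: alpha_auto)
  have f: "f \<in> I \<rightarrow> Z" using y by (auto simp: f_def I_def)
  have fc: "f \<in> I \<rightarrow> carrier tri" using f Z.subset by auto
  \<comment> \<open>Every pair \<open>(g, z)\<close> transports vectors: composing
    \<open>\<theta> v\<close> with \<open>g\<close> replaces \<open>v\<close> by some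
    \<open>v'\<close>, and \<open>z\<close> moves the reduced coordinates accordingly. Only
    existence of \<open>v'\<close> is claimed, as \<open>\<theta> v'\<close> on the free group
    determines \<open>v'\<close> only on \<open>{1..n}\<close>.\<close>
  have C: "z \<in> Z \<and> g \<in> carrier ?A \<and> (\<forall>v p. St v p \<longrightarrow>
      (\<exists>v'. (\<forall>w\<in>carrier (Free n). \<theta> v (g w) = \<theta> v' w) \<and> St v' (ap z p)))"
    if "gz \<in> generate (?A \<times>\<times> tri) ((\<lambda>i. (x i, f i)) ` I)" "gz = (g, z)" for gz g z
    using that
  proof (induction gz arbitrary: g z rule: generate.induct)
    case one
    then show ?case by (auto simp: AutoGroup_one_apply ap_one)
  next
    case (incl h)
    then obtain i j where ij: "(i, j) \<in> I" "g = alpha n i j" "z = y i j"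
      by (auto simp: x_def f_def)
    then have "i \<in> {1..n}" "j \<in> {1..n}" "i \<noteq> j" by (auto simp: I_def)
    then have "\<theta> v (g w) = \<theta> (act i j v) w" if "w \<in> carrier (Free n)" for v w
      using \<theta>_alpha that ij by simp
    moreover have "St (act i j v) (ap z p)" if "St v p" for v p
      using St[of j i v p] that ij by (auto simp: I_def)
    moreover have "z \<in> Z" "g \<in> carrier ?A"
      using Pi_mem[OF f ij(1)] Pi_mem[OF x ij(1)] ij(2,3) by (simp_all add: x_def f_def)
    ultimately show ?case by blast
  next
    case (inv h)
    then obtain i j where ij: "(i, j) \<in> I" "h = (alpha n i j, y i j)"
      by (auto simp: x_def f_def)
    have m: "i \<in> {1..n}" "j \<in> {1..n}" "i \<noteq> j" using ij by (auto simp: I_def)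
    have c: "alpha n i j \<in> carrier ?A" "y i j \<in> Z"
      using Pi_mem[OF f ij(1)] Pi_mem[OF x ij(1)] by (simp_all add: x_def f_def)
    then have "inv\<^bsub>?A \<times>\<times> tri\<^esub> h = (inv\<^bsub>?A\<^esub> (alpha n i j), inv\<^bsub>tri\<^esub> (y i j))"
      using inv_DirProd[OF A.is_group Q.is_group] ij Z.subset by auto
    then have gz: "g = inv\<^bsub>?A\<^esub> (alpha n i j)" "z = inv\<^bsub>tri\<^esub> (y i j)" using inv.prems by auto
    have "\<exists>v'. (\<forall>w\<in>carrier (Free n). \<theta> v (g w) = \<theta> v' w) \<and> St v' (ap z p)" if "St v p" for v p
    proof -
      \<comment> \<open>For an inverse generator the vector is pulled back along \<open>act\<close>,
        and the equivalence assumed for \<open>St\<close> is used backwards.\<close>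
      obtain v' where v': "act i j v' = v" using act_surj[OF m(3)] by blast
      have "ap (y i j) (ap z p) = p"
        unfolding ap_mult[symmetric] gz using c Z.subset by (simp add: subsetD ap_one)
      then have "St (act i j v') (ap (y i j) (ap z p))" using that v' by simp
      then have "St v' (ap z p)" using St[of j i v' "ap z p"] ij by (auto simp: I_def)
      moreover have "\<theta> v (g w) = \<theta> v' w" if w: "w \<in> carrier (Free n)" for w
      proof -
        have gw: "g w \<in> carrier (Free n)" using AutoGroup_closed[OF _ w] c gz by simp
        have "g \<in> carrier ?A" "alpha n i j \<otimes>\<^bsub>?A\<^esub> g = \<one>\<^bsub>?A\<^esub>" using c gz by simp_all
        then have "alpha n i j (g w) = w"
          using AutoGroup_mult_apply[OF c(1) _ w] AutoGroup_one_apply[OF w] by metis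
        then show ?thesis using \<theta>_alpha[OF m gw, of v'] v' by simp
      qed
      ultimately show ?thesis by blast
    qed
    then show ?case using c gz by simp
  next
    case (eng h1 h2)
    obtain g1 z1 g2 z2 where h: "h1 = (g1, z1)" "h2 = (g2, z2)" by (cases h1; cases h2) auto
    have gz: "g = g1 \<otimes>\<^bsub>?A\<^esub> g2" "z = z1 \<otimes>\<^bsub>tri\<^esub> z2" using eng.prems h by auto
    note IH = eng.IH(1)[OF h(1)] eng.IH(2)[OF h(2)]
    have "\<exists>v'. (\<forall>w\<in>carrier (Free n). \<theta> v (g w) = \<theta> v' w) \<and> St v' (ap z p)" if vp: "St v p" for v p
    proof -
      obtain v1 where v1: "\<forall>w\<in>carrier (Free n). \<theta> v (g1 w) = \<theta> v1 w" "St v1 (ap z1 p)"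
        using conjunct2[OF conjunct2[OF IH(1)], rule_format, OF vp] by auto
      obtain v2 where v2: "\<forall>w\<in>carrier (Free n). \<theta> v1 (g2 w) = \<theta> v2 w" "St v2 (ap z2 (ap z1 p))"
        using conjunct2[OF conjunct2[OF IH(2)], rule_format, OF v1(2)] by auto
      have "\<theta> v (g w) = \<theta> v2 w" if "w \<in> carrier (Free n)" for w
        using that IH v1(1) v2(1) AutoGroup_closed[of g2 "Free n" w]
        by (simp add: gz AutoGroup_mult_apply)
      then show ?thesis using v2(2) by (auto simp: gz ap_mult)
    qed
    then show ?case using IH by (simp add: gz)
  qed
  have "\<exists>\<Psi>\<in>hom (?A\<lparr>carrier := generate ?A (x ` I)\<rparr>) tri. \<forall>i\<in>I. \<Psi> (x i) = f i"
  proof (rule hom_extension[OF A.is_group Q.is_group x fc])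
    fix z assume z: "(\<one>\<^bsub>?A\<^esub>, z) \<in> generate (?A \<times>\<times> tri) ((\<lambda>i. (x i, f i)) ` I)"
    show "z = \<one>\<^bsub>tri\<^esub>"
    proof (rule faithful)
      show "z \<in> Z" using C[OF z refl] by blast
      fix v p assume vp: "St v p"
      obtain v' where v': "\<forall>w\<in>carrier (Free n). \<theta> v (\<one>\<^bsub>?A\<^esub> w) = \<theta> v' w" "St v' (ap z p)"
        using conjunct2[OF conjunct2[OF C[OF z refl]], rule_format, OF vp] by auto
      \<comment> \<open>Over the identity automorphism the transported vector is the original one on
        \<open>{1..n}\<close>, so \<open>z\<close> preserves \<open>St v\<close> and faithfulness
        applies.\<close>
      have "v j = v' j" if "j \<in> {1..n}" for j
        using bspec[OF v'(1) free_gen_closed[OF that]] free_gen_closed[OF that]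
        by (simp add: AutoGroup_one_apply \<theta>_gen)
      then show "St v (ap z p)" using St_local[OF v'(2)] by blast
    qed
  qed
  then show ?thesis unfolding gens by (auto simp: upper_McCool_def x_def f_def I_def)
qed

lemma (in magnus) s_cancel: "s j * x = s j * y \<longleftrightarrow> x = y"
proof -
  obtain r where r: "s j * r = 1" using s_unit[of j] by (auto simp: dvd_def)
  have "x = y" if "s j * x = s j * y"
    using arg_cong[OF that, of "\<lambda>z. r * z"] r by (simp add: mult.assoc[symmetric] mult.commute[of r])
  then show ?thesis by blast
qed

lemma (in magnus) s_zero: "s j * x = 0 \<longleftrightarrow> x = 0"
  using s_cancel[of j x 0] by simp

lemma fps_dvd_1: "f $ 0 = 1 \<Longrightarrow> f dvd (1 :: 'k::comm_ring_1 fps)"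
  using fps_inverse_exists[of f] by (metis dvdI mult.commute)

lemma lin_rep_exists:
  assumes l: "1 \<le> l" "l < i" "i \<le> n"
  shows "\<exists>\<Psi>\<in>hom (upper_McCool n) tri. \<forall>p q. 1 \<le> q \<and> q < p \<and> p \<le> n \<longrightarrow>
    \<Psi> (alpha n p q) = lin_rep i l w p q"
proof -
  \<comment> \<open>The value \<open>- 1\<close> makes the factor \<open>1 - s i\<close> a nonzero constant; the value 1 between \<open>l\<close> and
    \<open>i\<close> makes the vectors supported on \<open>{l, i}\<close> an invariant subspace.\<close>
  define s :: "nat \<Rightarrow> rat fps"
    where "s j = (if j = i then - 1 else if j \<le> l then 1 + fps_const (w j) * fps_X else 1)" for j
  interpret magnus n s
    by standard (auto simp: s_def intro!: fps_dvd_1)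
  define St :: "(nat \<Rightarrow> rat fps) \<Rightarrow> rat fps \<times> rat fps \<Rightarrow> bool"
    where "St v x \<longleftrightarrow> (\<forall>j\<in>{1..n} - {l, i}. v j = 0) \<and> fst x = v l \<and> snd x = v i" for v x
  show ?thesis
  proof (rule magnus_hom[where Z = "carrier tri" and St = St])
    show "subgroup (carrier tri) (tri :: (rat fps \<times> rat fps \<times> rat fps) monoid)"
      by (rule group.subgroup_self[OF group_tri])
    show "lin_rep i l w p q \<in> carrier tri" for p q by (auto simp: lin_rep_def tri_def)
    show "St v' x" if "St v x" "\<And>j. j \<in> {1..n} \<Longrightarrow> v' j = v j" for v v' x
      using that l by (auto simp: St_def)
    show "z = \<one>\<^bsub>tri\<^esub>"
      if z: "z \<in> carrier tri" "\<And>v x. St v x \<Longrightarrow> St v ((\<lambda>(u, t, d) (p, q). (u * p, t * q + d * p)) z x)" for z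
    proof -
      obtain u t d where utd: "z = (u, t, d)" by (cases z) auto
      \<comment> \<open>The two unit vectors recover all three entries of the matrix.\<close>
      have "St (\<lambda>j. if j = l then 1 else 0) (1, 0)" "St (\<lambda>j. if j = i then 1 else 0) (0, 1)"
        using l by (auto simp: St_def)
      from z(2)[OF this(1)] z(2)[OF this(2)] show ?thesis
        using l by (auto simp: St_def utd tri_def)
    qed
    fix q p and v :: "nat \<Rightarrow> rat fps" and x :: "rat fps \<times> rat fps" assume qp: "1 \<le> q" "q < p" "p \<le> n"
    obtain x1 x2 where x: "x = (x1, x2)" by (cases x) auto
    have si: "s i = - 1" by (simp add: s_def)
    have s_nz: "s j \<noteq> 0" for j using s_zero[of j 1] by simp
    consider "p = i" "q = l" | "p = i" "q \<noteq> l" | "p = l" | "p \<noteq> i" "p \<noteq> l" by blast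
    then show "St (act p q v) ((\<lambda>(u, t, d) (p, q). (u * p, t * q + d * p)) (lin_rep i l w p q) x) \<longleftrightarrow> St v x"
    proof cases
      case 1
      have "lin_rep i l w p q = (1, s l, 2)" using 1 l by (simp add: lin_rep_def s_def)
      moreover have "(\<forall>j\<in>{1..n} - {l, i}. act p q v j = 0) \<longleftrightarrow> (\<forall>j\<in>{1..n} - {l, i}. v j = 0)"
        by (auto simp: act_def 1)
      moreover have "act p q v i = s l * v i + 2 * v l" "act p q v l = v l"
        using 1 l by (auto simp: act_def si)
      ultimately show ?thesis by (auto simp: St_def x s_cancel s_nz)
    next
      case 2
      have "lin_rep i l w p q = (1, s q, 0)" using 2 l qp by (auto simp: lin_rep_def s_def)
      moreover have "(\<forall>j\<in>{1..n} - {l, i}. act p q v j = 0) \<longleftrightarrow> (\<forall>j\<in>{1..n} - {l, i}. v j = 0)"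
        by (auto simp: act_def 2)
      moreover have "act p q v i = s q * v i" "act p q v l = v l" if "\<forall>j\<in>{1..n} - {l, i}. v j = 0"
        using 2 l qp that by (auto simp: act_def)
      ultimately show ?thesis by (auto simp: St_def x s_cancel s_nz)
    next
      case 3
      have "lin_rep i l w p q = (s q, 1, 0)" using 3 l qp by (auto simp: lin_rep_def s_def)
      moreover have "(\<forall>j\<in>{1..n} - {l, i}. act p q v j = 0) \<longleftrightarrow> (\<forall>j\<in>{1..n} - {l, i}. v j = 0)"
        by (auto simp: act_def 3)
      moreover have "act p q v l = s q * v l" "act p q v i = v i" if "\<forall>j\<in>{1..n} - {l, i}. v j = 0"
        using 3 l qp that by (auto simp: act_def)
      ultimately show ?thesis by (auto simp: St_def x s_cancel s_nz)
    next
      case 4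
      have "lin_rep i l w p q = (1, 1, 0)" using 4 by (simp add: lin_rep_def)
      moreover have "(\<forall>j\<in>{1..n} - {l, i}. act p q v j = 0) \<longleftrightarrow> (\<forall>j\<in>{1..n} - {l, i}. v j = 0)"
      proof -
        have a: "act p q v j = v j" if "j \<noteq> p" for j using that by (simp add: act_def)
        \<comment> \<open>Below \<open>l\<close> the index \<open>q\<close> also lies outside the
          support, so \<open>v q = 0\<close>; above \<open>l\<close> the factor
          \<open>1 - s p\<close> is zero.\<close>
        have p: "act p q v p = s q * v p" if "p < l \<Longrightarrow> v q = 0"
          using that 4 by (auto simp: act_def s_def)
        have q: "p < l \<Longrightarrow> q \<in> {1..n} - {l, i} \<and> q \<noteq> p" using qp l by auto
        have pm: "p \<in> {1..n} - {l, i}" using 4 qp by auto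
        show ?thesis
        proof
          assume h: "\<forall>j\<in>{1..n} - {l, i}. act p q v j = 0"
          then have "v p = 0" using p q a pm by (metis s_zero)
          then show "\<forall>j\<in>{1..n} - {l, i}. v j = 0" using h a by metis
        next
          assume h: "\<forall>j\<in>{1..n} - {l, i}. v j = 0"
          then have "act p q v p = 0" using p q pm by (metis s_zero)
          then show "\<forall>j\<in>{1..n} - {l, i}. act p q v j = 0" using h a by metis
        qed
      qed
      moreover have "act p q v l = v l" "act p q v i = v i" using 4 by (auto simp: act_def)
      ultimately show ?thesis by (auto simp: St_def x)
    qed
  qed
qed

lemma nil_rep_exists:
  assumes o: "1 \<le> b" "b < c" "c < l" "l < i" "i \<le> n"
  shows "\<exists>\<Psi>\<in>hom (upper_McCool n) tri. \<forall>p q. 1 \<le> q \<and> q < p \<and> p \<le> n \<longrightarrow>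
    \<Psi> (alpha n p q) = nil_rep i l c b p q"
proof -
  define N1 N2 :: "rat dual dual fps" where N: "N1 = fps_const \<nu>\<^sub>1" "N2 = fps_const \<nu>\<^sub>2"
  have nn: "N1 * N1 = 0" "N2 * N2 = 0" by (simp_all add: N)
  then have nn': "N1 * (N1 * x) = 0" "N2 * (N2 * x) = 0" for x
    by (simp_all add: mult.assoc[symmetric])
  define s :: "nat \<Rightarrow> rat dual dual fps"
    where "s j = (if j = i then - 1 else if j = l then 1 + fps_X else if j = c then 1 + N1 * fps_X else 1)" for j
  interpret magnus n s
    by standard (auto simp: s_def N intro!: fps_dvd_1)
  have s: "s i = - 1" "s l = 1 + fps_X" "s c = 1 + N1 * fps_X" "\<And>j. j \<notin> {i, l, c} \<Longrightarrow> s j = 1"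
    using o by (auto simp: s_def)
  define K where "K = {1..n} - {b, c, l, i}"
  \<comment> \<open>The three combinations of coordinates used here span an invariant subspace, and the first two are
    \<open>\<nu>\<^sub>2\<close> and \<open>\<nu>\<^sub>1\<close> times the same scalar; since that scalar matters only up to the annihilator
    of \<open>\<nu>\<^sub>1\<close> and \<open>\<nu>\<^sub>2\<close>, the diagonal entry \<open>u\<close> is kept in the group of the \<open>U \<kappa>\<close>.\<close>
  define St :: "(nat \<Rightarrow> rat dual dual fps) \<Rightarrow> rat dual dual fps \<times> rat dual dual fps \<Rightarrow> bool"
    where "St v x \<longleftrightarrow> (\<forall>j\<in>K. v j = 0) \<and> - (fps_X * v b) = N2 * fst x \<and>
      N1 * fps_X * v l - fps_X * v c = N1 * fst x \<and> snd x = - (fps_X * v i) - 2 * v l" for v x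
  define \<iota> :: "rat \<Rightarrow> rat dual dual" where "\<iota> \<kappa> = Dual (Dual \<kappa> 0) 0" for \<kappa>
  define U where "U \<kappa> = 1 + fps_const (\<iota> \<kappa>) * N2 * fps_X" for \<kappa>
  \<comment> \<open>Since \<open>N2\<close> squares to zero, the elements \<open>U \<kappa>\<close>
    form a copy of the additive rationals.\<close>
  have U_mult: "U \<kappa> * U \<kappa>' = U (\<kappa> + \<kappa>')" for \<kappa> \<kappa>'
  proof -
    have e: "fps_const (\<iota> (\<kappa> + \<kappa>')) = fps_const (\<iota> \<kappa>) + fps_const (\<iota> \<kappa>')"
      by (simp add: \<iota>_def plus_dual_def zero_dual_def)
    show ?thesis unfolding U_def e by (simp add: algebra_simps nn' del: fps_const_add)
  qed
  have U0: "U 0 = 1"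
  proof -
    have "\<iota> 0 = 0" by (simp add: \<iota>_def zero_dual_def)
    then show ?thesis by (simp add: U_def)
  qed
  have U_nth: "U \<kappa> $ 0 = 1" for \<kappa> by (simp add: U_def)
  define Z :: "(rat dual dual fps \<times> rat dual dual fps \<times> rat dual dual fps) set"
    where "Z = {(u, t, d). (\<exists>\<kappa>. u = U \<kappa>) \<and> t $ 0 = 1}"
  have Zc: "Z \<subseteq> carrier tri" by (auto simp: Z_def tri_def U_nth)
  interpret T: group "tri :: (rat dual dual fps \<times> rat dual dual fps \<times> rat dual dual fps) monoid"
    by (rule group_tri)
  show ?thesis
  proof (rule magnus_hom[where Z = Z and St = St])
    show "subgroup Z tri"
    proof (rule T.subgroupI[OF Zc])
      have "(U 0, 1, 0) \<in> Z" by (auto simp: Z_def)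
      then show "Z \<noteq> {}" by blast
      show "x \<otimes>\<^bsub>tri\<^esub> y \<in> Z" if "x \<in> Z" "y \<in> Z" for x y
        using that U_mult by (auto simp: Z_def tri_def)
      show "inv\<^bsub>tri\<^esub> x \<in> Z" if x: "x \<in> Z" for x
      proof -
        obtain \<kappa> t d where xe: "x = (U \<kappa>, t, d)" using x by (auto simp: Z_def)
        obtain u' t' d' where i: "inv\<^bsub>tri\<^esub> x = (u', t', d')" by (cases "inv\<^bsub>tri\<^esub> x") auto
        have xc: "x \<in> carrier tri" using x Zc by auto
        then have "(u', t', d') \<in> carrier tri" unfolding i[symmetric] by simp
        moreover have "(u', t', d') \<otimes>\<^bsub>tri\<^esub> x = \<one>\<^bsub>tri\<^esub>" unfolding i[symmetric] using xc by simp
        then have "u' * U \<kappa> = 1" by (simp add: xe tri_def)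
        then have "u' * U \<kappa> * U (- \<kappa>) = U (- \<kappa>)" by simp
        then have "u' = U (- \<kappa>)" by (simp add: mult.assoc U_mult U0)
        ultimately show ?thesis unfolding i by (auto simp: Z_def tri_def)
      qed
    qed
    show "nil_rep i l c b p q \<in> Z" for p q
    proof -
      have \<iota>: "\<iota> 1 = 1" "\<iota> (- 1) = - 1" by (simp_all add: \<iota>_def one_dual_def zero_dual_def uminus_dual_def)
      have U1: "U 1 = 1 + fps_const \<nu>\<^sub>2 * fps_X" by (simp add: U_def \<iota> N)
      have U2: "U (- 1) = 1 - fps_const \<nu>\<^sub>2 * fps_X"
        by (simp add: U_def \<iota> N fps_const_neg[symmetric] del: fps_const_neg)
      have "fst (nil_rep i l c b p q) = U (if q = b \<and> p = l then 1 else if q = b \<and> p = c then - 1 else 0)"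
        by (simp add: nil_rep_def U1 U2 U0)
      moreover have "fst (snd (nil_rep i l c b p q)) $ 0 = 1" by (simp add: nil_rep_def)
      ultimately show ?thesis by (cases "nil_rep i l c b p q") (auto simp: Z_def)
    qed
    show "St v' x" if "St v x" "\<And>j. j \<in> {1..n} \<Longrightarrow> v' j = v j" for v v' x
      using that o by (auto simp: St_def K_def)
    have X_zero: "fps_X * f = 0 \<longleftrightarrow> f = 0" for f :: "rat dual dual fps"
    proof
      assume "fps_X * f = 0"
      then have "(fps_X * f) $ Suc m = 0" for m by simp
      then show "f = 0" by (intro fps_ext) simp
    qed simp
    show "z = \<one>\<^bsub>tri\<^esub>"
      if z: "z \<in> Z" "\<And>v x. St v x \<Longrightarrow> St v ((\<lambda>(u, t, d) (p, q). (u * p, t * q + d * p)) z x)" for z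
    proof -
      obtain \<kappa> t d where utd: "z = (U \<kappa>, t, d)" using z(1) by (auto simp: Z_def)
      \<comment> \<open>On this vector \<open>u\<close> is visible only after multiplication by
        \<open>N1\<close>. For \<open>u = U \<kappa>\<close> the comparison leaves
        \<open>\<kappa>\<close> times \<open>\<nu>\<^sub>1 * \<nu>\<^sub>2\<close>, which still
        determines \<open>\<kappa>\<close>.\<close>
      have St1: "St (\<lambda>j. if j = b then N2 else if j = c then N1 else 0) (- fps_X, 0)"
        using o by (auto simp: St_def K_def)
      have St2: "St (\<lambda>j. if j = i then 1 else 0) (0, - fps_X)"
        using o by (auto simp: St_def K_def)
      from z(2)[OF St1] have a: "- (fps_X * N1) = N1 * (U \<kappa> * (- fps_X))" "fps_X * d = 0"
        using o by (auto simp: St_def utd mult.commute)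
      from z(2)[OF St2] have "t * fps_X = fps_X" using o by (auto simp: St_def utd)
      then have "fps_X * (t - 1) = 0" by (simp add: algebra_simps)
      then have t: "t = 1" using X_zero by simp
      have "fps_X * (fps_X * (fps_const (\<iota> \<kappa>) * N1 * N2)) = 0"
        using a(1) by (simp add: U_def algebra_simps)
      then have "fps_const (\<iota> \<kappa>) * N1 * N2 = 0" by (simp only: X_zero)
      then have "\<iota> \<kappa> * \<nu>\<^sub>1 * \<nu>\<^sub>2 = 0" by (simp add: N)
      then have "du (du (\<iota> \<kappa> * \<nu>\<^sub>1 * \<nu>\<^sub>2)) = 0" by simp
      then have "\<kappa> = 0" by (simp add: \<iota>_def \<nu>\<^sub>1_def \<nu>\<^sub>2_def)
      then show ?thesis using a(2) X_zero U0 t by (simp add: utd tri_def)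
    qed
    fix q p and v :: "nat \<Rightarrow> rat dual dual fps" and x :: "rat dual dual fps \<times> rat dual dual fps"
    assume qp: "1 \<le> q" "q < p" "p \<le> n"
    obtain x1 x2 where x: "x = (x1, x2)" by (cases x) auto
    have c2: "fps_const (2 * y) = 2 * fps_const y" for y :: "rat dual dual"
      by (intro fps_ext) (simp add: numeral_fps_const)
    have rep: "nil_rep i l c b p q =
      (if q = b \<and> p = l then 1 + N2 * fps_X else if q = b \<and> p = c then 1 - N2 * fps_X else 1,
       if p = i \<and> q = l then 1 + fps_X else if p = i \<and> q = c then 1 + N1 * fps_X else 1,
       if p = i \<and> q = b then 2 * N2 else if p = i \<and> q = c then 2 * N1
       else if p = l \<and> q = b then - 2 * N2 else if p = l \<and> q = c then - 2 * N1 else 0)"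
      by (simp only: nil_rep_def N c2 mult_minus_left)
    define Y where "Y = - (fps_X * v i) - 2 * v l"
    define W where "W = N1 * fps_X * v l - fps_X * v c"
    have Stv: "St v x \<longleftrightarrow> (\<forall>j\<in>K. v j = 0) \<and> - (fps_X * v b) = N2 * x1 \<and> W = N1 * x1 \<and> x2 = Y"
      by (simp add: St_def x Y_def W_def)
    have supp: "(\<forall>j\<in>K. act p q v j = 0) \<longleftrightarrow> (\<forall>j\<in>K. v j = 0)"
    proof (cases "p \<in> K")
      case True
      then have "act p q v p = s q * v p" using s by (auto simp: act_def K_def)
      then have "act p q v p = 0 \<longleftrightarrow> v p = 0" by (simp add: s_zero)
      moreover have "act p q v j = v j" if "j \<noteq> p" for j using that by (simp add: act_def)
      ultimately show ?thesis by metis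
    qed (auto simp: act_def)
    have ne: "i \<noteq> l" "i \<noteq> c" "i \<noteq> b" "l \<noteq> c" "l \<noteq> b" "c \<noteq> b" "l \<noteq> i" "c \<noteq> i" "b \<noteq> i" "c \<noteq> l" "b \<noteq> l" "b \<noteq> c"
      using o by auto
    have sb: "s b = 1" using s(4)[of b] ne by auto
    \<comment> \<open>The three equations in \<open>St\<close> are transported in order: the second
      may use the first, and the third may use both.\<close>
    have key: "St (act p q v) ((\<lambda>(u, t, d) (p, q). (u * p, t * q + d * p)) (nil_rep i l c b p q) x) \<longleftrightarrow> St v x"
      if r: "nil_rep i l c b p q = (u, t, d)"
        and v': "act p q v b = vb" "act p q v c = vc" "act p q v l = vl" "act p q v i = vi"
        and F: "- (fps_X * vb) = N2 * (u * x1) \<longleftrightarrow> - (fps_X * v b) = N2 * x1"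
        and W: "- (fps_X * v b) = N2 * x1 \<Longrightarrow>
          N1 * fps_X * vl - fps_X * vc = N1 * (u * x1) \<longleftrightarrow> W = N1 * x1"
        and Y: "- (fps_X * v b) = N2 * x1 \<Longrightarrow> W = N1 * x1 \<Longrightarrow>
          t * x2 + d * x1 = - (fps_X * vi) - 2 * vl \<longleftrightarrow> x2 = Y"
      for u t d vb vc vl vi
      using supp F W Y unfolding Stv by (auto simp: St_def x r v')
    have A: "act p q v p = s q * v p + (1 - s p) * v q" "\<And>j. j \<noteq> p \<Longrightarrow> act p q v j = v j"
      by (simp_all add: act_def)
    consider "p = c" "q = b" | "p = l" "q = b" | "p = l" "q = c" | "p = i" "q = b" | "p = i" "q = c"
      | "p = i" "q = l" | "p \<in> {c, l, i}" "q \<notin> {b, c, l}" | "p = c" "q \<in> {c, l}" | "p = l" "q = l"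
      | "p \<notin> {c, l, i}"
      by blast
    then show "St (act p q v) ((\<lambda>(u, t, d) (p, q). (u * p, t * q + d * p)) (nil_rep i l c b p q) x) \<longleftrightarrow> St v x"
    proof cases
      case 1
      show ?thesis
      proof (rule key)
        show "nil_rep i l c b p q = (1 - N2 * fps_X, 1, 0)" unfolding rep by (simp only: 1 ne simp_thms if_True if_False)
        show "act p q v b = v b" "act p q v l = v l" "act p q v i = v i"
          using A(2) 1 ne by metis+
        show "act p q v c = v c - N1 * fps_X * v b"
          using A(1) by (simp add: 1 s sb W_def algebra_simps)
        show "- (fps_X * v b) = N2 * ((1 - N2 * fps_X) * x1) \<longleftrightarrow> - (fps_X * v b) = N2 * x1"
          by (simp add: algebra_simps nn')
        assume F: "- (fps_X * v b) = N2 * x1"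
        have "N1 * fps_X * v l - fps_X * (v c - N1 * fps_X * v b) = W - N1 * fps_X * (- (fps_X * v b))"
          by (simp add: W_def algebra_simps)
        then show "N1 * fps_X * v l - fps_X * (v c - N1 * fps_X * v b) = N1 * ((1 - N2 * fps_X) * x1)
            \<longleftrightarrow> W = N1 * x1"
          unfolding F by (simp add: algebra_simps)
      qed (simp add: Y_def)
    next
      case 2
      show ?thesis
      proof (rule key)
        show "nil_rep i l c b p q = (1 + N2 * fps_X, 1, - 2 * N2)" unfolding rep by (simp only: 2 ne simp_thms if_True if_False)
        show "act p q v b = v b" "act p q v c = v c" "act p q v i = v i"
          using A(2) 2 ne by metis+
        show "act p q v l = v l - fps_X * v b"
          using A(1) by (simp add: 2 s sb W_def algebra_simps)
        show "- (fps_X * v b) = N2 * ((1 + N2 * fps_X) * x1) \<longleftrightarrow> - (fps_X * v b) = N2 * x1"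
          by (simp add: algebra_simps nn')
        assume F: "- (fps_X * v b) = N2 * x1"
        have "N1 * fps_X * (v l - fps_X * v b) - fps_X * v c = W + N1 * fps_X * (- (fps_X * v b))"
          by (simp add: W_def algebra_simps)
        then show "N1 * fps_X * (v l - fps_X * v b) - fps_X * v c = N1 * ((1 + N2 * fps_X) * x1)
            \<longleftrightarrow> W = N1 * x1"
          unfolding F by (simp add: algebra_simps)
        have "- (fps_X * v i) - 2 * (v l - fps_X * v b) = Y - 2 * (- (fps_X * v b))"
          by (simp add: Y_def algebra_simps)
        then show "1 * x2 + - 2 * N2 * x1 = - (fps_X * v i) - 2 * (v l - fps_X * v b) \<longleftrightarrow> x2 = Y"
          unfolding F by (simp add: algebra_simps)
      qed
    next
      case 3
      show ?thesis
      proof (rule key)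
        show "nil_rep i l c b p q = (1, 1, - 2 * N1)" unfolding rep by (simp only: 3 ne simp_thms if_True if_False)
        show "act p q v b = v b" "act p q v c = v c" "act p q v i = v i"
          using A(2) 3 ne by metis+
        show "act p q v l = v l + W"
          using A(1) by (simp add: 3 s sb W_def algebra_simps)
        show "- (fps_X * v b) = N2 * (1 * x1) \<longleftrightarrow> - (fps_X * v b) = N2 * x1" by simp
        have eq: "N1 * fps_X * (v l + W) - fps_X * v c = W + N1 * fps_X * W"
          by (simp add: W_def algebra_simps)
        show "N1 * fps_X * (v l + W) - fps_X * v c = N1 * (1 * x1) \<longleftrightarrow> W = N1 * x1"
        proof
          assume "N1 * fps_X * (v l + W) - fps_X * v c = N1 * (1 * x1)"
          then have W: "W + N1 * fps_X * W = N1 * x1" using eq by simp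
          \<comment> \<open>Multiplication by \<open>N1\<close> removes both the correction term and
            the right side, so \<open>N1 * W = 0\<close> and the correction vanishes.\<close>
          from arg_cong[OF this, of "\<lambda>z. N1 * z"] have "N1 * W = 0" by (simp add: algebra_simps nn')
          then have "N1 * fps_X * W = 0" by (simp add: mult.commute mult.left_commute)
          then show "W = N1 * x1" using W by simp
        next
          assume "W = N1 * x1"
          then show "N1 * fps_X * (v l + W) - fps_X * v c = N1 * (1 * x1)"
            unfolding eq by (simp add: algebra_simps nn')
        qed
        assume W: "W = N1 * x1"
        have "- (fps_X * v i) - 2 * (v l + W) = Y - 2 * W" by (simp add: Y_def algebra_simps)
        then show "1 * x2 + - 2 * N1 * x1 = - (fps_X * v i) - 2 * (v l + W) \<longleftrightarrow> x2 = Y"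
          unfolding W by (simp add: algebra_simps)
      qed
    next
      case 4
      show ?thesis
      proof (rule key)
        show "nil_rep i l c b p q = (1, 1, 2 * N2)" unfolding rep by (simp only: 4 ne simp_thms if_True if_False)
        show "act p q v b = v b" "act p q v c = v c" "act p q v l = v l"
          using A(2) 4 ne by metis+
        show "act p q v i = v i + 2 * v b"
          using A(1) by (simp add: 4 s sb W_def algebra_simps)
        assume F: "- (fps_X * v b) = N2 * x1"
        have "- (fps_X * (v i + 2 * v b)) - 2 * v l = Y + 2 * (- (fps_X * v b))"
          by (simp add: Y_def algebra_simps)
        then show "1 * x2 + 2 * N2 * x1 = - (fps_X * (v i + 2 * v b)) - 2 * v l \<longleftrightarrow> x2 = Y"
          unfolding F by (simp add: algebra_simps)
      qed (simp_all add: W_def)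
    next
      case 5
      show ?thesis
      proof (rule key)
        show "nil_rep i l c b p q = (1, s c, 2 * N1)" unfolding rep by (simp only: 5 ne simp_thms if_True if_False s)
        show "act p q v b = v b" "act p q v c = v c" "act p q v l = v l"
          using A(2) 5 ne by metis+
        show "act p q v i = s c * v i + 2 * v c"
          using A(1) by (simp add: 5 s sb W_def algebra_simps)
        assume W: "W = N1 * x1"
        have "- (fps_X * (s c * v i + 2 * v c)) - 2 * v l = s c * Y + 2 * W"
          by (simp add: Y_def W_def s algebra_simps)
        then show "s c * x2 + 2 * N1 * x1 = - (fps_X * (s c * v i + 2 * v c)) - 2 * v l \<longleftrightarrow> x2 = Y"
          unfolding W by (simp add: s_cancel mult.assoc)
      qed (simp_all add: W_def)
    next
      case 6
      show ?thesis
      proof (rule key)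
        show "nil_rep i l c b p q = (1, s l, 0)" unfolding rep by (simp only: 6 ne simp_thms if_True if_False s)
        show "act p q v b = v b" "act p q v c = v c" "act p q v l = v l"
          using A(2) 6 ne by metis+
        show "act p q v i = s l * v i + 2 * v l"
          using A(1) by (simp add: 6 s sb W_def algebra_simps)
        have "- (fps_X * (s l * v i + 2 * v l)) - 2 * v l = s l * Y"
          by (simp add: Y_def s algebra_simps)
        then show "s l * x2 + 0 * x1 = - (fps_X * (s l * v i + 2 * v l)) - 2 * v l \<longleftrightarrow> x2 = Y"
          by (simp add: s_cancel)
      qed (simp_all add: W_def)
    next
      \<comment> \<open>The index \<open>q\<close> lies in \<open>K\<close> and
        \<open>s q = 1\<close>, so \<open>act p q\<close> fixes every vector vanishing on
        \<open>K\<close>.\<close>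
      case 7
      have r: "nil_rep i l c b p q = (1, 1, 0)" unfolding rep using 7 by auto
      have "q \<in> K" using 7 qp o by (auto simp: K_def)
      moreover have "s q = 1" using 7 qp o s by auto
      ultimately have "act p q v = v" if "\<forall>j\<in>K. v j = 0" using that by (simp add: act_def)
      then show ?thesis using supp by (auto simp: St_def x r)
    next
      case 8
      then show ?thesis using qp o by auto
    next
      case 9
      then show ?thesis using qp by auto
    next
      case 10
      show ?thesis
      proof (rule key)
        show "nil_rep i l c b p q = (1, 1, 0)" unfolding rep using 10 by auto
        show "act p q v b = v b"
        proof (cases "p = b")
          case True
          then have "s q = 1" using qp o s by auto
          then show ?thesis using True sb by (simp add: act_def)
        qed (simp add: act_def)
        show "act p q v c = v c" "act p q v l = v l" "act p q v i = v i" using 10 by (auto simp: act_def)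
      qed (simp_all add: W_def Y_def)
    qed
  qed
qed


section \<open>The metabelian quotient of the upper McCool group\<close>

lemma free_hom_eq:
  assumes H: "group H" and h: "h \<in> hom (free_group X) H" "k \<in> hom (free_group X) H"
    and eq: "\<And>x. x \<in> X \<Longrightarrow> h (free_gen x) = k (free_gen x)" and w: "w \<in> carrier (free_group X)"
  shows "h w = k w"
  using group.free_lift_unique[OF H h(1) refl w] group.free_lift_unique[OF H h(2) _ w, of "\<lambda>x. h (free_gen x)"] eq
  by simp

lemma alpha_eqI:
  assumes g: "g \<in> carrier (AutoGroup (Free n))" "h \<in> carrier (AutoGroup (Free n))"
    and eq: "\<And>m. m \<in> {1..n} \<Longrightarrow> g (free_gen m) = h (free_gen m)"
  shows "g = h"
  using free_hom_eq[OF group_free_group AutoGroup_hom[OF g(1)] AutoGroup_hom[OF g(2)] eq]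
  by (rule AutoGroup_eqI[OF g])

text \<open>Both sides are automorphisms, so it suffices to compare them on the free generators;
  multiplication in the automorphism group is composition with the right factor applied
  first.\<close>

lemma alpha_relations:
  fixes n :: nat
  defines "A \<equiv> AutoGroup (Free n)"
  shows "\<And>i j k l. \<lbrakk>1 \<le> j; j < i; i \<le> n; 1 \<le> l; l < k; k \<le> n; {i, j} \<inter> {k, l} = {}\<rbrakk> \<Longrightarrow>
      alpha n i j \<otimes>\<^bsub>A\<^esub> alpha n k l = alpha n k l \<otimes>\<^bsub>A\<^esub> alpha n i j"
    and "\<And>i j k. \<lbrakk>1 \<le> j; j < k; k < i; i \<le> n\<rbrakk> \<Longrightarrow>
      alpha n i j \<otimes>\<^bsub>A\<^esub> alpha n k j = alpha n k j \<otimes>\<^bsub>A\<^esub> alpha n i j"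
    and "\<And>i j k. \<lbrakk>1 \<le> j; j < k; k < i; i \<le> n\<rbrakk> \<Longrightarrow>
      alpha n i k \<otimes>\<^bsub>A\<^esub> (alpha n i j \<otimes>\<^bsub>A\<^esub> alpha n k j) = (alpha n i j \<otimes>\<^bsub>A\<^esub> alpha n k j) \<otimes>\<^bsub>A\<^esub> alpha n i k"
proof -
  interpret A: group A unfolding A_def by (rule group.AutoGroup[OF group_free_group])
  interpret F: group "Free n" by (rule group_free_group)
  have g: "free_gen m \<in> carrier (Free n)" if "1 \<le> m" "m \<le> n" for m using that by (intro free_gen_closed) auto
  have c: "alpha n i j \<in> carrier A" if "1 \<le> j" "j < i" "i \<le> n" for i j
    using that unfolding A_def by (intro alpha_auto) auto
  have hom: "group_hom (Free n) (Free n) (alpha n i j)" if "1 \<le> j" "j < i" "i \<le> n" for i j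
    using AutoGroup_hom[OF c[OF that, unfolded A_def]]
    by (intro group_hom.intro group_hom_axioms.intro group_free_group)
  have gen: "alpha n i j (free_gen m) = (if m = i
      then free_gen j \<otimes>\<^bsub>Free n\<^esub> free_gen i \<otimes>\<^bsub>Free n\<^esub> inv\<^bsub>Free n\<^esub> (free_gen j) else free_gen m)"
    if "1 \<le> j" "j < i" "i \<le> n" "1 \<le> m" "m \<le> n" for i j m
    using alpha_gen[of i n j] that by auto
  have mult': "(x \<otimes>\<^bsub>A\<^esub> y) w = x (y w)"
    if "x \<in> carrier A" "y \<in> carrier A" "w \<in> carrier (Free n)" for x y w
    using AutoGroup_mult_apply[of x "Free n" y w] that by (simp add: A_def)
  note eqI = alpha_eqI[of _ n, folded A_def]
  {
    fix i j k l assume i: "1 \<le> j" "j < i" "i \<le> n" "1 \<le> l" "l < k" "k \<le> n" "{i, j} \<inter> {k, l} = {}"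
    have cs: "alpha n i j \<in> carrier A" "alpha n k l \<in> carrier A" using i by (auto intro: c)
    have gs: "free_gen i \<in> carrier (Free n)" "free_gen j \<in> carrier (Free n)"
      "free_gen k \<in> carrier (Free n)" "free_gen l \<in> carrier (Free n)"
      using i by (auto intro: g)
    interpret ij: group_hom "Free n" "Free n" "alpha n i j" using i by (intro hom) auto
    interpret kl: group_hom "Free n" "Free n" "alpha n k l" using i by (intro hom) auto
    have m4: "1 \<le> i" "j \<le> n" "1 \<le> k" "l \<le> n" "i \<noteq> k" "i \<noteq> l" "j \<noteq> k" "j \<noteq> l" "k \<noteq> i" "l \<noteq> i"
      using i by auto
    have ij: "alpha n i j (free_gen m) = (if m = i
        then free_gen j \<otimes>\<^bsub>Free n\<^esub> free_gen i \<otimes>\<^bsub>Free n\<^esub> inv\<^bsub>Free n\<^esub> (free_gen j) else free_gen m)"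
      and kl: "alpha n k l (free_gen m) = (if m = k
        then free_gen l \<otimes>\<^bsub>Free n\<^esub> free_gen k \<otimes>\<^bsub>Free n\<^esub> inv\<^bsub>Free n\<^esub> (free_gen l) else free_gen m)"
      if "1 \<le> m" "m \<le> n" for m
      using gen[of j i m] gen[of l k m] i that by simp_all
    have eq: "alpha n i j (alpha n k l (free_gen m)) = alpha n k l (alpha n i j (free_gen m))"
      if m: "1 \<le> m" "m \<le> n" for m
    proof -
      consider "m = i" | "m = k" | "m \<noteq> i" "m \<noteq> k" by blast
      then show ?thesis
        by (cases; simp add: m m4 i(1,3,4,6) gs ij kl)
    qed
    show "alpha n i j \<otimes>\<^bsub>A\<^esub> alpha n k l = alpha n k l \<otimes>\<^bsub>A\<^esub> alpha n i j"
      using cs g eq by (intro eqI) (simp_all add: mult')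
  }
  {
    fix i j k assume i: "1 \<le> j" "j < k" "k < i" "i \<le> n"
    have cs: "alpha n i k \<in> carrier A" "alpha n i j \<in> carrier A" "alpha n k j \<in> carrier A"
      using i by (auto intro: c)
    have gs: "free_gen i \<in> carrier (Free n)" "free_gen j \<in> carrier (Free n)" "free_gen k \<in> carrier (Free n)"
      using i by (auto intro: g)
    interpret ik: group_hom "Free n" "Free n" "alpha n i k" using i by (intro hom) auto
    interpret ij: group_hom "Free n" "Free n" "alpha n i j" using i by (intro hom) auto
    interpret kj: group_hom "Free n" "Free n" "alpha n k j" using i by (intro hom) auto
    have m3: "1 \<le> i" "j \<le> n" "1 \<le> k" "k \<le> n" "j < i" "i \<noteq> j" "i \<noteq> k" "j \<noteq> i" "j \<noteq> k" "k \<noteq> i" "k \<noteq> j"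
      using i by auto
    have ik: "alpha n i k (free_gen m) = (if m = i
        then free_gen k \<otimes>\<^bsub>Free n\<^esub> free_gen i \<otimes>\<^bsub>Free n\<^esub> inv\<^bsub>Free n\<^esub> (free_gen k) else free_gen m)"
      and ij: "alpha n i j (free_gen m) = (if m = i
        then free_gen j \<otimes>\<^bsub>Free n\<^esub> free_gen i \<otimes>\<^bsub>Free n\<^esub> inv\<^bsub>Free n\<^esub> (free_gen j) else free_gen m)"
      and kj: "alpha n k j (free_gen m) = (if m = k
        then free_gen j \<otimes>\<^bsub>Free n\<^esub> free_gen k \<otimes>\<^bsub>Free n\<^esub> inv\<^bsub>Free n\<^esub> (free_gen j) else free_gen m)"
      if "1 \<le> m" "m \<le> n" for m
      using gen[of k i m] gen[of j i m] gen[of j k m] i m3 that by simp_all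
    have eq: "alpha n i j (alpha n k j (free_gen m)) = alpha n k j (alpha n i j (free_gen m))"
      "alpha n i k (alpha n i j (alpha n k j (free_gen m))) = alpha n i j (alpha n k j (alpha n i k (free_gen m)))"
      if m: "1 \<le> m" "m \<le> n" for m
    proof -
      consider "m = i" | "m = k" | "m \<noteq> i" "m \<noteq> k" by blast
      then show "alpha n i j (alpha n k j (free_gen m)) = alpha n k j (alpha n i j (free_gen m))"
        "alpha n i k (alpha n i j (alpha n k j (free_gen m))) = alpha n i j (alpha n k j (alpha n i k (free_gen m)))"
        by (cases; simp add: m m3 i gs ik ij kj F.m_assoc F.inv_mult_group)+
    qed
    show "alpha n i j \<otimes>\<^bsub>A\<^esub> alpha n k j = alpha n k j \<otimes>\<^bsub>A\<^esub> alpha n i j"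
      using cs g eq(1) by (intro eqI) (simp_all add: mult')
    show "alpha n i k \<otimes>\<^bsub>A\<^esub> (alpha n i j \<otimes>\<^bsub>A\<^esub> alpha n k j) = (alpha n i j \<otimes>\<^bsub>A\<^esub> alpha n k j) \<otimes>\<^bsub>A\<^esub> alpha n i k"
      using cs g eq(2) by (intro eqI) (simp_all add: mult')
  }
qed

lemma (in group) hom_quotient:
  assumes "N \<lhd> G"
  shows "group_hom G (G Mod N) (\<lambda>x. N #> x)" "(\<lambda>x. N #> x) ` carrier G = carrier (G Mod N)"
proof -
  interpret N: normal N G by (rule assms)
  show "group_hom G (G Mod N) (\<lambda>x. N #> x)"
    using N.r_coset_hom_Mod N.factorgroup_is_group is_group
    by (intro group_hom.intro group_hom_axioms.intro)
  show "(\<lambda>x. N #> x) ` carrier G = carrier (G Mod N)" by (auto simp: carrier_FactGroup)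
qed

lemma (in group) metabelian_quotient: "metabelian (G Mod second_derived G)"
proof -
  let ?N = "second_derived G" and ?M = "G Mod second_derived G"
  interpret N: normal ?N G by (rule second_derived_normal)
  interpret \<pi>: group_hom G ?M "\<lambda>x. ?N #> x" by (rule hom_quotient(1)[OF second_derived_normal])
  have \<gamma>: "lower_central ?M 2 = (\<lambda>x. ?N #> x) ` derived G (carrier G)"
    using \<pi>.derived_img[of "carrier G"] \<pi>.H.lower_central_2 hom_quotient(2)[OF second_derived_normal] by simp
  have "x \<otimes>\<^bsub>?M\<^esub> y = y \<otimes>\<^bsub>?M\<^esub> x" if xy: "x \<in> lower_central ?M 2" "y \<in> lower_central ?M 2" for x y
  proof -
    obtain g h where gh: "g \<in> derived G (carrier G)" "h \<in> derived G (carrier G)" "x = ?N #> g" "y = ?N #> h"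
      using xy \<gamma> by auto
    have c: "g \<in> carrier G" "h \<in> carrier G" using gh derived_in_carrier by blast+
    have "cm g h \<in> ?N"
      unfolding second_derived_def derived_def[of G "derived G (carrier G)"] cm_def
      using gh by (intro generate.incl) blast
    then have "?N #> cm g h = \<one>\<^bsub>?M\<^esub>" by (simp add: coset_join2 N.subgroup_axioms N.subset[THEN subsetD])
    moreover have "g \<otimes> h = cm g h \<otimes> (h \<otimes> g)" using c by (simp add: cm_def m_assoc)
    ultimately have "?N #> (g \<otimes> h) = ?N #> (h \<otimes> g)"
      using c \<pi>.hom_mult[of "cm g h" "h \<otimes> g"] \<pi>.H.l_one[of "?N #> (h \<otimes> g)"] by (metis cm_closed m_closed \<pi>.hom_closed)
    then show ?thesis using c gh by (metis \<pi>.hom_mult)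
  qed
  then show ?thesis by (intro metabelian.intro metabelian_axioms.intro \<pi>.H.is_group)
qed

text \<open>On the derived subgroup the diagonal is 1, and unipotent triangular matrices of size 2
  commute. Hence these representations descend to the metabelian quotient.\<close>

lemma (in tri_rep) second_derived_kernel: "second_derived G \<subseteq> kernel G tri \<Psi>"
proof -
  interpret \<Psi>: group_hom G tri \<Psi>
    using \<Psi>_hom by (intro group_hom.intro group_hom_axioms.intro group_tri is_group)
  have "\<Psi> (cm g h) = \<one>\<^bsub>tri\<^esub>" if "g \<in> derived G (carrier G)" "h \<in> derived G (carrier G)" for g h
  proof -
    have m: "g \<in> \<gamma> (Suc 1)" "h \<in> \<gamma> (Suc 1)" using that lower_central_2 by (auto simp: numeral_2_eq_2 One_nat_def)
    then have c: "g \<in> carrier G" "h \<in> carrier G" using lower_central_carrier by blast+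
    have "D (cm g h) = 0" using t_D_cm[OF c] ut_derived[OF m(1)] ut_derived[OF m(2)] by simp
    moreover have "u (cm g h) = 1" "t (cm g h) = 1" using ut_cm c by auto
    ultimately show ?thesis
      by (cases "\<Psi> (cm g h)") (simp add: u_def t_def D_def tri_def)
  qed
  then have "derived_set G (derived G (carrier G)) \<subseteq> kernel G tri \<Psi>"
    using derived_in_carrier[of "carrier G"] by (auto simp: kernel_def cm_def[symmetric] subset_iff)
  then show ?thesis
    unfolding second_derived_def derived_def[of G "derived G (carrier G)"]
    by (intro generate_subgroup_incl \<Psi>.subgroup_kernel)
qed

lemma hom_metabelian_quotient:
  assumes "group G" "\<Psi> \<in> hom G (tri :: ('k::comm_ring_1 fps \<times> 'k fps \<times> 'k fps) monoid)"
  shows "\<exists>\<Phi>\<in>hom (G Mod second_derived G) tri. \<forall>x\<in>carrier G. \<Phi> (second_derived G #>\<^bsub>G\<^esub> x) = \<Psi> x"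
proof -
  interpret group G by (rule assms)
  interpret tri_rep G \<Psi> using assms(2) by unfold_locales
  interpret \<Psi>: group_hom G tri \<Psi>
    using \<Psi>_hom by (intro group_hom.intro group_hom_axioms.intro group_tri is_group)
  from \<Psi>.FactGroup_universal_kernel[OF second_derived_normal second_derived_kernel]
  show ?thesis by metis
qed

theorem mccool_functionals_quotient:
  fixes n :: nat
  defines "G \<equiv> upper_McCool n"
  shows "mccool_functionals (G Mod second_derived G) n (\<lambda>i j. second_derived G #>\<^bsub>G\<^esub> alpha n i j)"
proof -
  let ?A = "AutoGroup (Free n)" and ?N = "second_derived G" and ?M = "G Mod second_derived G"
  let ?\<pi> = "\<lambda>x. second_derived G #>\<^bsub>G\<^esub> x"
  interpret A: group ?A by (rule group.AutoGroup[OF group_free_group])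
  interpret G: group G unfolding G_def by (rule group_upper_McCool)
  interpret M: metabelian ?M by (rule G.metabelian_quotient)
  interpret \<pi>: group_hom G ?M ?\<pi> by (rule G.hom_quotient(1)[OF G.second_derived_normal])
  have gens: "upper_McCool_gens n \<subseteq> carrier ?A"
    by (auto simp: upper_McCool_gens_def intro!: alpha_auto)
  have GA: "x \<otimes>\<^bsub>G\<^esub> y = x \<otimes>\<^bsub>?A\<^esub> y" for x y by (simp add: G_def upper_McCool_def)
  have cG: "carrier G = generate ?A (upper_McCool_gens n)" by (simp add: G_def upper_McCool_def)
  have sub: "upper_McCool_gens n \<subseteq> carrier G" unfolding cG by (auto intro: generate.incl)
  have c: "alpha n i j \<in> carrier G" if "1 \<le> j" "j < i" "i \<le> n" for i j
    using that sub by (auto simp: upper_McCool_gens_def)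
  have genG: "generate G (upper_McCool_gens n) = carrier G"
    using A.generate_consistent[OF _ A.generate_is_subgroup[OF gens], of "upper_McCool_gens n"] sub cG
    by (simp add: G_def upper_McCool_def)
  have image: "?\<pi> ` upper_McCool_gens n = {?\<pi> (alpha n i j) | i j. 1 \<le> j \<and> j < i \<and> i \<le> n}"
    by (auto simp: upper_McCool_gens_def)
  show ?thesis
  proof (intro mccool_functionals.intro mccool_quotient.intro mccool_quotient_axioms.intro
      mccool_functionals_axioms.intro M.metabelian_axioms)
    show "?\<pi> (alpha n i j) \<in> carrier ?M" if "1 \<le> j" "j < i" "i \<le> n" for i j
      using c[OF that] by (rule \<pi>.hom_closed)
    have "carrier ?M = ?\<pi> ` generate G (upper_McCool_gens n)"
      using G.hom_quotient(2)[OF G.second_derived_normal] genG by simp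
    then show "carrier ?M \<subseteq> generate ?M {?\<pi> (alpha n i j) | i j. 1 \<le> j \<and> j < i \<and> i \<le> n}"
      using \<pi>.generate_img[OF sub] image by simp
  next
    fix i j k l assume i: "1 \<le> j" "j < i" "i \<le> n" "1 \<le> l" "l < k" "k \<le> n" "{i, j} \<inter> {k, l} = {}"
    show "?\<pi> (alpha n i j) \<otimes>\<^bsub>?M\<^esub> ?\<pi> (alpha n k l) = ?\<pi> (alpha n k l) \<otimes>\<^bsub>?M\<^esub> ?\<pi> (alpha n i j)"
      using alpha_relations(1)[OF i] c i by (simp only: \<pi>.hom_mult[symmetric] GA)
  next
    fix i j k assume i: "1 \<le> j" "j < k" "k < i" "i \<le> n"
    have cs: "alpha n i j \<in> carrier G" "alpha n k j \<in> carrier G" "alpha n i k \<in> carrier G"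
      using i by (auto intro: c)
    show "?\<pi> (alpha n i j) \<otimes>\<^bsub>?M\<^esub> ?\<pi> (alpha n k j) = ?\<pi> (alpha n k j) \<otimes>\<^bsub>?M\<^esub> ?\<pi> (alpha n i j)"
      using alpha_relations(2)[OF i] cs by (simp only: \<pi>.hom_mult[symmetric] GA)
    show "?\<pi> (alpha n i k) \<otimes>\<^bsub>?M\<^esub> (?\<pi> (alpha n i j) \<otimes>\<^bsub>?M\<^esub> ?\<pi> (alpha n k j)) =
        (?\<pi> (alpha n i j) \<otimes>\<^bsub>?M\<^esub> ?\<pi> (alpha n k j)) \<otimes>\<^bsub>?M\<^esub> ?\<pi> (alpha n i k)"
      using alpha_relations(3)[OF i] cs G.m_closed[OF cs(1,2)]
      by (simp only: \<pi>.hom_mult[symmetric] GA)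
  next
    fix i l and w :: "nat \<Rightarrow> rat" assume "1 \<le> l" "l < i" "i \<le> n"
    from lin_rep_exists[OF this, of w] show "\<exists>\<Psi>\<in>hom ?M tri. \<forall>p q. 1 \<le> q \<and> q < p \<and> p \<le> n \<longrightarrow>
        \<Psi> (?\<pi> (alpha n p q)) = lin_rep i l w p q"
      using hom_metabelian_quotient[OF G.is_group] c unfolding G_def[symmetric] by metis
  next
    fix i l c' b assume "1 \<le> b" "b < c'" "c' < l" "l < i" "i \<le> n"
    from nil_rep_exists[OF this] show "\<exists>\<Psi>\<in>hom ?M tri. \<forall>p q. 1 \<le> q \<and> q < p \<and> p \<le> n \<longrightarrow>
        \<Psi> (?\<pi> (alpha n p q)) = nil_rep i l c' b p q"
      using hom_metabelian_quotient[OF G.is_group] c unfolding G_def[symmetric] by metis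
  qed
qed

theorem theorem1p1:
  fixes n :: nat
  assumes "n \<ge> 1"
  shows "chen_rank (upper_McCool n) 1 = enat (n choose 2) \<and>
         chen_rank (upper_McCool n) 2 = enat (n choose 3) \<and>
         (\<forall>k\<ge>3. chen_rank (upper_McCool n) k =
            enat (((n + 1) choose 4) + (\<Sum>i=3..k. (n + i - 2) choose (i + 1))))"
  unfolding chen_rank_def
  by (rule mccool_functionals.graded_ranks[OF mccool_functionals_quotient])

end
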